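(* Let $(X,\mathcal F)$ be a strongly equicontinuous, compact and quasi-effective foliated space. Then the closure of each leaf is a homogeneous space.
   Context: A topological space is homogeneous if the pseudogroup of all its local homeomorphisms (all homeomorphisms between open subsets) has exactly one orbit. **Foliated spaces.** A locally compact Polish space $X$ is a foliated space if it has an open cover $\{U_i\}$ with homeomorphisms $\phi_i:U_i\to B_i\times Z_i$ (flow boxes), $B_i$ an open ball of finite radius in $\mathbb R^n$, $Z_i$ a Polish space, with coordinate changes $\phi_i\circ\phi_j^{-1}(x_j,z_j)=(x_i(x_j,z_j),z_i(z_j))$, $z_i$ continuous, and $x_i$ of class $C^k$ in the sense that its partial derivatives up to order $k$ in the $\mathbb R^n$-directions exist and are continuous in $(x_j,z_j)$. The sets $\phi_i^{-1}(B_i\times\{z\})$ are plaques. The leaves are the connected components of $X$ in the finer topology with basis the open subsets of plaques. **Holonomy pseudogroup.** Let $p_i:U_i\to Z_i$ be the composite of $\phi_i$ with the projection $B_i\times Z_i\to Z_i$, and $Z_{i,j}=p_i(U_i\cap U_j)$. For a suitable (regular) cover there are homeomorphisms $h_{i,j}:Z_{i,j}\to Z_{j,i}$ with $p_j=h_{i,j}\circ p_i$ on $U_i\cap U_j$. The $h_{i,j}$ generate a pseudogroup $\mathcal H$ on $Z=\bigsqcup_iZ_i$, the holonomy pseudogroup. **Pseudogroups.** A pseudogroup of local transformations of a space $Z$ is a collection $\mathcal H$ of homeomorphisms between open subsets of $Z$ containing $\mathrm{id}_Z$ and closed under composition (wherever defined), inversion, restriction to open sets and combination (union) of maps. It is generated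 by $E\subset\mathcal H$ if all its elements are obtained from $E$ by these operations. $E$ is symmetric if $h\in E\Rightarrow h^{-1}\in E$. The orbit of $x$ is $\{h(x): h\in\mathcal H,\ x\in\operatorname{dom}h\}$. **Quasi-local metrics.** A cover of a set $Z$ by quasi-locally equal metric spaces is a family $\{(Z_i,d_i)\}_{i\in I}$ of metric spaces with $Z=\bigcup_iZ_i$, each $Z_i\cap Z_j$ open in $(Z_i,d_i)$ and in $(Z_j,d_j)$, such that for all $\varepsilon>0$ there is $\delta(\varepsilon)>0$ so that: for all $i,j\in I$ and $z\in Z_i\cap Z_j$ there is an open neighborhood $U_{i,j,z}$ of $z$ in $Z_i\cap Z_j$ with $d_i(x,y)<\delta(\varepsilon)\Rightarrow d_j(x,y)<\varepsilon$ for all $\varepsilon>0$ and $x,y\in U_{i,j,z}$. Two such families are equivalent if their union is again such a family; an equivalence class $\mathfrak Q$ is a quasi-local metric. It induces a topology on $Z$ with base the open balls of all $(Z_i,d_i)$. **Strong equicontinuity.** A pseudogroup $\mathcal H$ on a space $Z$ is strongly equicontinuous if there are a quasi-local metric $\mathfrak Q$ inducing the topology of $Z$, some $\{(Z_i,d_i)\}_{i\in I}\in\mathfrak Q$ and a symmetric set $S$ of generators of $\mathcal H$, closed under compositions, such that for every $\varepsilon>0$ there is $\delta(\varepsilon)>0$ with $d_i(x,y)<\delta(\varepsilon)\Rightarrow d_j(h(x),h(y))<\varepsilon$ for all $h\in S$, $i,j\in I$ and $x,y\in Z_i\cap h^{-1}(Z_j\cap\operatorname{im}h)$. **Quasi-effectiveness.**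 $\mathcal H$ is quasi-effective if it is generated by some symmetric set $S$, closed under compositions, such that any transformation in $S$ is the identity on its domain if it is the identity on some non-empty open subset of its domain. A foliated space is strongly equicontinuous (resp. quasi-effective) if its holonomy pseudogroup is (this is independent of the chosen representative). *)

theory Defs
  imports "HOL-Analysis.Analysis" "HOL-Library.Extended_Nat"
begin

section \<open>Pseudogroups\<close>

text \<open>
  A partial map of a space is represented by its graph, a binary relation. So \<open>h O g\<close> is
  ``first \<open>h\<close>, then \<open>g\<close>'', composed wherever defined; \<open>h\<inverse>\<close> is the inverse map;
  \<open>Id_on V O h\<close> is the restriction of \<open>h\<close> to \<open>V\<close>; the combination of a family of maps
  is the union of the graphs. The empty map counts as a local homeomorphism.
\<close>

definition local_homeomorphism :: "'a topology \<Rightarrow> ('a \<times> 'a) set \<Rightarrow> bool" where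
  "local_homeomorphism T h \<longleftrightarrow>
     openin T (Domain h) \<and> openin T (Range h) \<and>
     (\<exists>f. homeomorphic_map (subtopology T (Domain h)) (subtopology T (Range h)) f \<and>
          h = (\<lambda>x. (x, f x)) ` Domain h)"

definition pseudogroup :: "'a topology \<Rightarrow> ('a \<times> 'a) set set \<Rightarrow> bool" where
  "pseudogroup T H \<longleftrightarrow>
     (\<forall>h\<in>H. local_homeomorphism T h) \<and>
     Id_on (topspace T) \<in> H \<and>
     (\<forall>h\<in>H. \<forall>g\<in>H. h O g \<in> H) \<and>
     (\<forall>h\<in>H. h\<inverse> \<in> H) \<and>
     (\<forall>h\<in>H. \<forall>V. openin T V \<longrightarrow> Id_on V O h \<in> H) \<and>
     (\<forall>G\<subseteq>H. local_homeomorphism T (\<Union>G) \<longrightarrow> \<Union>G \<in> H)"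

inductive_set generated_pseudogroup :: "'a topology \<Rightarrow> ('a \<times> 'a) set set \<Rightarrow> ('a \<times> 'a) set set"
  for T E where
  base: "h \<in> E \<Longrightarrow> h \<in> generated_pseudogroup T E"
| ident: "Id_on (topspace T) \<in> generated_pseudogroup T E"
| comp: "h \<in> generated_pseudogroup T E \<Longrightarrow> g \<in> generated_pseudogroup T E \<Longrightarrow>
    h O g \<in> generated_pseudogroup T E"
| inverse: "h \<in> generated_pseudogroup T E \<Longrightarrow> h\<inverse> \<in> generated_pseudogroup T E"
| restrict: "h \<in> generated_pseudogroup T E \<Longrightarrow> openin T V \<Longrightarrow>
    Id_on V O h \<in> generated_pseudogroup T E"
| combine: "(\<And>g. g \<in> G \<Longrightarrow> g \<in> generated_pseudogroup T E) \<Longrightarrow> local_homeomorphism T (\<Union>G) \<Longrightarrow>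
    \<Union>G \<in> generated_pseudogroup T E"

lemma local_homeomorphism_iff:
  "local_homeomorphism T h \<longleftrightarrow>
     h \<subseteq> topspace T \<times> topspace T \<and> single_valued h \<and> single_valued (h\<inverse>) \<and>
     (\<forall>V. openin T V \<longrightarrow> openin T (h `` V)) \<and> (\<forall>V. openin T V \<longrightarrow> openin T (h\<inverse> `` V))"
    (is "?L \<longleftrightarrow> ?R")
proof
  assume ?L
  then obtain f where o: "openin T (Domain h)" "openin T (Range h)"
    and f: "homeomorphic_map (subtopology T (Domain h)) (subtopology T (Range h)) f"
    and h: "h = (\<lambda>x. (x, f x)) ` Domain h"
    by (auto simp: local_homeomorphism_def)
  have D: "Domain h \<subseteq> topspace T" and R: "Range h \<subseteq> topspace T"
    using o openin_subset by blast+
  have t: "topspace (subtopology T (Domain h)) = Domain h"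
    using D by auto
  have inj: "inj_on f (Domain h)"
    using f t by (metis homeomorphic_map_def)
  have mem: "(x, y) \<in> h \<longleftrightarrow> x \<in> Domain h \<and> y = f x" for x y
    by (subst h) auto
  have "openin T (h `` V)" if "openin T V" for V
  proof -
    have "openin (subtopology T (Domain h)) (Domain h \<inter> V)"
      using that by (metis inf_commute openin_subtopology_Int2)
    then have "openin (subtopology T (Range h)) (f ` (Domain h \<inter> V))"
      using f homeomorphic_imp_open_map open_map_def by blast
    moreover have "h `` V = f ` (Domain h \<inter> V)"
      using mem by auto
    ultimately show ?thesis
      using o openin_trans_full by metis
  qed
  moreover have "openin T (h\<inverse> `` V)" if "openin T V" for V
  proof -
    have "continuous_map (subtopology T (Domain h)) (subtopology T (Range h)) f"
      using f by (simp add: homeomorphic_imp_continuous_map)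
    then have "openin (subtopology T (Domain h)) {x \<in> Domain h. f x \<in> Range h \<inter> V}"
      using that t unfolding continuous_map_def by (metis inf_commute openin_subtopology_Int2)
    moreover have "h\<inverse> `` V = {x \<in> Domain h. f x \<in> Range h \<inter> V}"
      using mem by auto
    ultimately show ?thesis
      using o openin_trans_full by metis
  qed
  moreover have "single_valued h" "single_valued (h\<inverse>)"
    using mem inj by (auto simp: single_valued_def inj_on_def)
  moreover have "h \<subseteq> topspace T \<times> topspace T"
    using D R by auto
  ultimately show ?R by blast
next
  assume R: ?R
  define f where "f x = (THE y. (x, y) \<in> h)" for x
  have mem: "(x, y) \<in> h \<longleftrightarrow> x \<in> Domain h \<and> y = f x" for x y
    using R unfolding f_def single_valued_def by (metis (mono_tags, lifting) Domain.simps the_equality)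
  have D: "Domain h = h\<inverse> `` topspace T" and Ra: "Range h = h `` topspace T"
    using R by auto
  then have o: "openin T (Domain h)" "openin T (Range h)"
    using R by auto
  have t: "topspace (subtopology T (Domain h)) = Domain h" "topspace (subtopology T (Range h)) = Range h"
    using o openin_subset by fastforce+
  have fD: "(x, f x) \<in> h" if "x \<in> Domain h" for x
    using that mem[of x "f x"] by simp
  have fU: "y = f x" if "(x, y) \<in> h" for x y
    using that mem[of x y] by simp
  have im: "f ` Domain h = Range h"
  proof
    show "f ` Domain h \<subseteq> Range h" using fD by blast
    show "Range h \<subseteq> f ` Domain h" using fU by blast
  qed
  have "continuous_map (subtopology T (Domain h)) (subtopology T (Range h)) f"
  proof -
    have "openin (subtopology T (Domain h)) {x \<in> Domain h. f x \<in> U}"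
      if "openin (subtopology T (Range h)) U" for U
    proof -
      have "openin T U" using that o openin_trans_full by metis
      then have "openin T (h\<inverse> `` U)" using R by blast
      moreover have "{x \<in> Domain h. f x \<in> U} = h\<inverse> `` U"
        using fD fU by blast
      ultimately show ?thesis
        using o by (metis (no_types, lifting) mem_Collect_eq openin_open_subtopology subsetI)
    qed
    moreover have "f \<in> Domain h \<rightarrow> Range h"
      using fD by blast
    ultimately show ?thesis
      unfolding continuous_map_def t by (intro conjI allI impI)
  qed
  moreover have "open_map (subtopology T (Domain h)) (subtopology T (Range h)) f"
    unfolding open_map_def
  proof (intro allI impI)
    fix U assume U: "openin (subtopology T (Domain h)) U"
    then have "openin T U" "U \<subseteq> Domain h"
      using o openin_open_subtopology by metis+
    moreover have "h `` U = f ` U"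
      using fD fU \<open>U \<subseteq> Domain h\<close> by blast
    ultimately have "openin T (f ` U)" "f ` U \<subseteq> Range h"
      using R im by (metis, metis image_mono)
    then show "openin (subtopology T (Range h)) (f ` U)"
      using o openin_open_subtopology by metis
  qed
  moreover have "inj_on f (Domain h)"
    using R fD unfolding inj_on_def single_valued_def by (metis converse_iff)
  ultimately have "homeomorphic_map (subtopology T (Domain h)) (subtopology T (Range h)) f"
    using t im bijective_open_imp_homeomorphic_map by metis
  moreover have "h = (\<lambda>x. (x, f x)) ` Domain h"
    using fD fU by auto
  ultimately show ?L
    using o unfolding local_homeomorphism_def by blast
qed

lemma local_homeomorphism_Id_on: "local_homeomorphism T (Id_on V)" if "openin T V"
proof -
  have "Id_on V `` W = V \<inter> W" "(Id_on V)\<inverse> `` W = V \<inter> W" for W by auto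
  then show ?thesis
    using that openin_subset[OF that] unfolding local_homeomorphism_iff
    by (auto simp: single_valued_def)
qed

lemma local_homeomorphism_comp:
  assumes "local_homeomorphism T h" "local_homeomorphism T g"
  shows "local_homeomorphism T (h O g)"
  using assms unfolding local_homeomorphism_iff
  by (auto simp: relcomp_Image converse_relcomp intro: single_valued_relcomp)

lemma local_homeomorphism_converse:
  "local_homeomorphism T h \<Longrightarrow> local_homeomorphism T (h\<inverse>)"
  unfolding local_homeomorphism_iff by auto

text \<open>The inductive definition yields the smallest pseudogroup containing the generators.\<close>

lemma pseudogroup_generated_pseudogroup:
  assumes "\<forall>h\<in>E. local_homeomorphism T h"
  shows "pseudogroup T (generated_pseudogroup T E)"
proof -
  have 1: "local_homeomorphism T h" if "h \<in> generated_pseudogroup T E" for h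
    using that
  proof (induction rule: generated_pseudogroup.induct)
    case (base h) then show ?case using assms by simp
  next
    case ident show ?case by (rule local_homeomorphism_Id_on) simp
  next
    case (comp h g) then show ?case by (simp add: local_homeomorphism_comp)
  next
    case (inverse h) then show ?case by (simp add: local_homeomorphism_converse)
  next
    case (restrict h V)
    then show ?case by (simp add: local_homeomorphism_comp local_homeomorphism_Id_on)
  next
    case (combine G) then show ?case by simp
  qed
  have 2: "\<Union>G \<in> generated_pseudogroup T E"
    if "G \<subseteq> generated_pseudogroup T E" "local_homeomorphism T (\<Union>G)" for G
    using that by (metis generated_pseudogroup.combine subsetD)
  show ?thesis
    unfolding pseudogroup_def
    using 1 2 by (simp add: generated_pseudogroup.ident generated_pseudogroup.comp
        generated_pseudogroup.inverse generated_pseudogroup.restrict)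
qed

lemma generated_pseudogroup_least:
  assumes "pseudogroup T H" "E \<subseteq> H"
  shows "generated_pseudogroup T E \<subseteq> H"
proof
  fix h assume "h \<in> generated_pseudogroup T E"
  then show "h \<in> H"
  proof (induction rule: generated_pseudogroup.induct)
    case (base h) then show ?case using assms(2) by (rule subsetD[rotated])
  next
    case (combine G)
    then have "G \<subseteq> H" "local_homeomorphism T (\<Union>G)" by (simp_all add: subset_iff)
    then show ?case using assms(1) by (simp add: pseudogroup_def)
  qed (use assms(1) in \<open>simp_all add: pseudogroup_def\<close>)
qed

definition symmetric_maps :: "('a \<times> 'a) set set \<Rightarrow> bool" where
  "symmetric_maps S \<longleftrightarrow> (\<forall>h\<in>S. h\<inverse> \<in> S)"

definition closed_under_composition :: "('a \<times> 'a) set set \<Rightarrow> bool" where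
  "closed_under_composition S \<longleftrightarrow> (\<forall>h\<in>S. \<forall>g\<in>S. h O g \<in> S)"

definition pseudogroup_orbit :: "('a \<times> 'a) set set \<Rightarrow> 'a \<Rightarrow> 'a set" where
  "pseudogroup_orbit H x = {y. \<exists>h\<in>H. (x, y) \<in> h}"

definition homogeneous_space :: "'a topology \<Rightarrow> bool" where
  "homogeneous_space T \<longleftrightarrow>
     (\<exists>!Q. Q \<in> pseudogroup_orbit {h. local_homeomorphism T h} ` topspace T)"


section \<open>Quasi-local metrics\<close>

text \<open>
  A family of metric spaces is given as a set of elements of the library type of metrics,
  each of which carries its own underlying set. The modulus \<open>\<delta>\<close> is a function because the
  neighbourhood \<open>U\<close> must not depend on \<open>\<epsilon>\<close>.
\<close>

definition quasi_locally_equal_cover :: "'a set \<Rightarrow> 'a metric set \<Rightarrow> bool" where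
  "quasi_locally_equal_cover Z D \<longleftrightarrow>
     Z = (\<Union>m\<in>D. mspace m) \<and>
     (\<forall>m\<in>D. \<forall>m'\<in>D. openin (mtopology_of m) (mspace m \<inter> mspace m') \<and>
                     openin (mtopology_of m') (mspace m \<inter> mspace m')) \<and>
     (\<exists>\<delta>::real \<Rightarrow> real. (\<forall>\<epsilon>>0. \<delta> \<epsilon> > 0) \<and>
        (\<forall>m\<in>D. \<forall>m'\<in>D. \<forall>z \<in> mspace m \<inter> mspace m'.
           \<exists>U \<subseteq> mspace m \<inter> mspace m'. z \<in> U \<and>
             openin (mtopology_of m) U \<and> openin (mtopology_of m') U \<and>
             (\<forall>\<epsilon>>0. \<forall>x\<in>U. \<forall>y\<in>U. mdist m x y < \<delta> \<epsilon> \<longrightarrow> mdist m' x y < \<epsilon>)))"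

definition quasi_local_equivalence :: "'a set \<Rightarrow> ('a metric set \<times> 'a metric set) set" where
  "quasi_local_equivalence Z =
     {(D, D'). quasi_locally_equal_cover Z D \<and> quasi_locally_equal_cover Z D' \<and>
               quasi_locally_equal_cover Z (D \<union> D')}"

definition quasi_local_metrics :: "'a set \<Rightarrow> 'a metric set set set" where
  "quasi_local_metrics Z = {D. quasi_locally_equal_cover Z D} // quasi_local_equivalence Z"

definition metric_balls :: "'a metric set \<Rightarrow> 'a set set" where
  "metric_balls D = {mball_of m x r | m x r. m \<in> D \<and> x \<in> mspace m \<and> 0 < r}"

definition induces_topology :: "'a metric set set \<Rightarrow> 'a topology \<Rightarrow> bool" where
  "induces_topology Q T \<longleftrightarrow>
     (\<forall>D\<in>Q. openin T = arbitrary union_of (\<lambda>U. U \<in> metric_balls D))"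


section \<open>Strong equicontinuity and quasi-effectiveness\<close>

definition strongly_equicontinuous :: "'a topology \<Rightarrow> ('a \<times> 'a) set set \<Rightarrow> bool" where
  "strongly_equicontinuous T H \<longleftrightarrow>
     (\<exists>Q \<in> quasi_local_metrics (topspace T). induces_topology Q T \<and>
       (\<exists>D\<in>Q. \<exists>S. symmetric_maps S \<and> closed_under_composition S \<and>
          H = generated_pseudogroup T S \<and>
          (\<forall>\<epsilon>>0. \<exists>\<delta>>0. \<forall>h\<in>S. \<forall>m\<in>D. \<forall>m'\<in>D. \<forall>x y x' y'.
             (x, x') \<in> h \<and> (y, y') \<in> h \<and> x \<in> mspace m \<and> y \<in> mspace m \<and>
             x' \<in> mspace m' \<and> y' \<in> mspace m' \<and> mdist m x y < \<delta>
             \<longrightarrow> mdist m' x' y' < \<epsilon>)))"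

definition quasi_effective :: "'a topology \<Rightarrow> ('a \<times> 'a) set set \<Rightarrow> bool" where
  "quasi_effective T H \<longleftrightarrow>
     (\<exists>S. symmetric_maps S \<and> closed_under_composition S \<and>
          H = generated_pseudogroup T S \<and>
          (\<forall>h\<in>S. \<forall>V. openin T V \<and> V \<noteq> {} \<and> V \<subseteq> Domain h \<and> Id_on V O h = Id_on V
             \<longrightarrow> h = Id_on (Domain h)))"


section \<open>Foliated spaces\<close>

definition polish_topology :: "'a topology \<Rightarrow> bool" where
  "polish_topology X \<longleftrightarrow> completely_metrizable_space X \<and> separable_space X"

text \<open>
  Class \<open>C\<^sup>m\<close> in the \<open>\<real>\<^sup>n\<close>-directions for a function on a set \<open>W\<close> that is open in
  \<open>\<real>\<^sup>n \<times> Z\<close>: the iterated partial derivatives up to order \<open>m\<close> exist on \<open>W\<close> and are jointly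
  continuous there. As \<open>W\<close> is open, the derivative at \<open>t = 0\<close> only sees values on \<open>W\<close>.
\<close>

primrec leafwise_C ::
  "nat \<Rightarrow> 'z topology \<Rightarrow> ((real^'n) \<times> 'z) set \<Rightarrow> ((real^'n) \<times> 'z \<Rightarrow> real^'n) \<Rightarrow> bool" where
  "leafwise_C 0 Z W f \<longleftrightarrow>
     continuous_map (subtopology (prod_topology euclidean Z) W) euclidean f"
| "leafwise_C (Suc m) Z W f \<longleftrightarrow>
     continuous_map (subtopology (prod_topology euclidean Z) W) euclidean f \<and>
     (\<forall>a. \<exists>g. (\<forall>x z. (x, z) \<in> W \<longrightarrow>
                 ((\<lambda>t. f (x + t *\<^sub>R axis a 1, z)) has_vector_derivative g (x, z)) (at 0)) \<and>
              leafwise_C m Z W g)"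

text \<open>
  A cover by flow boxes: index set \<open>I\<close>, domains \<open>U\<^sub>i\<close>, balls \<open>B\<^sub>i\<close>, transversals \<open>Z\<^sub>i\<close> and
  charts \<open>\<phi>\<^sub>i : U\<^sub>i \<rightarrow> B\<^sub>i \<times> Z\<^sub>i\<close>.
\<close>

record ('x, 'n, 'i, 'z) flow_box_cover =
  indices :: "'i set"
  flow_box :: "'i \<Rightarrow> 'x set"
  leaf_ball :: "'i \<Rightarrow> (real^'n) set"
  transversal :: "'i \<Rightarrow> 'z topology"
  chart :: "'i \<Rightarrow> 'x \<Rightarrow> (real^'n) \<times> 'z"

definition overlap_image :: "('x, 'n::finite, 'i, 'z) flow_box_cover \<Rightarrow> 'i \<Rightarrow> 'i \<Rightarrow> ((real^'n) \<times> 'z) set"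
  where "overlap_image F i j = chart F j ` (flow_box F i \<inter> flow_box F j)"

definition coordinate_change ::
  "('x, 'n::finite, 'i, 'z) flow_box_cover \<Rightarrow> 'i \<Rightarrow> 'i \<Rightarrow> (real^'n) \<times> 'z \<Rightarrow> (real^'n) \<times> 'z"
  where "coordinate_change F i j = chart F i \<circ> the_inv_into (flow_box F j) (chart F j)"

text \<open>The order of differentiability \<open>k\<close> may be infinite.\<close>

definition foliated_space ::
  "enat \<Rightarrow> 'x topology \<Rightarrow> ('x, 'n::finite, 'i, 'z) flow_box_cover \<Rightarrow> bool" where
  "foliated_space k X F \<longleftrightarrow>
     locally_compact_space X \<and> polish_topology X \<and>
     topspace X = (\<Union>i\<in>indices F. flow_box F i) \<and>
     (\<forall>i\<in>indices F.
        openin X (flow_box F i) \<and>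
        (\<exists>c r. 0 < r \<and> leaf_ball F i = ball c r) \<and>
        polish_topology (transversal F i) \<and>
        homeomorphic_map (subtopology X (flow_box F i))
          (prod_topology (top_of_set (leaf_ball F i)) (transversal F i)) (chart F i)) \<and>
     (\<forall>i\<in>indices F. \<forall>j\<in>indices F.
        (\<exists>\<zeta>. continuous_map (subtopology (transversal F j) (snd ` overlap_image F i j))
                (transversal F i) \<zeta> \<and>
             (\<forall>(x, z) \<in> overlap_image F i j. snd (coordinate_change F i j (x, z)) = \<zeta> z)) \<and>
        (\<forall>m. enat m \<le> k \<longrightarrow>
           leafwise_C m (transversal F j) (overlap_image F i j) (fst \<circ> coordinate_change F i j)))"

definition plaques :: "('x, 'n::finite, 'i, 'z) flow_box_cover \<Rightarrow> 'x set set" where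
  "plaques F = {{u \<in> flow_box F i. snd (chart F i u) = z} | i z.
                  i \<in> indices F \<and> z \<in> topspace (transversal F i)}"

definition leaf_topology :: "'x topology \<Rightarrow> ('x, 'n::finite, 'i, 'z) flow_box_cover \<Rightarrow> 'x topology" where
  "leaf_topology X F =
     topology (arbitrary union_of (\<lambda>W. \<exists>P\<in>plaques F. openin (subtopology X P) W))"

definition leaves :: "'x topology \<Rightarrow> ('x, 'n::finite, 'i, 'z) flow_box_cover \<Rightarrow> 'x set set" where
  "leaves X F = connected_components_of (leaf_topology X F)"


section \<open>The holonomy pseudogroup\<close>

definition total_transversal :: "('x, 'n::finite, 'i, 'z) flow_box_cover \<Rightarrow> ('i \<times> 'z) topology" where
  "total_transversal F = sum_topology (transversal F) (indices F)"

text \<open>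
  The graph of \<open>h\<^sub>i\<^sub>j : p\<^sub>i(U\<^sub>i \<inter> U\<^sub>j) \<rightarrow> p\<^sub>j(U\<^sub>i \<inter> U\<^sub>j)\<close>, \<open>p\<^sub>j = h\<^sub>i\<^sub>j \<circ> p\<^sub>i\<close>. In a foliated space this is
  a homeomorphism between open sets, since the second component of a coordinate change is a
  continuous function of the transverse coordinate alone, defined on all of the overlap; thus
  every cover as in the definition of a foliated space has a holonomy pseudogroup.
\<close>

definition holonomy_map ::
  "('x, 'n::finite, 'i, 'z) flow_box_cover \<Rightarrow> 'i \<Rightarrow> 'i \<Rightarrow> (('i \<times> 'z) \<times> ('i \<times> 'z)) set" where
  "holonomy_map F i j =
     (\<lambda>u. ((i, snd (chart F i u)), (j, snd (chart F j u)))) ` (flow_box F i \<inter> flow_box F j)"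

definition holonomy_pseudogroup ::
  "('x, 'n::finite, 'i, 'z) flow_box_cover \<Rightarrow> (('i \<times> 'z) \<times> ('i \<times> 'z)) set set" where
  "holonomy_pseudogroup F =
     generated_pseudogroup (total_transversal F)
       {holonomy_map F i j | i j. i \<in> indices F \<and> j \<in> indices F}"

definition strongly_equicontinuous_foliation :: "('x, 'n::finite, 'i, 'z) flow_box_cover \<Rightarrow> bool" where
  "strongly_equicontinuous_foliation F \<longleftrightarrow>
     strongly_equicontinuous (total_transversal F) (holonomy_pseudogroup F)"

definition quasi_effective_foliation :: "('x, 'n::finite, 'i, 'z) flow_box_cover \<Rightarrow> bool" where
  "quasi_effective_foliation F \<longleftrightarrow>
     quasi_effective (total_transversal F) (holonomy_pseudogroup F)"

end

theory Submission
  imports Defs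
begin

text \<open>
  Let \<open>y\<close> lie in the closure \<open>M\<close> of a leaf \<open>L\<close>, and let \<open>z\<close> be its plaque in a flow box. Plaques
  \<open>z\<^sub>n\<close> of \<open>L\<close> accumulate at \<open>z\<close>, and chains of finitely many relatively compact pieces of flow boxes
  give holonomy maps \<open>c\<^sub>n\<close> with \<open>c\<^sub>n (z\<^sub>0) = z\<^sub>n\<close>. By strong equicontinuity the \<open>c\<^sub>n\<close> and their inverses are
  defined on balls of a common radius about \<open>z\<^sub>0\<close> and \<open>z\<^sub>n\<close>, and they are equicontinuous there. A
  common pointwise cluster point of the \<open>c\<^sub>n\<close> and of their inverses is a local homeomorphism \<open>g\<close> with
  \<open>g (z\<^sub>0) = z\<close> that respects \<open>M\<close>. Together with translations along the plaques, \<open>g\<close> carries a point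
  of \<open>L\<close> to \<open>y\<close> inside \<open>M\<close>; the points of \<open>L\<close> are related to each other by translations alone.
\<close>

section \<open>Metrics and compactness\<close>

text \<open>The obstacle is that holonomy along a long chain could have a tiny domain, since each
  step restricts it further, and equicontinuity says nothing about where a map is defined. The cure
  is to compare the whole composite, at every length, with one element of \<open>S\<close>: each
  step agrees locally with an element of \<open>S\<close>, and \<open>S\<close> is closed under
  composition, so one modulus serves all lengths and errors do not accumulate. Compact pieces inside
  the flow boxes bound the size of a single step by Lebesgue numbers. The limit is a cluster point
  in a product of copies of a compact set (Tychonoff), indexed by the disjoint union of a common
  domain of the \<open>c n\<close> and one of their inverses. Taking both at once matters: a single
  \<open>n\<close> approximates a map and its inverse together, so the two limits are mutually
  inverse wherever they can be composed. Since \<open>M\<close> is closed and a union of plaques,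
  membership in \<open>M\<close> can be read off on the transversal and is invariant along chains,
  hence it survives the limit.\<close>

lemma openin_mtopology_of:
  "openin (mtopology_of m) U \<longleftrightarrow>
     U \<subseteq> mspace m \<and> (\<forall>x\<in>U. \<exists>r>0. \<forall>y\<in>mspace m. mdist m x y < r \<longrightarrow> y \<in> U)"
proof -
  have "mball_of m x r \<subseteq> U \<longleftrightarrow> (\<forall>y\<in>mspace m. mdist m x y < r \<longrightarrow> y \<in> U)"
    if "U \<subseteq> mspace m" "x \<in> U" for x r
    using that by (auto simp: subset_eq)
  then show ?thesis
    using Metric_space.openin_mtopology[OF Metric_space_mspace_mdist, of m U]
    unfolding mtopology_of_def mball_of_def by (metis (no_types, lifting))
qed

lemma mdist_self [simp]: "x \<in> mspace m \<Longrightarrow> mdist m x x = 0"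
  by simp

lemma openin_mball_of: "openin (mtopology_of m) (mball_of m x r)"
  by (simp add: mtopology_of_def mball_of_def Metric_space.openin_mball)

lemma closedin_mcball_of: "closedin (mtopology_of m) (mcball_of m x r)"
  by (simp add: mtopology_of_def mcball_of_def Metric_space.closedin_mcball)

lemma lebesgue_number_of:
  assumes "compactin (mtopology_of m) C" "C \<subseteq> \<Union>\<U>" "\<And>U. U \<in> \<U> \<Longrightarrow> openin (mtopology_of m) U"
  shows "\<exists>\<epsilon>>0. \<forall>x\<in>C. \<exists>U\<in>\<U>. mball_of m x \<epsilon> \<subseteq> U"
  using assms unfolding mtopology_of_def mball_of_def
  by (rule Metric_space.lebesgue_number[OF Metric_space_mspace_mdist])

lemma compactin_subset_mspace: "compactin (mtopology_of m) C \<Longrightarrow> C \<subseteq> mspace m"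
  using compactin_subset_topspace by fastforce

lemma metrizable_imp_mtopology_of:
  assumes "metrizable_space X"
  obtains m where "mtopology_of m = X"
proof -
  obtain M d where "Metric_space M d" "X = Metric_space.mtopology M d"
    using assms unfolding metrizable_space_def by blast
  then show ?thesis using that Metric_space.mtopology_of[of M d] by simp
qed

text \<open>Distances inside a summand are truncated at 1, and points of different summands are put
  at distance 1. Small balls then never leave their summand, so the two topologies agree.\<close>

lemma sum_topology_metric:
  assumes "\<And>i. i \<in> I \<Longrightarrow> metrizable_space (X i)"
  obtains m where "mtopology_of m = sum_topology X I"
proof -
  have "\<exists>m. mtopology_of m = X i" if "i \<in> I" for i
    using assms[OF that] metrizable_imp_mtopology_of by metis
  then obtain \<mu> where \<mu>: "\<And>i. i \<in> I \<Longrightarrow> mtopology_of (\<mu> i) = X i"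
    by metis
  then have sp: "mspace (\<mu> i) = topspace (X i)" if "i \<in> I" for i
    using arg_cong[OF \<mu>[OF that], of topspace] by simp
  define M where "M = Sigma I (topspace \<circ> X)"
  define d where "d = (\<lambda>p q. if fst p = fst q then min 1 (mdist (\<mu> (fst p)) (snd p) (snd q)) else (1::real))"
  have min_add: "min 1 a \<le> min 1 b + min 1 c" if "a \<le> b + c" "0 \<le> b" "0 \<le> c" for a b c :: real
    using that by (auto simp: min_def)
  interpret Metric_space M d
  proof
    show "0 \<le> d x y" for x y by (simp add: d_def)
    show "d x y = d y x" for x y by (auto simp: d_def mdist_commute)
    show "(d x y = 0) = (x = y)" if "x \<in> M" "y \<in> M" for x y
    proof -
      have "mdist (\<mu> (fst x)) (snd x) (snd y) = 0 \<longleftrightarrow> snd x = snd y" if "fst x = fst y"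
        using \<open>x \<in> M\<close> \<open>y \<in> M\<close> that sp by (auto simp: M_def)
      then show ?thesis
        by (auto simp: d_def min_def prod_eq_iff split: if_splits)
    qed
    show "d x z \<le> d x y + d y z" if "x \<in> M" "y \<in> M" "z \<in> M" for x y z
    proof (cases "fst x = fst y \<and> fst y = fst z")
      case True
      then have "mdist (\<mu> (fst x)) (snd x) (snd z) \<le>
          mdist (\<mu> (fst x)) (snd x) (snd y) + mdist (\<mu> (fst x)) (snd y) (snd z)"
        using that sp by (auto simp: M_def intro!: mdist_triangle)
      from min_add[OF this mdist_nonneg mdist_nonneg] show ?thesis
        using True unfolding d_def by simp
    next
      case False
      then show ?thesis
        using mdist_nonneg[of "\<mu> (fst x)" "snd x" "snd y"] mdist_nonneg[of "\<mu> (fst y)" "snd y" "snd z"]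
        unfolding d_def by (auto simp: min_def)
    qed
  qed
  have "openin mtopology U \<longleftrightarrow> openin (sum_topology X I) U" for U
  proof
    assume U: "openin mtopology U"
    then have UM: "U \<subseteq> M" by (simp add: openin_mtopology)
    have "openin (X i) {x. (i, x) \<in> U}" if "i \<in> I" for i
      unfolding \<mu>[OF that, symmetric] openin_mtopology_of
    proof (intro conjI ballI)
      show "{x. (i, x) \<in> U} \<subseteq> mspace (\<mu> i)"
        using UM that sp by (auto simp: M_def)
      fix x assume x: "x \<in> {x. (i, x) \<in> U}"
      then obtain r where r: "r > 0" "mball (i, x) r \<subseteq> U"
        using U unfolding openin_mtopology by blast
      have "y \<in> {x. (i, x) \<in> U}" if y: "y \<in> mspace (\<mu> i)" "mdist (\<mu> i) x y < r" for y
      proof -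
        have "(i, y) \<in> mball (i, x) r"
          unfolding in_mball using y x UM \<open>i \<in> I\<close> sp r(1) by (auto simp: M_def d_def)
        then show ?thesis using r by auto
      qed
      then show "\<exists>r>0. \<forall>y\<in>mspace (\<mu> i). mdist (\<mu> i) x y < r \<longrightarrow> y \<in> {x. (i, x) \<in> U}"
        using r(1) by blast
    qed
    then show "openin (sum_topology X I) U"
      using UM by (simp add: openin_sum_topology M_def)
  next
    assume U: "openin (sum_topology X I) U"
    then have UM: "U \<subseteq> M" by (simp add: openin_sum_topology M_def)
    show "openin mtopology U"
      unfolding openin_mtopology
    proof (intro conjI allI impI)
      show "U \<subseteq> M" by (fact UM)
      fix p assume p: "p \<in> U"
      then have i: "fst p \<in> I" using UM by (auto simp: M_def)
      have "openin (mtopology_of (\<mu> (fst p))) {x. (fst p, x) \<in> U}"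
        using U i \<mu> by (simp add: openin_sum_topology)
      then have "\<exists>r>0. \<forall>y\<in>mspace (\<mu> (fst p)). mdist (\<mu> (fst p)) (snd p) y < r \<longrightarrow> (fst p, y) \<in> U"
        unfolding openin_mtopology_of using p by simp
      then obtain r where r: "r > 0"
        "\<And>y. y \<in> mspace (\<mu> (fst p)) \<Longrightarrow> mdist (\<mu> (fst p)) (snd p) y < r \<Longrightarrow> (fst p, y) \<in> U"
        by blast
      have "q \<in> U" if q: "q \<in> mball p (min r 1)" for q
      proof -
        have "q \<in> M" "fst p = fst q" "mdist (\<mu> (fst p)) (snd p) (snd q) < r"
          using q unfolding in_mball by (auto simp: d_def split: if_splits)
        then show ?thesis
          using r(2)[of "snd q"] sp[OF i] by (auto simp: M_def)
      qed
      then show "\<exists>r>0. mball p r \<subseteq> U"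
        using r(1) by (intro exI[of _ "min r 1"]) auto
    qed
  qed
  then have "mtopology_of (metric (M, d)) = sum_topology X I"
    by (simp add: topology_eq)
  then show ?thesis using that by blast
qed

text \<open>Turns one constant per element into a common one by taking the least;
  \<open>mono\<close> makes the smaller constant admissible.\<close>

lemma finite_uniform_bound:
  assumes "finite A" "\<And>a. a \<in> A \<Longrightarrow> \<exists>\<delta>>0::real. Q a \<delta>"
    and mono: "\<And>a \<delta> \<delta>'. a \<in> A \<Longrightarrow> Q a \<delta> \<Longrightarrow> 0 < \<delta>' \<Longrightarrow> \<delta>' \<le> \<delta> \<Longrightarrow> Q a \<delta>'"
  shows "\<exists>\<delta>>0. \<forall>a\<in>A. Q a \<delta>"
proof -
  have "\<exists>f. \<forall>a\<in>A. 0 < f a \<and> Q a (f a)"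
    using assms(2) by (rule_tac bchoice) simp
  then obtain f where f: "\<And>a. a \<in> A \<Longrightarrow> 0 < f a \<and> Q a (f a)"
    by auto
  \<comment> \<open>The extra 1 keeps the set nonempty when \<open>A\<close> is empty.\<close>
  define \<delta> where "\<delta> = Min (insert 1 (f ` A))"
  have fin: "finite (insert 1 (f ` A))" using assms(1) by simp
  have "\<delta> \<in> insert 1 (f ` A)" unfolding \<delta>_def by (rule Min_in[OF fin]) simp
  then have "\<delta> > 0" using f by auto
  moreover have "Q a \<delta>" if a: "a \<in> A" for a
  proof (rule mono[OF a])
    show "Q a (f a)" using f[OF a] by simp
    show "\<delta> \<le> f a" unfolding \<delta>_def by (rule Min_le[OF fin]) (use a in simp)
  qed fact
  ultimately show ?thesis by auto
qed

text \<open>A Lebesgue number of the cover of \<open>C\<close> by \<open>m'\<close>-balls of radius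
  \<epsilon>/2 works: \<open>x\<close> and a sufficiently near \<open>y\<close> share one such ball.
  Only \<open>x\<close> has to lie in \<open>C\<close>; that the neighbour \<open>y\<close> belongs
  to \<open>mspace m'\<close> is part of the gain.\<close>

lemma compact_uniform_comparison:
  assumes C: "compactin (mtopology_of m) C" "C \<subseteq> mspace m'"
    and op: "\<And>x r. openin (mtopology_of m) (mball_of m' x r \<inter> mspace m)"
    and "0 < \<epsilon>"
  shows "\<exists>\<delta>>0. \<forall>x\<in>C. \<forall>y\<in>mspace m. mdist m x y < \<delta> \<longrightarrow> y \<in> mspace m' \<and> mdist m' x y < \<epsilon>"
proof -
  have Cm: "C \<subseteq> mspace m" using C compactin_subset_mspace by blast
  define \<U> where "\<U> = (\<lambda>x. mball_of m' x (\<epsilon>/2) \<inter> mspace m) ` C"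
  have "C \<subseteq> \<Union>\<U>"
  proof
    fix x assume "x \<in> C"
    then have "x \<in> mball_of m' x (\<epsilon>/2) \<inter> mspace m"
      using C(2) Cm \<open>0 < \<epsilon>\<close> by auto
    then show "x \<in> \<Union>\<U>" using \<open>x \<in> C\<close> unfolding \<U>_def by blast
  qed
  then obtain \<delta> where \<delta>: "\<delta> > 0" "\<forall>x\<in>C. \<exists>U\<in>\<U>. mball_of m x \<delta> \<subseteq> U"
    using lebesgue_number_of[OF C(1), of \<U>] op by (auto simp: \<U>_def)
  have "y \<in> mspace m' \<and> mdist m' x y < \<epsilon>" if x: "x \<in> C" and y: "y \<in> mspace m" "mdist m x y < \<delta>" for x y
  proof -
    obtain c where c: "c \<in> C" "mball_of m x \<delta> \<subseteq> mball_of m' c (\<epsilon>/2)"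
      using \<delta>(2) x unfolding \<U>_def by blast
    have "x \<in> mball_of m x \<delta>" "y \<in> mball_of m x \<delta>"
      using x y Cm \<delta>(1) by auto
    then have "x \<in> mball_of m' c (\<epsilon>/2)" "y \<in> mball_of m' c (\<epsilon>/2)"
      using c(2) by blast+
    then show ?thesis
      using mdist_triangle[of x m' c y] by (auto simp: mdist_commute)
  qed
  then show ?thesis using \<delta>(1) by blast
qed

section \<open>Members of a quasi-local family as open metric subspaces\<close>

lemma quasi_local_openin_ball:
  assumes D: "quasi_locally_equal_cover Z D" "m \<in> D" "m' \<in> D"
  shows "openin (mtopology_of m) (mball_of m' c r \<inter> mspace m)"
proof -
  from D(1) have "\<exists>\<delta>::real \<Rightarrow> real. (\<forall>\<epsilon>>0. \<delta> \<epsilon> > 0) \<and>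
        (\<forall>m\<in>D. \<forall>m'\<in>D. \<forall>z \<in> mspace m \<inter> mspace m'.
           \<exists>U \<subseteq> mspace m \<inter> mspace m'. z \<in> U \<and>
             openin (mtopology_of m) U \<and> openin (mtopology_of m') U \<and>
             (\<forall>\<epsilon>>0. \<forall>x\<in>U. \<forall>y\<in>U. mdist m x y < \<delta> \<epsilon> \<longrightarrow> mdist m' x y < \<epsilon>))"
    unfolding quasi_locally_equal_cover_def by (elim conjE)
  then obtain \<delta> :: "real \<Rightarrow> real" where \<delta>: "\<forall>\<epsilon>>0. \<delta> \<epsilon> > 0"
    and all: "\<forall>m\<in>D. \<forall>m'\<in>D. \<forall>z \<in> mspace m \<inter> mspace m'.
           \<exists>U \<subseteq> mspace m \<inter> mspace m'. z \<in> U \<and>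
             openin (mtopology_of m) U \<and> openin (mtopology_of m') U \<and>
             (\<forall>\<epsilon>>0. \<forall>x\<in>U. \<forall>y\<in>U. mdist m x y < \<delta> \<epsilon> \<longrightarrow> mdist m' x y < \<epsilon>)"
    by (elim exE conjE)
  note U = all[rule_format, OF D(2,3)]
  show ?thesis
    unfolding openin_mtopology_of
  proof (intro conjI ballI)
    fix z assume z: "z \<in> mball_of m' c r \<inter> mspace m"
    then obtain W where W: "W \<subseteq> mspace m \<inter> mspace m'" "z \<in> W" "openin (mtopology_of m) W"
       "\<forall>\<epsilon>>0. \<forall>x\<in>W. \<forall>y\<in>W. mdist m x y < \<delta> \<epsilon> \<longrightarrow> mdist m' x y < \<epsilon>"
      using U[of z] by auto
    then obtain s where s: "s > 0" "\<forall>y\<in>mspace m. mdist m z y < s \<longrightarrow> y \<in> W"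
      unfolding openin_mtopology_of by blast
    \<comment> \<open>The room left between \<open>z\<close> and the boundary of the ball. An
      \<open>m\<close>-distance below \<open>\<delta> e\<close> is an \<open>m'\<close>-distance
      below \<open>e\<close> as long as the points stay in \<open>W\<close>, which the radius
      \<open>s\<close> ensures.\<close>
    define e where "e = r - mdist m' c z"
    have e: "e > 0" using z by (auto simp: e_def)
    have "y \<in> mball_of m' c r \<inter> mspace m" if y: "y \<in> mspace m" "mdist m z y < min s (\<delta> e)" for y
    proof -
      have "y \<in> W" using s y by auto
      then have "mdist m' z y < e" using W y e by auto
      then show ?thesis
        using z \<open>y \<in> W\<close> W(1) mdist_triangle[of c m' z y] by (auto simp: e_def)
    qed
    then show "\<exists>r'>0. \<forall>y\<in>mspace m. mdist m z y < r' \<longrightarrow> y \<in> mball_of m' c r \<inter> mspace m"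
      using s(1) \<delta>[rule_format, OF e] by (intro exI[of _ "min s (\<delta> e)"]) auto
  qed auto
qed

lemma induced_topology_metric:
  assumes Q: "Q \<in> quasi_local_metrics Z" "induces_topology Q T" "D \<in> Q"
  shows "quasi_locally_equal_cover Z D"
    and "openin T = arbitrary union_of (\<lambda>U. U \<in> metric_balls D)"
proof -
  obtain D0 where "Q = quasi_local_equivalence Z `` {D0}"
    using Q(1) unfolding quasi_local_metrics_def by (rule quotientE)
  then have "(D0, D) \<in> quasi_local_equivalence Z" using Q(3) by blast
  then show "quasi_locally_equal_cover Z D"
    unfolding quasi_local_equivalence_def by blast
  show "openin T = arbitrary union_of (\<lambda>U. U \<in> metric_balls D)"
    using Q(2,3) unfolding induces_topology_def by (rule bspec)
qed

text \<open>An \<open>m\<close>-open set is a union of \<open>m\<close>-balls, which belong to the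
  base of \<open>T\<close>. Conversely, a basic ball of any member meets \<open>mspace m\<close> in
  an \<open>m\<close>-open set, by the local comparison of the two metrics.\<close>

lemma quasi_local_subtopology:
  assumes D: "quasi_locally_equal_cover Z D" "m \<in> D"
    and T: "openin T = arbitrary union_of (\<lambda>U. U \<in> metric_balls D)"
  shows "openin T (mspace m)" "mtopology_of m = subtopology T (mspace m)"
proof -
  have 1: "openin T U" if U: "openin (mtopology_of m) U" for U
  proof -
    obtain r where r: "\<And>x. x \<in> U \<Longrightarrow> r x > 0 \<and> (\<forall>y\<in>mspace m. mdist m x y < r x \<longrightarrow> y \<in> U)"
      using U unfolding openin_mtopology_of by metis
    have Us: "U \<subseteq> mspace m" using U by (simp add: openin_mtopology_of)
    have "U = \<Union>((\<lambda>x. mball_of m x (r x)) ` U)"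
    proof
      show "U \<subseteq> \<Union>((\<lambda>x. mball_of m x (r x)) ` U)"
      proof
        fix x assume x: "x \<in> U"
        then have "x \<in> mball_of m x (r x)" using r Us by auto
        then show "x \<in> \<Union>((\<lambda>x. mball_of m x (r x)) ` U)" using x by blast
      qed
      show "\<Union>((\<lambda>x. mball_of m x (r x)) ` U) \<subseteq> U" using r by auto
    qed
    moreover have "(\<lambda>x. mball_of m x (r x)) ` U \<subseteq> metric_balls D"
      using r Us D(2) unfolding metric_balls_def by blast
    ultimately show ?thesis
      unfolding T union_of_def arbitrary_def by (metis (no_types, lifting) CollectI subsetD subsetI)
  qed
  have "openin (mtopology_of m) (mspace m)"
    by (simp add: openin_mtopology_of zero_less_one) (metis zero_less_one)
  then show o: "openin T (mspace m)" by (rule 1)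
  have 2: "openin (mtopology_of m) (U \<inter> mspace m)" if U: "openin T U" for U
  proof -
    obtain \<U> where \<U>: "\<U> \<subseteq> metric_balls D" "U = \<Union>\<U>"
      using U unfolding T union_of_def arbitrary_def by auto
    have "U \<inter> mspace m = (\<Union>B\<in>\<U>. B \<inter> mspace m)" using \<U> by auto
    moreover have "openin (mtopology_of m) (B \<inter> mspace m)" if "B \<in> \<U>" for B
      using \<U>(1) that quasi_local_openin_ball[OF D] unfolding metric_balls_def by blast
    ultimately show ?thesis by (metis (no_types, lifting) imageE openin_Union)
  qed
  show "mtopology_of m = subtopology T (mspace m)"
    unfolding topology_eq
  proof (intro allI iffI)
    fix U assume "openin (mtopology_of m) U"
    then show "openin (subtopology T (mspace m)) U"
      using 1 o openin_mtopology_of openin_open_subtopology by metis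
  next
    fix U assume "openin (subtopology T (mspace m)) U"
    then have "openin T U" "U \<subseteq> mspace m" using o openin_open_subtopology by metis+
    then show "openin (mtopology_of m) U" using 2[of U] by (simp add: inf_absorb1)
  qed
qed

text \<open>
  The quasi-local metric is traded for one metric \<open>\<mu>\<close> of the space. The side condition
  \<open>mdist \<mu> x' y' < \<rho>\<close> stays: strong equicontinuity says nothing about points whose images lie
  in no common member of the family \<open>D\<close>.
\<close>

lemma strongly_equicontinuous_on_compact:
  fixes \<mu> :: "'a metric"
  assumes D: "quasi_locally_equal_cover (topspace T) D"
    and T: "openin T = arbitrary union_of (\<lambda>U. U \<in> metric_balls D)"
    and \<mu>: "mtopology_of \<mu> = T"
    and eq: "\<forall>\<epsilon>>0. \<exists>\<delta>>0. \<forall>h\<in>S. \<forall>m\<in>D. \<forall>m'\<in>D. \<forall>x y x' y'.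
             (x, x') \<in> h \<and> (y, y') \<in> h \<and> x \<in> mspace m \<and> y \<in> mspace m \<and>
             x' \<in> mspace m' \<and> y' \<in> mspace m' \<and> mdist m x y < \<delta>
             \<longrightarrow> mdist m' x' y' < \<epsilon>"
    and S: "\<And>h. h \<in> S \<Longrightarrow> h \<subseteq> topspace T \<times> topspace T"
    and K: "compactin T K"
  shows "\<exists>\<rho>>0. \<forall>\<epsilon>>0. \<exists>\<delta>>0. \<forall>h\<in>S. \<forall>x y x' y'.
     (x, x') \<in> h \<and> (y, y') \<in> h \<and> x \<in> K \<and> x' \<in> K \<and> mdist \<mu> x y < \<delta> \<and> mdist \<mu> x' y' < \<rho>
       \<longrightarrow> mdist \<mu> x' y' < \<epsilon>"
proof -
  have sp: "mspace \<mu> = topspace T" using \<mu> by (metis topspace_mtopology_of)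
  have KT: "K \<subseteq> topspace T" using K by (rule compactin_subset_topspace)
  have TD: "topspace T = (\<Union>m\<in>D. mspace m)"
    using D unfolding quasi_locally_equal_cover_def by (rule conjunct1)
  then have Dsub: "mspace m \<subseteq> topspace T" if "m \<in> D" for m
    using that by blast
  have opT: "openin T (mspace m)" and mtop: "mtopology_of m = subtopology T (mspace m)" if "m \<in> D" for m
    by (rule quasi_local_subtopology[OF D that T])+
  \<comment> \<open>The doubled radius leaves every point of the ball of radius \<open>r\<close> a
    further margin \<open>r\<close> inside the same member of \<open>D\<close>.\<close>
  have "\<exists>m r. m \<in> D \<and> r > 0 \<and> mball_of \<mu> p (2*r) \<subseteq> mspace m" if "p \<in> K" for p
  proof -
    obtain m where m: "m \<in> D" "p \<in> mspace m"
      using TD KT \<open>p \<in> K\<close> by blast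
    then obtain r where "r > 0" "\<forall>y\<in>mspace \<mu>. mdist \<mu> p y < r \<longrightarrow> y \<in> mspace m"
      using opT[OF m(1)] \<mu> m(2) openin_mtopology_of by metis
    then have "r/2 > 0 \<and> mball_of \<mu> p (2 * (r/2)) \<subseteq> mspace m" by auto
    then show ?thesis using m(1) by blast
  qed
  then obtain n r where nr: "\<And>p. p \<in> K \<Longrightarrow> n p \<in> D \<and> r p > 0 \<and> mball_of \<mu> p (2 * r p) \<subseteq> mspace (n p)"
    by metis
  have "\<exists>F. finite F \<and> F \<subseteq> K \<and> K \<subseteq> (\<Union>p\<in>F. mball_of \<mu> p (r p))"
  proof -
    have 1: "K \<subseteq> \<Union>((\<lambda>p. mball_of \<mu> p (r p)) ` K)"
    proof
      fix x assume x: "x \<in> K"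
      then have "x \<in> mball_of \<mu> x (r x)" using nr KT sp by auto
      then show "x \<in> \<Union>((\<lambda>p. mball_of \<mu> p (r p)) ` K)" using x by blast
    qed
    have "\<exists>\<F>. finite \<F> \<and> \<F> \<subseteq> (\<lambda>p. mball_of \<mu> p (r p)) ` K \<and> K \<subseteq> \<Union>\<F>"
      by (rule compactinD[OF K _ 1]) (use openin_mball_of[of \<mu>] \<mu> in auto)
    then obtain \<F> where \<F>: "finite \<F>" "\<F> \<subseteq> (\<lambda>p. mball_of \<mu> p (r p)) ` K" "K \<subseteq> \<Union>\<F>" by blast
    obtain F where "F \<subseteq> K" "finite F" "\<F> = (\<lambda>p. mball_of \<mu> p (r p)) ` F"
      using finite_subset_image[OF \<F>(1,2)] by blast
    then show ?thesis using \<F>(3) by blast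
  qed
  then obtain F where F: "finite F" "F \<subseteq> K" "K \<subseteq> (\<Union>p\<in>F. mball_of \<mu> p (r p))" by blast
  have rp: "r p > 0" if "p \<in> F" for p using nr F(2) that by blast
  have "\<exists>\<rho>>0. \<forall>p\<in>F. \<rho> \<le> r p"
  proof (rule finite_uniform_bound[OF F(1)])
    show "\<exists>\<delta>>0. \<delta> \<le> r p" if "p \<in> F" for p using rp[OF that] by blast
  qed linarith
  then obtain \<rho> where \<rho>: "\<rho> > 0" "\<forall>p\<in>F. \<rho> \<le> r p" by blast
  \<comment> \<open>Compact pieces of \<open>K\<close>, each inside a single member
    \<open>n p\<close> of \<open>D\<close>, so that \<open>\<mu>\<close> and the metric of that
    member can be compared uniformly on it.\<close>
  define C where "C p = K \<inter> mcball_of \<mu> p (r p)" for p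
  have C: "C p \<subseteq> mspace (n p)" "compactin T (C p)" if "p \<in> F" for p
  proof -
    have pK: "p \<in> K" using that F by auto
    have "mcball_of \<mu> p (r p) \<subseteq> mball_of \<mu> p (2 * r p)"
    proof
      fix y assume "y \<in> mcball_of \<mu> p (r p)"
      then show "y \<in> mball_of \<mu> p (2 * r p)" using nr[OF pK] by auto
    qed
    then show "C p \<subseteq> mspace (n p)" using nr[OF pK] unfolding C_def by blast
    show "compactin T (C p)"
      unfolding C_def using compact_Int_closedin[OF K] closedin_mcball_of[of \<mu>] \<mu> by metis
  qed
  have cover: "\<exists>p\<in>F. x \<in> C p \<and> n p \<in> D \<and> (\<forall>y\<in>mspace \<mu>. mdist \<mu> x y < \<rho> \<longrightarrow> y \<in> mspace (n p))"
    if x: "x \<in> K" for x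
  proof -
    obtain p where p: "p \<in> F" "x \<in> mball_of \<mu> p (r p)" using F x by auto
    have "y \<in> mspace (n p)" if "y \<in> mspace \<mu>" "mdist \<mu> x y < \<rho>" for y
    proof -
      have "y \<in> mball_of \<mu> p (2 * r p)"
        using p that \<rho> mdist_triangle[of p \<mu> x y] by force
      then show ?thesis using nr p F by blast
    qed
    moreover have "x \<in> C p" "n p \<in> D" using p x nr F unfolding C_def by auto
    ultimately show ?thesis using p(1) by blast
  qed
  have "\<exists>\<delta>>0. \<forall>h\<in>S. \<forall>x y x' y'.
     (x, x') \<in> h \<and> (y, y') \<in> h \<and> x \<in> K \<and> x' \<in> K \<and> mdist \<mu> x y < \<delta> \<and> mdist \<mu> x' y' < \<rho>
       \<longrightarrow> mdist \<mu> x' y' < \<epsilon>" if "\<epsilon> > 0" for \<epsilon>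
  proof -
    \<comment> \<open>Three moduli are composed from the target back to the source: from the metric
      of \<open>n q\<close> to \<open>\<mu>\<close> at the image, strong equicontinuity between
      members of \<open>D\<close>, and from \<open>\<mu>\<close> to the metric of \<open>n p\<close>
      at the argument.\<close>
    have "\<exists>\<delta>>0. \<forall>x\<in>C q. \<forall>y\<in>mspace (n q). mdist (n q) x y < \<delta> \<longrightarrow> y \<in> mspace \<mu> \<and> mdist \<mu> x y < \<epsilon>"
      if q: "q \<in> F" for q
    proof (rule compact_uniform_comparison)
      have nq: "n q \<in> D" using q F nr by auto
      show "compactin (mtopology_of (n q)) (C q)"
        using C[OF q] mtop[OF nq] by (simp add: compactin_subtopology)
      show "C q \<subseteq> mspace \<mu>" using C[OF q] Dsub[OF nq] sp by auto
      show "openin (mtopology_of (n q)) (mball_of \<mu> x r \<inter> mspace (n q))" for x r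
        unfolding mtop[OF nq] using openin_mball_of[of \<mu> x r] \<mu> by (simp add: openin_subtopology_Int)
    qed fact
    then have "\<exists>\<delta>>0. \<forall>q\<in>F. \<forall>x\<in>C q. \<forall>y\<in>mspace (n q). mdist (n q) x y < \<delta> \<longrightarrow> y \<in> mspace \<mu> \<and> mdist \<mu> x y < \<epsilon>"
      by (rule finite_uniform_bound[OF F(1)]) auto
    then obtain \<epsilon>1 where \<epsilon>1: "\<epsilon>1 > 0"
      "\<forall>q\<in>F. \<forall>x\<in>C q. \<forall>y\<in>mspace (n q). mdist (n q) x y < \<epsilon>1 \<longrightarrow> y \<in> mspace \<mu> \<and> mdist \<mu> x y < \<epsilon>"
      by blast
    obtain \<delta>1 where \<delta>1: "\<delta>1 > 0" "\<forall>h\<in>S. \<forall>m\<in>D. \<forall>m'\<in>D. \<forall>x y x' y'.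
             (x, x') \<in> h \<and> (y, y') \<in> h \<and> x \<in> mspace m \<and> y \<in> mspace m \<and>
             x' \<in> mspace m' \<and> y' \<in> mspace m' \<and> mdist m x y < \<delta>1
             \<longrightarrow> mdist m' x' y' < \<epsilon>1"
      using eq \<epsilon>1(1) by blast
    have "\<exists>\<delta>>0. \<forall>x\<in>C p. \<forall>y\<in>mspace \<mu>. mdist \<mu> x y < \<delta> \<longrightarrow> y \<in> mspace (n p) \<and> mdist (n p) x y < \<delta>1"
      if p: "p \<in> F" for p
    proof (rule compact_uniform_comparison)
      have np: "n p \<in> D" using p F nr by auto
      show "compactin (mtopology_of \<mu>) (C p)" using C[OF p] \<mu> by simp
      show "C p \<subseteq> mspace (n p)" by (rule C[OF p])
      fix x r
      have "openin T (mball_of (n p) x r)"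
        using openin_mball_of[of "n p" x r] opT[OF np] openin_open_subtopology unfolding mtop[OF np] by metis
      moreover have "mball_of (n p) x r \<subseteq> mspace \<mu>" using Dsub[OF np] sp by auto
      ultimately show "openin (mtopology_of \<mu>) (mball_of (n p) x r \<inter> mspace \<mu>)"
        using \<mu> by (simp add: inf_absorb1)
    qed fact
    then have "\<exists>\<delta>>0. \<forall>p\<in>F. \<forall>x\<in>C p. \<forall>y\<in>mspace \<mu>. mdist \<mu> x y < \<delta> \<longrightarrow> y \<in> mspace (n p) \<and> mdist (n p) x y < \<delta>1"
      by (rule finite_uniform_bound[OF F(1)]) auto
    then obtain \<delta> where \<delta>: "\<delta> > 0"
      "\<forall>p\<in>F. \<forall>x\<in>C p. \<forall>y\<in>mspace \<mu>. mdist \<mu> x y < \<delta> \<longrightarrow> y \<in> mspace (n p) \<and> mdist (n p) x y < \<delta>1"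
      by blast
    have "mdist \<mu> x' y' < \<epsilon>" if h: "h \<in> S" "(x, x') \<in> h" "(y, y') \<in> h" and k: "x \<in> K" "x' \<in> K"
      and d: "mdist \<mu> x y < \<delta>" "mdist \<mu> x' y' < \<rho>" for h x y x' y'
    proof -
      have yy: "y \<in> mspace \<mu>" "y' \<in> mspace \<mu>" using S[OF h(1)] h sp by auto
      obtain p where p: "p \<in> F" "x \<in> C p" "n p \<in> D" using cover[OF k(1)] by blast
      have y: "y \<in> mspace (n p)" "mdist (n p) x y < \<delta>1" using \<delta>(2) p yy d by auto
      \<comment> \<open>Here the bound \<open>\<rho>\<close> on the images is used: it places
        \<open>y'\<close> in the member of \<open>D\<close> chosen for \<open>x'\<close>.\<close>
      obtain q where q: "q \<in> F" "x' \<in> C q" "n q \<in> D" "y' \<in> mspace (n q)"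
        using cover[OF k(2)] yy d by blast
      have "x \<in> mspace (n p)" "x' \<in> mspace (n q)" using C(1) p q by auto
      then have "mdist (n q) x' y' < \<epsilon>1" using \<delta>1(2) h p(3) q(3,4) y by blast
      then show ?thesis using \<epsilon>1(2) q by blast
    qed
    then show ?thesis using \<delta>(1) by (intro exI[of _ \<delta>]) blast
  qed
  then show ?thesis using \<rho>(1) by blast
qed

section \<open>Limits of pointwise equicontinuous relations\<close>

text \<open>Closures of the tails are nested nonempty closed sets in the compact product of copies
  of \<open>K\<close>; \<open>G\<close> is a point of their intersection. As \<open>J\<close> may be
  uncountable, a pointwise convergent subsequence need not exist; what is obtained is approximation
  at finitely many indices at once, for arbitrarily large \<open>n\<close>.\<close>

lemma pointwise_cluster_point:
  assumes K: "compactin (mtopology_of \<mu>) K" and F: "\<And>n i. i \<in> J \<Longrightarrow> F (n::nat) i \<in> K"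
  obtains G where "\<And>i. i \<in> J \<Longrightarrow> G i \<in> K"
    "\<And>I \<epsilon> N. finite I \<Longrightarrow> I \<subseteq> J \<Longrightarrow> \<epsilon> > 0 \<Longrightarrow> \<exists>n\<ge>N. \<forall>i\<in>I. mdist \<mu> (F n i) (G i) < \<epsilon>"
proof -
  define P where "P = product_topology (\<lambda>_. subtopology (mtopology_of \<mu>) K) J"
  have KM: "K \<subseteq> mspace \<mu>" using K by (rule compactin_subset_mspace)
  have topP: "topspace P = PiE J (\<lambda>_. K)"
    using KM by (simp add: P_def inf_absorb2)
  have "compact_space (subtopology (mtopology_of \<mu>) K)"
    using K by (simp add: compact_space_subtopology)
  then have cP: "compact_space P"
    unfolding P_def by (simp add: compact_space_product_topology)
  define g where "g n = restrict (F n) J" for n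
  have g: "g n \<in> topspace P" for n unfolding topP g_def using F by auto
  define C where "C N = P closure_of (g ` {N..})" for N
  have "(\<Inter>N. C N) \<noteq> {}"
  proof (rule compact_space_imp_nest[OF cP])
    show "closedin P (C N)" for N unfolding C_def by simp
    show "C N \<noteq> {}" for N
    proof -
      have "g N \<in> C N" unfolding C_def using g closure_of_subset[of "g ` {N..}" P] by blast
      then show ?thesis by blast
    qed
    show "decseq C" unfolding C_def decseq_def by (auto intro!: closure_of_mono)
  qed
  then obtain G where G: "\<And>N. G \<in> C N" by blast
  have GK: "G i \<in> K" if "i \<in> J" for i
  proof -
    have "G \<in> topspace P" using G[of 0] unfolding C_def by (simp add: in_closure_of)
    then show ?thesis using that unfolding topP by auto
  qed
  have "\<exists>n\<ge>N. \<forall>i\<in>I. mdist \<mu> (F n i) (G i) < \<epsilon>" if I: "finite I" "I \<subseteq> J" "\<epsilon> > 0" for I \<epsilon> N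
  proof -
    \<comment> \<open>A basic neighbourhood of the cluster point, constraining only the coordinates
      in \<open>I\<close>.\<close>
    define V where "V i = (if i \<in> I then K \<inter> mball_of \<mu> (G i) \<epsilon> else K)" for i
    have "openin P (PiE J V)"
      unfolding P_def openin_PiE_gen
    proof (intro disjI2 conjI ballI)
      have "{i \<in> J. V i \<noteq> topspace (subtopology (mtopology_of \<mu>) K)} \<subseteq> I"
        using KM by (auto simp: V_def inf_absorb2)
      then show "finite {i \<in> J. V i \<noteq> topspace (subtopology (mtopology_of \<mu>) K)}"
        using I(1) finite_subset by blast
      show "openin (subtopology (mtopology_of \<mu>) K) (V i)" for i
      proof (cases "i \<in> I")
        case True
        then show ?thesis
          unfolding V_def using openin_subtopology_Int2[OF openin_mball_of] by simp
      next
        case False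
        then show ?thesis
          unfolding V_def using KM openin_topspace[of "subtopology (mtopology_of \<mu>) K"]
          by (simp add: inf_absorb2)
      qed
    qed
    moreover have "G \<in> PiE J V"
    proof -
      have "G \<in> topspace P" using G[of 0] unfolding C_def by (simp add: in_closure_of)
      then have "G \<in> extensional J" unfolding topP by (simp add: PiE_def)
      moreover have "G i \<in> V i" if "i \<in> J" for i
        using GK[OF that] KM I(3) by (auto simp: V_def)
      ultimately show ?thesis by (auto simp: PiE_def)
    qed
    moreover have "G \<in> P closure_of (g ` {N..})" using G unfolding C_def by blast
    ultimately obtain n where n: "n \<ge> N" "g n \<in> PiE J V"
      unfolding in_closure_of by blast
    have "mdist \<mu> (F n i) (G i) < \<epsilon>" if i: "i \<in> I" for i
    proof -
      have "F n i \<in> V i" using n(2) i I(2) unfolding g_def by (auto simp: PiE_def Pi_def)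
      then show ?thesis using i by (simp add: V_def mdist_commute)
    qed
    then show ?thesis using n(1) by blast
  qed
  then show ?thesis using that GK by blast
qed

text \<open>An \<epsilon>/3 argument: the equicontinuity is uniform in \<open>n\<close>, and one
  \<open>n\<close> approximates \<open>\<gamma>\<close> at both \<open>x\<close> and
  \<open>y\<close>. That this \<open>n\<close> depends on the pair does no harm.\<close>

lemma cluster_map_continuous:
  assumes A: "A \<subseteq> mspace \<mu>" and fK: "\<And>n x. x \<in> A \<Longrightarrow> f (n::nat) x \<in> K" and \<gamma>K: "\<And>x. x \<in> A \<Longrightarrow> \<gamma> x \<in> K"
    and K: "K \<subseteq> mspace \<mu>"
    and equi: "\<And>x \<epsilon>. x \<in> A \<Longrightarrow> 0 < \<epsilon> \<Longrightarrow> \<exists>\<delta>>0. \<forall>n. \<forall>y\<in>A. mdist \<mu> x y < \<delta> \<longrightarrow> mdist \<mu> (f n x) (f n y) < \<epsilon>"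
    and cl: "\<And>x y \<epsilon>. x \<in> A \<Longrightarrow> y \<in> A \<Longrightarrow> 0 < \<epsilon> \<Longrightarrow> \<exists>n. mdist \<mu> (f n x) (\<gamma> x) < \<epsilon> \<and> mdist \<mu> (f n y) (\<gamma> y) < \<epsilon>"
    and opA: "openin (mtopology_of \<mu>) A" and V: "openin (mtopology_of \<mu>) V"
  shows "openin (mtopology_of \<mu>) {x \<in> A. \<gamma> x \<in> V}"
  unfolding openin_mtopology_of
proof (intro conjI ballI)
  show "{x \<in> A. \<gamma> x \<in> V} \<subseteq> mspace \<mu>" using A by blast
  fix x assume "x \<in> {x \<in> A. \<gamma> x \<in> V}"
  then have x: "x \<in> A" "\<gamma> x \<in> V" by auto
  obtain \<epsilon> where \<epsilon>: "\<epsilon> > 0" "\<And>y. y \<in> mspace \<mu> \<Longrightarrow> mdist \<mu> (\<gamma> x) y < \<epsilon> \<Longrightarrow> y \<in> V"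
    using V x(2) unfolding openin_mtopology_of by blast
  have "\<exists>\<delta>>0. \<forall>n. \<forall>y\<in>A. mdist \<mu> x y < \<delta> \<longrightarrow> mdist \<mu> (f n x) (f n y) < \<epsilon> / 3"
    using \<epsilon>(1) by (intro equi x) simp
  then obtain \<delta> where \<delta>: "\<delta> > 0" "\<And>n y. y \<in> A \<Longrightarrow> mdist \<mu> x y < \<delta> \<Longrightarrow> mdist \<mu> (f n x) (f n y) < \<epsilon> / 3"
    by blast
  obtain r where r: "r > 0" "\<And>y. y \<in> mspace \<mu> \<Longrightarrow> mdist \<mu> x y < r \<Longrightarrow> y \<in> A"
    using opA x(1) unfolding openin_mtopology_of by blast
  have "y \<in> {x \<in> A. \<gamma> x \<in> V}" if y: "y \<in> mspace \<mu>" "mdist \<mu> x y < min \<delta> r" for y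
  proof -
    have yA: "y \<in> A" using r y by auto
    obtain n where n: "mdist \<mu> (f n x) (\<gamma> x) < \<epsilon>/3" "mdist \<mu> (f n y) (\<gamma> y) < \<epsilon>/3"
      using cl[OF x(1) yA, of "\<epsilon>/3"] \<epsilon>(1) by auto
    have m: "f n x \<in> mspace \<mu>" "f n y \<in> mspace \<mu>" "\<gamma> x \<in> mspace \<mu>" "\<gamma> y \<in> mspace \<mu>"
      using fK \<gamma>K K x yA by blast+
    have "mdist \<mu> (f n x) (f n y) < \<epsilon>/3" using \<delta>(2)[OF yA] y(2) by simp
    then have "mdist \<mu> (\<gamma> x) (\<gamma> y) < \<epsilon>"
      using n mdist_triangle[OF m(3,1,4)] mdist_triangle[OF m(1,2,4)] mdist_commute[of \<mu> "f n x" "\<gamma> x"]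
      by linarith
    then show ?thesis using \<epsilon>(2)[OF m(4)] yA by blast
  qed
  then show "\<exists>r>0. \<forall>y\<in>mspace \<mu>. mdist \<mu> x y < r \<longrightarrow> y \<in> {x \<in> A. \<gamma> x \<in> V}"
    using \<delta>(1) r(1) by (intro exI[of _ "min \<delta> r"]) auto
qed

text \<open>Cluster maps \<open>\<gamma>\<close> of the \<open>c n\<close> on \<open>A\<close> and
  \<open>\<gamma>'\<close> of their inverses on \<open>E\<close> are taken jointly, and
  \<open>g\<close> is the part of \<open>\<gamma>\<close> that \<open>\<gamma>'\<close> undoes. The
  last clause of the conclusion says that a pair of \<open>g\<close> is approximated in either
  coordinate with the other one held fixed; this is how closed invariant sets pass to
  \<open>g\<close>.\<close>

lemma limit_local_homeomorphism:
  fixes c :: "nat \<Rightarrow> ('p \<times> 'p) set"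
  assumes K: "compactin (mtopology_of \<mu>) K"
    and A: "openin (mtopology_of \<mu>) A" and E: "openin (mtopology_of \<mu>) E"
    and cA: "\<And>n x. x \<in> A \<Longrightarrow> \<exists>x'\<in>K. (x, x') \<in> c n"
    and cE: "\<And>n v. v \<in> E \<Longrightarrow> \<exists>x\<in>K. (x, v) \<in> c n"
    and eA: "\<And>x \<epsilon>. x \<in> A \<Longrightarrow> 0 < \<epsilon> \<Longrightarrow> \<exists>\<delta>>0. \<forall>n x' y y'.
        (x, x') \<in> c n \<and> (y, y') \<in> c n \<and> y \<in> mspace \<mu> \<and> mdist \<mu> x y < \<delta> \<longrightarrow> mdist \<mu> x' y' < \<epsilon>"
    and eE: "\<And>v \<epsilon>. v \<in> E \<Longrightarrow> 0 < \<epsilon> \<Longrightarrow> \<exists>\<delta>>0. \<forall>n x y y'.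
        (x, v) \<in> c n \<and> (y, y') \<in> c n \<and> y' \<in> mspace \<mu> \<and> mdist \<mu> v y' < \<delta> \<longrightarrow> mdist \<mu> x y < \<epsilon>"
    and w: "w \<in> A" "z \<in> E" "\<And>n. (w, zs n) \<in> c n" "\<And>n. zs n \<in> mspace \<mu>"
    and lim: "\<And>\<epsilon>. \<epsilon> > 0 \<Longrightarrow> \<exists>N. \<forall>n\<ge>N. mdist \<mu> (zs n) z < \<epsilon>"
  shows "\<exists>g. local_homeomorphism (mtopology_of \<mu>) g \<and> (w, z) \<in> g \<and>
     (\<forall>x x' \<epsilon>. (x, x') \<in> g \<and> \<epsilon> > 0 \<longrightarrow>
        (\<exists>n y'. (x, y') \<in> c n \<and> y' \<in> mspace \<mu> \<and> mdist \<mu> x' y' < \<epsilon>) \<and>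
        (\<exists>n y. (y, x') \<in> c n \<and> y \<in> mspace \<mu> \<and> mdist \<mu> x y < \<epsilon>))"
proof -
  have KM: "K \<subseteq> mspace \<mu>" using K by (rule compactin_subset_mspace)
  have AM: "A \<subseteq> mspace \<mu>" and EM: "E \<subseteq> mspace \<mu>"
    using A E unfolding openin_mtopology_of by auto
  define f where "f n x = (SOME x'. x' \<in> K \<and> (x, x') \<in> c n)" for n x
  define f' where "f' n v = (SOME x. x \<in> K \<and> (x, v) \<in> c n)" for n v
  have f: "f n x \<in> K" "(x, f n x) \<in> c n" if "x \<in> A" for n x
    using someI_ex[of "\<lambda>x'. x' \<in> K \<and> (x, x') \<in> c n"] cA[OF that, of n] unfolding f_def by blast+
  have f': "f' n v \<in> K" "(f' n v, v) \<in> c n" if "v \<in> E" for n v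
    using someI_ex[of "\<lambda>x. x \<in> K \<and> (x, v) \<in> c n"] cE[OF that, of n] unfolding f'_def by blast+
  \<comment> \<open>Indices \<open>Inl x\<close> stand for the maps and \<open>Inr v\<close> for
    their inverses, so that one choice of \<open>n\<close> later serves both.\<close>
  have FK: "case_sum (f n) (f' n) i \<in> K" if "i \<in> A <+> E" for n i
    using that f f' by auto
  obtain G where GK: "\<And>i. i \<in> A <+> E \<Longrightarrow> G i \<in> K"
    and Gcl: "\<And>I \<epsilon> N. finite I \<Longrightarrow> I \<subseteq> A <+> E \<Longrightarrow> \<epsilon> > 0 \<Longrightarrow>
       \<exists>n\<ge>N. \<forall>i\<in>I. mdist \<mu> (case_sum (f n) (f' n) i) (G i) < \<epsilon>"
    using pointwise_cluster_point[where F = "\<lambda>n. case_sum (f n) (f' n)", OF K FK] by blast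
  define \<gamma> where "\<gamma> x = G (Inl x)" for x
  define \<gamma>' where "\<gamma>' v = G (Inr v)" for v
  have \<gamma>: "\<gamma> x \<in> K" if "x \<in> A" for x using GK that unfolding \<gamma>_def by auto
  have \<gamma>': "\<gamma>' v \<in> K" if "v \<in> E" for v using GK that unfolding \<gamma>'_def by auto
  have opA: "openin (mtopology_of \<mu>) {x \<in> A. \<gamma> x \<in> V}" if V: "openin (mtopology_of \<mu>) V" for V
  proof (rule cluster_map_continuous[where f = f and K = K])
    show "\<exists>\<delta>>0. \<forall>n. \<forall>y\<in>A. mdist \<mu> x y < \<delta> \<longrightarrow> mdist \<mu> (f n x) (f n y) < \<epsilon>"
      if "x \<in> A" "0 < \<epsilon>" for x \<epsilon>
      using eA[OF that] f(2) that(1) AM by (meson subsetD)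
    show "\<exists>n. mdist \<mu> (f n x) (\<gamma> x) < \<epsilon> \<and> mdist \<mu> (f n y) (\<gamma> y) < \<epsilon>"
      if "x \<in> A" "y \<in> A" "0 < \<epsilon>" for x y \<epsilon>
      using Gcl[of "{Inl x, Inl y}" \<epsilon> 0] that unfolding \<gamma>_def by auto
  qed (use AM KM f \<gamma> A V in auto)
  have opE: "openin (mtopology_of \<mu>) {v \<in> E. \<gamma>' v \<in> V}" if V: "openin (mtopology_of \<mu>) V" for V
  proof (rule cluster_map_continuous[where f = f' and K = K])
    show "\<exists>\<delta>>0. \<forall>n. \<forall>y\<in>E. mdist \<mu> x y < \<delta> \<longrightarrow> mdist \<mu> (f' n x) (f' n y) < \<epsilon>"
      if "x \<in> E" "0 < \<epsilon>" for x \<epsilon>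
      using eE[OF that] f'(2) that(1) EM by (meson subsetD)
    show "\<exists>n. mdist \<mu> (f' n x) (\<gamma>' x) < \<epsilon> \<and> mdist \<mu> (f' n y) (\<gamma>' y) < \<epsilon>"
      if "x \<in> E" "y \<in> E" "0 < \<epsilon>" for x y \<epsilon>
      using Gcl[of "{Inr x, Inr y}" \<epsilon> 0] that unfolding \<gamma>'_def by auto
  qed (use EM KM f' \<gamma>' E V in auto)
  have le_zero: "a = b" if "a \<in> mspace \<mu>" "b \<in> mspace \<mu>" "\<And>\<epsilon>. \<epsilon> > 0 \<Longrightarrow> mdist \<mu> a b < \<epsilon>" for a b
  proof -
    have "\<not> mdist \<mu> a b > 0" using that(3)[of "mdist \<mu> a b"] by auto
    then have "mdist \<mu> a b = 0" using mdist_nonneg[of \<mu> a b] by linarith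
    then show ?thesis using that by simp
  qed
  \<comment> \<open>For one \<open>n\<close>, the relation \<open>c n\<close> takes \<open>x\<close>
    to a point near \<open>\<gamma> x\<close> and \<open>f' n (\<gamma> x)\<close> to
    \<open>\<gamma> x\<close> itself. Equicontinuity of the inverses at \<open>\<gamma> x\<close>
    makes these two arguments close, and \<open>f' n (\<gamma> x)\<close> is close to
    \<open>\<gamma>' (\<gamma> x)\<close>.\<close>
  have inv1: "\<gamma>' (\<gamma> x) = x" if x: "x \<in> A" "\<gamma> x \<in> E" for x
  proof (rule le_zero)
    have m: "\<gamma> x \<in> mspace \<mu>" "x \<in> mspace \<mu>" "\<gamma>' (\<gamma> x) \<in> mspace \<mu>"
      using x \<gamma>[OF x(1)] \<gamma>'[OF x(2)] KM AM by auto
    then show "\<gamma>' (\<gamma> x) \<in> mspace \<mu>" "x \<in> mspace \<mu>" by auto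
    fix \<epsilon> :: real assume \<epsilon>: "\<epsilon> > 0"
    have "\<exists>\<delta>>0. \<forall>n u y y'. (u, \<gamma> x) \<in> c n \<and> (y, y') \<in> c n \<and> y' \<in> mspace \<mu> \<and> mdist \<mu> (\<gamma> x) y' < \<delta> \<longrightarrow> mdist \<mu> u y < \<epsilon>/2"
      using \<epsilon> by (intro eE x) simp
    then obtain \<delta> where \<delta>: "\<delta> > 0" "\<And>n u y y'. (u, \<gamma> x) \<in> c n \<Longrightarrow> (y, y') \<in> c n \<Longrightarrow> y' \<in> mspace \<mu> \<Longrightarrow> mdist \<mu> (\<gamma> x) y' < \<delta> \<Longrightarrow> mdist \<mu> u y < \<epsilon>/2"
      by meson
    obtain n where n: "mdist \<mu> (f n x) (\<gamma> x) < min \<delta> (\<epsilon>/2)" "mdist \<mu> (f' n (\<gamma> x)) (\<gamma>' (\<gamma> x)) < min \<delta> (\<epsilon>/2)"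
      using Gcl[of "{Inl x, Inr (\<gamma> x)}" "min \<delta> (\<epsilon>/2)" 0] \<delta>(1) \<epsilon> x unfolding \<gamma>_def \<gamma>'_def by auto
    have fm: "f n x \<in> mspace \<mu>" "f' n (\<gamma> x) \<in> mspace \<mu>" using f f' x KM by blast+
    have "mdist \<mu> (f' n (\<gamma> x)) x < \<epsilon>/2"
      using \<delta>(2)[OF f'(2)[OF x(2)] f(2)[OF x(1)] fm(1)] n(1) by (simp add: mdist_commute)
    then show "mdist \<mu> (\<gamma>' (\<gamma> x)) x < \<epsilon>"
      using n(2) mdist_triangle[OF m(3) fm(2) m(2)] by (simp add: mdist_commute)
  qed
  have inv2: "\<gamma> (\<gamma>' v) = v" if v: "v \<in> E" "\<gamma>' v \<in> A" for v
  proof (rule le_zero)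
    have m: "\<gamma>' v \<in> mspace \<mu>" "v \<in> mspace \<mu>" "\<gamma> (\<gamma>' v) \<in> mspace \<mu>"
      using v \<gamma>'[OF v(1)] \<gamma>[OF v(2)] KM EM by auto
    then show "\<gamma> (\<gamma>' v) \<in> mspace \<mu>" "v \<in> mspace \<mu>" by auto
    fix \<epsilon> :: real assume \<epsilon>: "\<epsilon> > 0"
    have "\<exists>\<delta>>0. \<forall>n u y y'. (\<gamma>' v, u) \<in> c n \<and> (y, y') \<in> c n \<and> y \<in> mspace \<mu> \<and> mdist \<mu> (\<gamma>' v) y < \<delta> \<longrightarrow> mdist \<mu> u y' < \<epsilon>/2"
      using \<epsilon> by (intro eA v) simp
    then obtain \<delta> where \<delta>: "\<delta> > 0" "\<And>n u y y'. (\<gamma>' v, u) \<in> c n \<Longrightarrow> (y, y') \<in> c n \<Longrightarrow> y \<in> mspace \<mu> \<Longrightarrow> mdist \<mu> (\<gamma>' v) y < \<delta> \<Longrightarrow> mdist \<mu> u y' < \<epsilon>/2"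
      by meson
    obtain n where n: "mdist \<mu> (f' n v) (\<gamma>' v) < min \<delta> (\<epsilon>/2)" "mdist \<mu> (f n (\<gamma>' v)) (\<gamma> (\<gamma>' v)) < min \<delta> (\<epsilon>/2)"
      using Gcl[of "{Inr v, Inl (\<gamma>' v)}" "min \<delta> (\<epsilon>/2)" 0] \<delta>(1) \<epsilon> v unfolding \<gamma>_def \<gamma>'_def by auto
    have fm: "f' n v \<in> mspace \<mu>" "f n (\<gamma>' v) \<in> mspace \<mu>" using f f' v KM by blast+
    have "mdist \<mu> (f n (\<gamma>' v)) v < \<epsilon>/2"
      using \<delta>(2)[OF f(2)[OF v(2)] f'(2)[OF v(1)] fm(1)] n(1) by (simp add: mdist_commute)
    then show "mdist \<mu> (\<gamma> (\<gamma>' v)) v < \<epsilon>"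
      using n(2) mdist_triangle[OF m(3) fm(2) m(2)] by (simp add: mdist_commute)
  qed
  have \<gamma>w: "\<gamma> w = z"
  proof (rule le_zero)
    have m: "\<gamma> w \<in> mspace \<mu>" "z \<in> mspace \<mu>" using \<gamma> w KM EM by auto
    then show "\<gamma> w \<in> mspace \<mu>" "z \<in> mspace \<mu>" by auto
    \<comment> \<open>Equicontinuity at \<open>w\<close>, applied with \<open>y = w\<close>, leaves
      \<open>c n\<close> a single value in the metric space there, so the chosen
      \<open>f n w\<close> is the prescribed \<open>zs n\<close>.\<close>
    have fw: "f n w = zs n" for n
    proof (rule le_zero)
      show "f n w \<in> mspace \<mu>" "zs n \<in> mspace \<mu>" using f w KM by auto
      fix \<epsilon> :: real assume "\<epsilon> > 0"
      from eA[OF w(1) this] obtain \<delta> where "\<delta> > 0" "\<forall>n x' y y'.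
        (w, x') \<in> c n \<and> (y, y') \<in> c n \<and> y \<in> mspace \<mu> \<and> mdist \<mu> w y < \<delta> \<longrightarrow> mdist \<mu> x' y' < \<epsilon>" by blast
      moreover have "mdist \<mu> w w = 0" "w \<in> mspace \<mu>" using w AM by auto
      ultimately show "mdist \<mu> (f n w) (zs n) < \<epsilon>" using f(2)[OF w(1)] w(3) by metis
    qed
    fix \<epsilon> :: real assume \<epsilon>: "\<epsilon> > 0"
    obtain N where N: "\<forall>n\<ge>N. mdist \<mu> (zs n) z < \<epsilon>/2" using lim[of "\<epsilon>/2"] \<epsilon> by auto
    \<comment> \<open>An index beyond \<open>N\<close> is required, since \<open>zs n\<close> is
      near \<open>z\<close> only eventually.\<close>
    obtain n where n: "n \<ge> N" "mdist \<mu> (f n w) (\<gamma> w) < \<epsilon>/2"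
      using Gcl[of "{Inl w}" "\<epsilon>/2" N] \<epsilon> w unfolding \<gamma>_def by auto
    have "mdist \<mu> (zs n) z < \<epsilon>/2" using N n(1) by blast
    then show "mdist \<mu> (\<gamma> w) z < \<epsilon>"
      using n(2) mdist_triangle[OF m(1) w(4)[of n] m(2)] unfolding fw by (simp add: mdist_commute)
  qed
  define g where "g = {(x, x'). x \<in> A \<and> x' \<in> E \<and> \<gamma> x = x' \<and> \<gamma>' x' = x}"
  have "local_homeomorphism (mtopology_of \<mu>) g"
    unfolding local_homeomorphism_iff
  proof (intro conjI allI impI)
    show "g \<subseteq> topspace (mtopology_of \<mu>) \<times> topspace (mtopology_of \<mu>)"
      using AM EM by (auto simp: g_def)
    show "single_valued g" "single_valued (g\<inverse>)" by (auto simp: g_def single_valued_def)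
    fix V assume V: "openin (mtopology_of \<mu>) V"
    \<comment> \<open>Images under \<open>g\<close> are preimages under \<open>\<gamma>'\<close>, so
      openness in both directions comes from continuity of the two cluster maps.\<close>
    have "g `` V = {v \<in> E. \<gamma>' v \<in> V \<inter> A}"
      using inv2 by (force simp: g_def)
    then show "openin (mtopology_of \<mu>) (g `` V)" using opE[of "V \<inter> A"] V A by auto
    have "g\<inverse> `` V = {x \<in> A. \<gamma> x \<in> V \<inter> E}"
      using inv1 by (force simp: g_def)
    then show "openin (mtopology_of \<mu>) (g\<inverse> `` V)" using opA[of "V \<inter> E"] V E by auto
  qed
  moreover have "(w, z) \<in> g" using \<gamma>w inv1[of w] w by (auto simp: g_def)
  moreover have "(\<exists>n y'. (x, y') \<in> c n \<and> y' \<in> mspace \<mu> \<and> mdist \<mu> x' y' < \<epsilon>) \<and>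
        (\<exists>n y. (y, x') \<in> c n \<and> y \<in> mspace \<mu> \<and> mdist \<mu> x y < \<epsilon>)"
    if g: "(x, x') \<in> g" and \<epsilon>: "\<epsilon> > 0" for x x' \<epsilon>
  proof -
    have x: "x \<in> A" "x' \<in> E" "\<gamma> x = x'" "\<gamma>' x' = x" using g by (auto simp: g_def)
    obtain n where "mdist \<mu> (f n x) x' < \<epsilon>" "mdist \<mu> (f' n x') x < \<epsilon>"
      using Gcl[of "{Inl x, Inr x'}" \<epsilon> 0] \<epsilon> x unfolding \<gamma>_def \<gamma>'_def by auto
    moreover have "f n x \<in> mspace \<mu>" "f' n x' \<in> mspace \<mu>" using f f' x KM by blast+
    ultimately show ?thesis
      using f(2)[OF x(1), of n] f'(2)[OF x(2), of n] mdist_commute by metis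
  qed
  ultimately show ?thesis by blast
qed

section \<open>Germs and chains\<close>

text \<open>\<open>S\<close> need not be closed under restriction and union, so an element of the
  pseudogroup need not lie in \<open>S\<close>. Restriction and union create no new germs, however,
  and composition and inversion can be carried out in \<open>S\<close>. The generators
  \<open>E\<close> are kept apart from \<open>S\<close> so that the identity can be adjoined to
  \<open>S\<close> while the pseudogroup stays as it is.\<close>

lemma generated_pseudogroup_germ:
  assumes loc: "\<forall>s\<in>S. local_homeomorphism T s" and sym: "symmetric_maps S"
    and cc: "closed_under_composition S" and id: "Id_on (topspace T) \<in> S" and "E \<subseteq> S"
    and h: "h \<in> generated_pseudogroup T E" "(x, x') \<in> h"
  shows "\<exists>s\<in>S. \<exists>N. openin T N \<and> x \<in> N \<and> (\<forall>y\<in>N. \<forall>y'. (y, y') \<in> h \<longrightarrow> (y, y') \<in> s)"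
  using h
proof (induction arbitrary: x x' rule: generated_pseudogroup.induct)
  have "\<forall>s\<in>E. local_homeomorphism T s" using loc \<open>E \<subseteq> S\<close> by blast
  from pseudogroup_generated_pseudogroup[OF this]
  have pg: "local_homeomorphism T h" if "h \<in> generated_pseudogroup T E" for h
    using that by (simp add: pseudogroup_def)
  {
    case (base h)
    then have "local_homeomorphism T h" "h \<in> S" using loc \<open>E \<subseteq> S\<close> by blast+
    then have "x \<in> topspace T"
      using base.prems unfolding local_homeomorphism_iff by blast
    then show ?case using \<open>h \<in> S\<close> by blast
  next
    case ident
    then show ?case using id by (intro bexI[of _ "Id_on (topspace T)"] exI[of _ "topspace T"]) auto
  next
    case (comp h g)
    then obtain y where y: "(x, y) \<in> h" "(y, x') \<in> g" by blast
    obtain s N where s: "s \<in> S" "openin T N" "x \<in> N"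
      "\<forall>y\<in>N. \<forall>y'. (y, y') \<in> h \<longrightarrow> (y, y') \<in> s" using comp.IH(1)[OF y(1)] by blast
    obtain t M where t: "t \<in> S" "openin T M" "y \<in> M"
      "\<forall>y\<in>M. \<forall>y'. (y, y') \<in> g \<longrightarrow> (y, y') \<in> t" using comp.IH(2)[OF y(2)] by blast
    have h: "single_valued h" "openin T (h\<inverse> `` M)"
      using pg[OF comp.hyps(1)] t(2) unfolding local_homeomorphism_iff by simp_all
    \<comment> \<open>The neighbourhood is cut down to points that \<open>h\<close> sends into
      \<open>M\<close>, where \<open>t\<close> takes over from \<open>g\<close>.\<close>
    have NM: "openin T (N \<inter> h\<inverse> `` M)" using s(2) h(2) by (rule openin_Int)
    have "s O t \<in> S" using cc s(1) t(1) unfolding closed_under_composition_def by blast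
    moreover have "x \<in> N \<inter> h\<inverse> `` M" using s(3) t(3) y(1) by blast
    moreover have "(u, u') \<in> s O t" if u: "u \<in> N \<inter> h\<inverse> `` M" "(u, u') \<in> h O g" for u u'
    proof -
      obtain v where v: "(u, v) \<in> h" "(v, u') \<in> g" using u(2) by blast
      have "v \<in> M" using u(1) v(1) h(1) unfolding single_valued_def by blast
      then show ?thesis using v s(4) t(4) u(1) by blast
    qed
    ultimately show ?case using NM by blast
  next
    case (inverse h)
    then obtain s N where s: "s \<in> S" "openin T N" "x' \<in> N"
      "\<forall>y\<in>N. \<forall>y'. (y, y') \<in> h \<longrightarrow> (y, y') \<in> s" by blast
    have h: "single_valued (h\<inverse>)" "openin T (h `` N)"
      using pg[OF inverse.hyps] s(2) unfolding local_homeomorphism_iff by simp_all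
    have "s\<inverse> \<in> S"
      using s(1) sym unfolding symmetric_maps_def by blast
    moreover have "x \<in> h `` N" using inverse.prems s(3) by blast
    moreover have "(u, u') \<in> s\<inverse>" if u: "u \<in> h `` N" "(u, u') \<in> h\<inverse>" for u u'
    proof -
      obtain v where v: "v \<in> N" "(v, u) \<in> h" using u(1) by blast
      then have "v = u'" using h(1) u(2) unfolding single_valued_def by blast
      then show ?thesis using v s(4) by blast
    qed
    ultimately show ?case using h(2) by blast
  next
    case (restrict h V)
    then have "(x, x') \<in> h" by blast
    then obtain s N where s: "s \<in> S" "openin T N" "x \<in> N"
      "\<forall>y\<in>N. \<forall>y'. (y, y') \<in> h \<longrightarrow> (y, y') \<in> s" using restrict.IH by blast
    then have "\<forall>y\<in>N. \<forall>y'. (y, y') \<in> Id_on V O h \<longrightarrow> (y, y') \<in> s" by blast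
    then show ?case using s by blast
  next
    case (combine G)
    then obtain g where g: "g \<in> G" "(x, x') \<in> g" by blast
    then obtain s N where s: "s \<in> S" "openin T N" "x \<in> N"
      "\<forall>y\<in>N. \<forall>y'. (y, y') \<in> g \<longrightarrow> (y, y') \<in> s" using combine.IH by blast
    have "openin T (Domain g)" using pg[OF combine.hyps(1)[OF g(1)]] unfolding local_homeomorphism_def by simp
    \<comment> \<open>On the domain of \<open>g\<close> the single-valued union agrees with
      \<open>g\<close>; elsewhere in \<open>N\<close> other members of \<open>G\<close> could take
      over.\<close>
    then have "openin T (N \<inter> Domain g)" using s(2) by blast
    moreover have "x \<in> N \<inter> Domain g" using s g by blast
    moreover have "(u, u') \<in> s" if u: "u \<in> N \<inter> Domain g" "(u, u') \<in> \<Union>G" for u u'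
    proof -
      obtain v where v: "(u, v) \<in> g" using u(1) by blast
      then have "(u, v) \<in> \<Union>G" using g(1) by blast
      moreover have "single_valued (\<Union>G)" using combine.hyps(2) unfolding local_homeomorphism_iff by simp
      ultimately have "v = u'" using u(2) by (meson single_valuedD)
      then show ?thesis using v s(4) u(1) by blast
    qed
    ultimately show ?case using s(1) by blast
  }
qed

text \<open>The composite of the maps \<open>hol\<close> along a path of \<open>P\<close>-steps. It
  starts from the identity of the whole type, so its domain is cut down only by the steps actually
  taken.\<close>

inductive chain :: "('p \<times> 'p) set \<Rightarrow> ('p \<Rightarrow> 'p \<Rightarrow> ('p \<times> 'p) set) \<Rightarrow> 'p \<Rightarrow> 'p \<Rightarrow> ('p \<times> 'p) set \<Rightarrow> bool"
  for P hol where
  chain_refl: "chain P hol p p Id"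
| chain_step: "chain P hol p q c \<Longrightarrow> (q, r) \<in> P \<Longrightarrow> chain P hol p r (c O hol q r)"

text \<open>Chains grow at their end; reversing one needs growth at the start.\<close>

lemma chain_prepend:
  assumes "chain P hol q r c" "(p, q) \<in> P"
  shows "chain P hol p r (hol p q O c)"
  using assms
proof (induction rule: chain.induct)
  case (chain_refl q)
  then show ?case using chain.chain_step[OF chain.chain_refl, of p q P hol] by simp
next
  case (chain_step q r c s)
  then show ?case using chain.chain_step[of P hol p r "hol p q O c" s] by (simp add: O_assoc)
qed

lemma rtrancl_chain:
  assumes "(p, q) \<in> P\<^sup>*" shows "\<exists>c. chain P hol p q c"
  using assms
proof (induction rule: rtrancl_induct)
  case base
  show ?case using chain.chain_refl by (rule exI)
next
  case (step q r)
  then obtain c where "chain P hol p q c" by blast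
  from chain.chain_step[OF this step.hyps(2)] show ?case by (rule exI)
qed

text \<open>
  Composites along chains are defined on balls whose size does not depend on the length of the
  chain: \<open>equi\<close> keeps two nearby orbits close unless a step throws them more than \<open>\<rho>\<close> apart, and
  \<open>hol_unif\<close> excludes such jumps.
\<close>

locale equicontinuous_chains =
  fixes \<mu> :: "'p metric" and S :: "('p \<times> 'p) set set" and K :: "'p set" and \<rho> :: real
    and P :: "('p \<times> 'p) set" and hol :: "'p \<Rightarrow> 'p \<Rightarrow> ('p \<times> 'p) set"
  assumes S_sub: "\<And>s. s \<in> S \<Longrightarrow> s \<subseteq> mspace \<mu> \<times> mspace \<mu>"
    and S_id: "Id_on (mspace \<mu>) \<in> S"
    and S_comp: "\<And>s t. s \<in> S \<Longrightarrow> t \<in> S \<Longrightarrow> s O t \<in> S"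
    and K: "compactin (mtopology_of \<mu>) K"
    and \<rho>: "0 < \<rho>"
    and equi: "\<And>\<epsilon>. 0 < \<epsilon> \<Longrightarrow> \<exists>\<delta>>0. \<forall>s\<in>S. \<forall>x y x' y'. (x, x') \<in> s \<and> (y, y') \<in> s \<and> x \<in> K \<and> x' \<in> K \<and>
        mdist \<mu> x y < \<delta> \<and> mdist \<mu> x' y' < \<rho> \<longrightarrow> mdist \<mu> x' y' < \<epsilon>"
    and P_sub: "P \<subseteq> K \<times> K" and P_sym: "sym P"
    and hol_sv: "\<And>p q. (p, q) \<in> P \<Longrightarrow> single_valued (hol p q)"
    and hol_mem: "\<And>p q. (p, q) \<in> P \<Longrightarrow> (p, q) \<in> hol p q"
    and hol_conv: "\<And>p q. (p, q) \<in> P \<Longrightarrow> hol q p = (hol p q)\<inverse>"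
    and hol_unif: "\<And>\<epsilon>. 0 < \<epsilon> \<Longrightarrow> \<exists>\<eta>>0. \<forall>(p, q)\<in>P. \<exists>s\<in>S. (p, q) \<in> s \<and>
        (\<forall>x\<in>mball_of \<mu> p \<eta>. \<exists>x'. (x, x') \<in> hol p q \<inter> s \<and> mdist \<mu> q x' < \<epsilon>)"
begin

lemma KM: "K \<subseteq> mspace \<mu>"
  using K by (rule compactin_subset_mspace)

lemma chain_converse: "chain P hol p q c \<Longrightarrow> chain P hol q p (c\<inverse>)"
proof (induction rule: chain.induct)
  case (chain_refl p)
  then show ?case by (simp add: chain.chain_refl)
next
  case (chain_step p q c r)
  then have "(r, q) \<in> P" using P_sym by (meson symE)
  from chain_prepend[OF chain_step.IH this] show ?case
    using hol_conv[OF chain_step.hyps(2)] by (simp add: converse_relcomp)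
qed

lemma chain_single_valued: "chain P hol p q c \<Longrightarrow> single_valued c"
  by (induction rule: chain.induct) (auto intro: single_valued_relcomp hol_sv)

lemma chain_mem: "chain P hol p q c \<Longrightarrow> (p, q) \<in> c"
  by (induction rule: chain.induct) (use hol_mem in auto)

text \<open>The bound kept through the induction is \<open>\<eta>\<close>, the same at every length.
  A point within \<open>\<eta>\<close> of \<open>q\<close> is in reach of the next step, which lands
  it within \<open>\<rho>\<close> of \<open>r\<close>; equicontinuity of the composite from the
  start \<open>p\<close> then improves \<open>\<rho>\<close> to \<open>\<eta>\<close>.
  Equicontinuity is applied to the accompanying element of \<open>S\<close>, as the chain itself
  need not belong to \<open>S\<close>.\<close>

lemma chain_uniform_domain:
  assumes "0 < \<epsilon>"
  obtains \<delta> where "0 < \<delta>"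
    "\<And>p q c. chain P hol p q c \<Longrightarrow> p \<in> K \<Longrightarrow>
       \<exists>s\<in>S. (p, q) \<in> s \<and> (\<forall>x\<in>mball_of \<mu> p \<delta>. \<exists>x'. (x, x') \<in> c \<inter> s \<and> mdist \<mu> q x' < \<epsilon>)"
proof -
  define \<epsilon>' where "\<epsilon>' = min \<epsilon> \<rho>"
  have \<epsilon>': "0 < \<epsilon>'" "\<epsilon>' \<le> \<epsilon>" "\<epsilon>' \<le> \<rho>" using assms \<rho> by (auto simp: \<epsilon>'_def)
  obtain \<eta>' where \<eta>': "0 < \<eta>'" "\<forall>(p, q)\<in>P. \<exists>s\<in>S. (p, q) \<in> s \<and>
        (\<forall>x\<in>mball_of \<mu> p \<eta>'. \<exists>x'. (x, x') \<in> hol p q \<inter> s \<and> mdist \<mu> q x' < \<epsilon>')"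
    using hol_unif[OF \<epsilon>'(1)] by blast
  \<comment> \<open>\<open>\<eta> \<le> \<eta>'\<close> keeps the image inside the domain of the
    next step; \<open>\<eta> \<le> \<epsilon>\<close> gives the bound that is claimed.\<close>
  define \<eta> where "\<eta> = min \<eta>' \<epsilon>"
  have \<eta>: "0 < \<eta>" "\<eta> \<le> \<eta>'" "\<eta> \<le> \<epsilon>" using assms \<eta>' by (auto simp: \<eta>_def)
  obtain \<delta>' where \<delta>': "0 < \<delta>'" "\<And>s x y x' y'. s \<in> S \<Longrightarrow> (x, x') \<in> s \<Longrightarrow> (y, y') \<in> s \<Longrightarrow> x \<in> K \<Longrightarrow> x' \<in> K \<Longrightarrow>
        mdist \<mu> x y < \<delta>' \<Longrightarrow> mdist \<mu> x' y' < \<rho> \<Longrightarrow> mdist \<mu> x' y' < \<eta>"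
    using equi[OF \<eta>(1)] by meson
  \<comment> \<open>\<open>\<delta> \<le> \<eta>\<close> serves the empty chain, where the image is
    the point itself.\<close>
  define \<delta> where "\<delta> = min \<delta>' \<eta>"
  have \<delta>: "0 < \<delta>" "\<delta> \<le> \<delta>'" "\<delta> \<le> \<eta>" using \<delta>' \<eta> by (auto simp: \<delta>_def)
  have "\<exists>s\<in>S. (p, q) \<in> s \<and> (\<forall>x\<in>mball_of \<mu> p \<delta>. \<exists>x'. (x, x') \<in> c \<inter> s \<and> mdist \<mu> q x' < \<eta>)"
    if "chain P hol p q c" "p \<in> K" for p q c
    using that
  proof (induction rule: chain.induct)
    case (chain_refl p)
    then have "(p, p) \<in> Id_on (mspace \<mu>)" using KM by auto
    then show ?case using S_id \<delta>(3) by (intro bexI[of _ "Id_on (mspace \<mu>)"]) auto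
  next
    case (chain_step p q c r)
    then obtain s where s: "s \<in> S" "(p, q) \<in> s"
      "\<forall>x\<in>mball_of \<mu> p \<delta>. \<exists>x'. (x, x') \<in> c \<inter> s \<and> mdist \<mu> q x' < \<eta>" by blast
    obtain t where t: "t \<in> S" "(q, r) \<in> t"
      "\<forall>x\<in>mball_of \<mu> q \<eta>'. \<exists>x'. (x, x') \<in> hol q r \<inter> t \<and> mdist \<mu> r x' < \<epsilon>'"
      using \<eta>'(2) chain_step.hyps(2) by blast
    have qr: "q \<in> mspace \<mu>" "r \<in> K" using chain_step.hyps(2) P_sub KM by blast+
    have st: "s O t \<in> S" "(p, r) \<in> s O t" using S_comp s t by auto
    have "\<exists>x'. (x, x') \<in> (c O hol q r) \<inter> (s O t) \<and> mdist \<mu> r x' < \<eta>" if x: "x \<in> mball_of \<mu> p \<delta>" for x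
    proof -
      obtain u where u: "(x, u) \<in> c" "(x, u) \<in> s" "mdist \<mu> q u < \<eta>" using s(3) x by blast
      have "u \<in> mspace \<mu>" using u(2) S_sub[OF s(1)] by blast
      then have "u \<in> mball_of \<mu> q \<eta>'" using u(3) qr \<eta>(2) by simp
      then obtain v where v: "(u, v) \<in> hol q r" "(u, v) \<in> t" "mdist \<mu> r v < \<epsilon>'" using t(3) by blast
      have "(x, v) \<in> s O t" using u v by blast
      moreover have "mdist \<mu> p x < \<delta>'" using x \<delta>(2) by simp
      moreover have "mdist \<mu> r v < \<rho>" using v(3) \<epsilon>'(3) by simp
      ultimately have "mdist \<mu> r v < \<eta>" using \<delta>'(2)[OF st(1,2)] chain_step.prems qr(2) by blast
      then show ?thesis using u v by blast
    qed
    then show ?case using st by blast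
  qed
  then show ?thesis using that[OF \<delta>(1)] \<eta>(3) by (meson order_less_le_trans)
qed

text \<open>\<open>A\<close> stands for plaques of a leaf near the limit plaque \<open>z\<close>,
  and \<open>Y\<close> for the trace of the leaf closure. The base point \<open>w\<close> is itself
  chosen near \<open>z\<close>: forward images near \<open>zs n\<close> and backward images near
  \<open>w\<close> then all lie in the ball about \<open>z\<close>, hence in the compact
  \<open>K\<close>.\<close>

theorem chain_limit:
  assumes z: "z \<in> mspace \<mu>" and r: "0 < r" "mball_of \<mu> z r \<subseteq> K"
    and A: "A \<subseteq> K" "\<And>p q. p \<in> A \<Longrightarrow> q \<in> A \<Longrightarrow> (p, q) \<in> P\<^sup>*" "\<And>\<epsilon>. 0 < \<epsilon> \<Longrightarrow> \<exists>p\<in>A. mdist \<mu> p z < \<epsilon>"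
    and Y: "closedin (mtopology_of \<mu>) Y" "\<And>p q x x'. (p, q) \<in> P \<Longrightarrow> (x, x') \<in> hol p q \<Longrightarrow> x \<in> Y \<longleftrightarrow> x' \<in> Y"
  shows "\<exists>w\<in>A. \<exists>g. local_homeomorphism (mtopology_of \<mu>) g \<and> (w, z) \<in> g \<and> (\<forall>(x, x')\<in>g. x \<in> Y \<longleftrightarrow> x' \<in> Y)"
proof -
  \<comment> \<open>\<open>r/2\<close> keeps images in the ball of radius \<open>r\<close> about
    \<open>z\<close>; \<open>\<rho>/2\<close> keeps two images within \<open>\<rho>\<close> of each
    other, as \<open>equi\<close> presupposes.\<close>
  define \<epsilon>0 where "\<epsilon>0 = min (r/2) (\<rho>/2)"
  have \<epsilon>0: "0 < \<epsilon>0" "\<epsilon>0 \<le> r/2" "\<epsilon>0 \<le> \<rho>/2" using r \<rho> by (auto simp: \<epsilon>0_def)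
  obtain \<delta>' where \<delta>': "0 < \<delta>'"
    "\<And>p q c. chain P hol p q c \<Longrightarrow> p \<in> K \<Longrightarrow>
       \<exists>s\<in>S. (p, q) \<in> s \<and> (\<forall>x\<in>mball_of \<mu> p \<delta>'. \<exists>x'. (x, x') \<in> c \<inter> s \<and> mdist \<mu> q x' < \<epsilon>0)"
    using chain_uniform_domain[OF \<epsilon>0(1)] by metis
  define \<delta> where "\<delta> = min \<delta>' (r/2)"
  have \<delta>: "0 < \<delta>" "\<delta> \<le> r/2" "\<delta> \<le> \<delta>'" using \<delta>'(1) r by (auto simp: \<delta>_def)
  have dom: "\<exists>s\<in>S. \<forall>x\<in>mball_of \<mu> p \<delta>. \<exists>x'. (x, x') \<in> c \<inter> s \<and> mdist \<mu> q x' < \<epsilon>0"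
    if "chain P hol p q c" "p \<in> K" for p q c
    using \<delta>'(2)[OF that] \<delta>(3) by fastforce
  \<comment> \<open>The term \<open>\<delta>/2\<close> puts the ball of that radius about
    \<open>z\<close> inside every ball of radius \<open>\<delta>\<close> about \<open>zs n\<close>,
    giving all inverses a common domain; the other term makes \<open>zs n\<close> converge to
    \<open>z\<close>.\<close>
  have "\<exists>p\<in>A. mdist \<mu> p z < min (\<delta>/2) (inverse (real (Suc n)))" for n
    by (rule A(3)) (use \<delta>(1) in simp)
  then obtain zs where zs: "\<And>n. zs n \<in> A" "\<And>n. mdist \<mu> (zs n) z < min (\<delta>/2) (inverse (real (Suc n)))"
    by metis
  define w where "w = zs 0"
  have wz: "w \<in> A" "mdist \<mu> w z < \<delta>/2" using zs[of 0] by (auto simp: w_def)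
  have zsM: "zs n \<in> mspace \<mu>" "zs n \<in> K" for n using zs(1) A(1) KM by blast+
  have wM: "w \<in> mspace \<mu>" "w \<in> K" using zsM by (auto simp: w_def)
  have "\<exists>c. chain P hol w (zs n) c" for n by (rule rtrancl_chain[OF A(2)[OF wz(1) zs(1)]])
  then obtain c where c: "\<And>n. chain P hol w (zs n) (c n)" by metis
  have near: "x \<in> K" if "x \<in> mspace \<mu>" "q \<in> mspace \<mu>" "mdist \<mu> q x < r/2" "mdist \<mu> q z < \<delta>/2" for x q
  proof -
    have "mdist \<mu> z x < r" using mdist_triangle[OF z that(2,1)] that(3,4) \<delta>(2) r(1) mdist_commute[of \<mu> z q] by linarith
    then show ?thesis using r(2) z that(1) by auto
  qed
  obtain s where s: "\<And>n. s n \<in> S"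
    "\<And>n x. x \<in> mball_of \<mu> w \<delta> \<Longrightarrow> \<exists>x'. (x, x') \<in> c n \<inter> s n \<and> mdist \<mu> (zs n) x' < \<epsilon>0"
    using dom[OF c wM(2)] by metis
  obtain t where t: "\<And>n. t n \<in> S"
    "\<And>n v. v \<in> mball_of \<mu> (zs n) \<delta> \<Longrightarrow> \<exists>x. (v, x) \<in> (c n)\<inverse> \<inter> t n \<and> mdist \<mu> w x < \<epsilon>0"
    using dom[OF chain_converse[OF c] zsM(2)] by metis
  have sv: "single_valued (c n)" "single_valued ((c n)\<inverse>)" for n
    using chain_single_valued c chain_converse by blast+
  \<comment> \<open>Single-valuedness of the chain identifies any image \<open>x'\<close> with the
    controlled one, so every pair of \<open>c n\<close> over the ball also belongs to
    \<open>s n\<close>.\<close>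
  have fwd: "(x, x') \<in> s n \<and> mdist \<mu> (zs n) x' < \<epsilon>0 \<and> x' \<in> K"
    if x: "x \<in> mball_of \<mu> w \<delta>" "(x, x') \<in> c n" for x x' n
  proof -
    obtain u where u: "(x, u) \<in> c n" "(x, u) \<in> s n" "mdist \<mu> (zs n) u < \<epsilon>0" using s(2)[OF x(1)] by blast
    have "u = x'" using u(1) x(2) sv(1) unfolding single_valued_def by blast
    moreover have "u \<in> mspace \<mu>" using S_sub[OF s(1)] u(2) by blast
    moreover have "mdist \<mu> (zs n) u < r/2" using u(3) \<epsilon>0(2) by linarith
    ultimately show ?thesis using near[of u "zs n"] zsM zs(2)[of n] u by auto
  qed
  have bwd: "(v, x) \<in> t n \<and> mdist \<mu> w x < \<epsilon>0 \<and> x \<in> K"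
    if x: "v \<in> mball_of \<mu> (zs n) \<delta>" "(x, v) \<in> c n" for x v n
  proof -
    obtain u where u: "(u, v) \<in> c n" "(v, u) \<in> t n" "mdist \<mu> w u < \<epsilon>0" using t(2)[OF x(1)] by blast
    have "u = x" using u(1) x(2) sv(2)[of n] unfolding single_valued_def by blast
    moreover have "u \<in> mspace \<mu>" using S_sub[OF t(1)] u(2) by blast
    moreover have "mdist \<mu> w u < r/2" using u(3) \<epsilon>0(2) by linarith
    ultimately show ?thesis using near[of u w] wM wz(2) u by auto
  qed
  have E: "v \<in> mball_of \<mu> (zs n) \<delta>" if "v \<in> mball_of \<mu> z (\<delta>/2)" for v n
    using that mdist_triangle[of "zs n" \<mu> z v] zsM zs(2)[of n] by auto
  have pair: "mdist \<mu> a b < \<rho>" if "a \<in> mspace \<mu>" "b \<in> mspace \<mu>" "q \<in> mspace \<mu>" "mdist \<mu> q a < \<epsilon>0" "mdist \<mu> q b < \<epsilon>0" for a b q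
    using mdist_triangle[OF that(1,3,2)] that(4,5) \<epsilon>0(3) mdist_commute[of \<mu> q a] by linarith
  have "\<exists>g. local_homeomorphism (mtopology_of \<mu>) g \<and> (w, z) \<in> g \<and>
     (\<forall>x x' \<epsilon>. (x, x') \<in> g \<and> \<epsilon> > 0 \<longrightarrow>
        (\<exists>n y'. (x, y') \<in> c n \<and> y' \<in> mspace \<mu> \<and> mdist \<mu> x' y' < \<epsilon>) \<and>
        (\<exists>n y. (y, x') \<in> c n \<and> y \<in> mspace \<mu> \<and> mdist \<mu> x y < \<epsilon>))"
  proof (rule limit_local_homeomorphism[OF K openin_mball_of openin_mball_of])
    show "\<exists>x'\<in>K. (x, x') \<in> c n" if "x \<in> mball_of \<mu> w \<delta>" for n x
      using s(2)[OF that, of n] fwd[OF that, of _ n] by blast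
    show "\<exists>x\<in>K. (x, v) \<in> c n" if "v \<in> mball_of \<mu> z (\<delta>/2)" for n v
      using t(2)[OF E[OF that, of n]] bwd[OF E[OF that, of n]] by blast
    show "w \<in> mball_of \<mu> w \<delta>" using wM \<delta>(1) by simp
    show "z \<in> mball_of \<mu> z (\<delta>/2)" using z \<delta>(1) by simp
    show "zs n \<in> mspace \<mu>" for n by (rule zsM)
    show "(w, zs n) \<in> c n" for n by (rule chain_mem[OF c])
    show "\<exists>N. \<forall>n\<ge>N. mdist \<mu> (zs n) z < \<epsilon>" if \<epsilon>: "0 < \<epsilon>" for \<epsilon>
    proof -
      obtain N where N: "inverse (real (Suc N)) < \<epsilon>" using reals_Archimedean[OF \<epsilon>] by blast
      have "mdist \<mu> (zs n) z < \<epsilon>" if "n \<ge> N" for n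
      proof -
        have "inverse (real (Suc n)) \<le> inverse (real (Suc N))" using that by (simp add: le_imp_inverse_le)
        then show ?thesis using zs(2)[of n] N by linarith
      qed
      then show ?thesis by blast
    qed
    show "\<exists>\<delta>'>0. \<forall>n x' y y'. (x, x') \<in> c n \<and> (y, y') \<in> c n \<and> y \<in> mspace \<mu> \<and> mdist \<mu> x y < \<delta>' \<longrightarrow> mdist \<mu> x' y' < \<epsilon>"
      if x: "x \<in> mball_of \<mu> w \<delta>" and \<epsilon>: "0 < \<epsilon>" for x \<epsilon>
    proof -
      obtain d where d: "0 < d" "\<And>s x y x' y'. s \<in> S \<Longrightarrow> (x, x') \<in> s \<Longrightarrow> (y, y') \<in> s \<Longrightarrow> x \<in> K \<Longrightarrow> x' \<in> K \<Longrightarrow>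
        mdist \<mu> x y < d \<Longrightarrow> mdist \<mu> x' y' < \<rho> \<Longrightarrow> mdist \<mu> x' y' < \<epsilon>"
        using equi[OF \<epsilon>] by meson
      have xK: "x \<in> K" using x near[of x w] wM wz(2) \<delta>(2) by auto
      \<comment> \<open>The second term of the minimum keeps \<open>y\<close> in the ball on which
        \<open>s n\<close> controls the chain.\<close>
      have "mdist \<mu> x' y' < \<epsilon>" if h: "(x, x') \<in> c n" "(y, y') \<in> c n" "y \<in> mspace \<mu>"
        "mdist \<mu> x y < min d (\<delta> - mdist \<mu> w x)" for n x' y y'
      proof -
        have y: "y \<in> mball_of \<mu> w \<delta>" using h(3,4) x mdist_triangle[of w \<mu> x y] by auto
        have 1: "(x, x') \<in> s n" "mdist \<mu> (zs n) x' < \<epsilon>0" "x' \<in> K" using fwd[OF x h(1)] by auto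
        have 2: "(y, y') \<in> s n" "mdist \<mu> (zs n) y' < \<epsilon>0" "y' \<in> K" using fwd[OF y h(2)] by auto
        have "mdist \<mu> x' y' < \<rho>" using pair[OF _ _ zsM(1) 1(2) 2(2)] 1(3) 2(3) KM by blast
        then show ?thesis using d(2)[OF s(1) 1(1) 2(1) xK 1(3)] h(4) by simp
      qed
      moreover have "0 < min d (\<delta> - mdist \<mu> w x)" using d(1) x by simp
      ultimately show ?thesis by blast
    qed
    show "\<exists>\<delta>'>0. \<forall>n x y y'. (x, v) \<in> c n \<and> (y, y') \<in> c n \<and> y' \<in> mspace \<mu> \<and> mdist \<mu> v y' < \<delta>' \<longrightarrow> mdist \<mu> x y < \<epsilon>"
      if v: "v \<in> mball_of \<mu> z (\<delta>/2)" and \<epsilon>: "0 < \<epsilon>" for v \<epsilon>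
    proof -
      obtain d where d: "0 < d" "\<And>s x y x' y'. s \<in> S \<Longrightarrow> (x, x') \<in> s \<Longrightarrow> (y, y') \<in> s \<Longrightarrow> x \<in> K \<Longrightarrow> x' \<in> K \<Longrightarrow>
        mdist \<mu> x y < d \<Longrightarrow> mdist \<mu> x' y' < \<rho> \<Longrightarrow> mdist \<mu> x' y' < \<epsilon>"
        using equi[OF \<epsilon>] by meson
      have vK: "v \<in> K" using v r(2) \<delta>(1,2) by (auto simp: subset_eq)
      have "mdist \<mu> x y < \<epsilon>" if h: "(x, v) \<in> c n" "(y, y') \<in> c n" "y' \<in> mspace \<mu>"
        "mdist \<mu> v y' < min d (\<delta>/2 - mdist \<mu> z v)" for n x y y'
      proof -
        have y: "y' \<in> mball_of \<mu> z (\<delta>/2)" using h(3,4) v mdist_triangle[of z \<mu> v y'] by auto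
        have 1: "(v, x) \<in> t n" "mdist \<mu> w x < \<epsilon>0" "x \<in> K" using bwd[OF E[OF v] h(1)] by auto
        have 2: "(y', y) \<in> t n" "mdist \<mu> w y < \<epsilon>0" "y \<in> K" using bwd[OF E[OF y] h(2)] by auto
        have "mdist \<mu> x y < \<rho>" using pair[OF _ _ wM(1) 1(2) 2(2)] 1(3) 2(3) KM by blast
        then show ?thesis using d(2)[OF t(1) 1(1) 2(1) vK 1(3)] h(4) by simp
      qed
      moreover have "0 < min d (\<delta>/2 - mdist \<mu> z v)" using d(1) v by simp
      ultimately show ?thesis by blast
    qed
  qed
  then obtain g where g: "local_homeomorphism (mtopology_of \<mu>) g" "(w, z) \<in> g"
    "\<And>x x' \<epsilon>. (x, x') \<in> g \<Longrightarrow> \<epsilon> > 0 \<Longrightarrow>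
        (\<exists>n y'. (x, y') \<in> c n \<and> y' \<in> mspace \<mu> \<and> mdist \<mu> x' y' < \<epsilon>)"
    "\<And>x x' \<epsilon>. (x, x') \<in> g \<Longrightarrow> \<epsilon> > 0 \<Longrightarrow>
        (\<exists>n y. (y, x') \<in> c n \<and> y \<in> mspace \<mu> \<and> mdist \<mu> x y < \<epsilon>)" by blast
  have inv: "x \<in> Y \<longleftrightarrow> x' \<in> Y" if "chain P hol p q c" "(x, x') \<in> c" for p q c x x'
    using that
  proof (induction arbitrary: x' rule: chain.induct)
    case (chain_step p q c r)
    then show ?case using Y(2) by blast
  qed simp
  have clos: "x \<in> Y" if "x \<in> mspace \<mu>" "\<And>\<epsilon>. \<epsilon> > 0 \<Longrightarrow> \<exists>y\<in>Y. mdist \<mu> x y < \<epsilon>" for x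
  proof (rule ccontr)
    assume "x \<notin> Y"
    then have "x \<in> mspace \<mu> - Y" using that(1) by blast
    moreover have "openin (mtopology_of \<mu>) (mspace \<mu> - Y)" using Y(1) by (simp add: closedin_def)
    ultimately obtain \<epsilon> where "\<epsilon> > 0" "\<forall>y\<in>mspace \<mu>. mdist \<mu> x y < \<epsilon> \<longrightarrow> y \<in> mspace \<mu> - Y"
      unfolding openin_mtopology_of by blast
    moreover have "Y \<subseteq> mspace \<mu>" using Y(1) closedin_subset by fastforce
    ultimately show False using that(2)[of \<epsilon>] by blast
  qed
  \<comment> \<open>If \<open>x\<close> lies in \<open>Y\<close>, so do its images under the chains,
    and these come arbitrarily close to \<open>x'\<close>; the converse uses preimages of
    \<open>x'\<close> close to \<open>x\<close>.\<close>
  have "x \<in> Y \<longleftrightarrow> x' \<in> Y" if xg: "(x, x') \<in> g" for x x'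
  proof -
    have "x \<in> mspace \<mu>" "x' \<in> mspace \<mu>" using g(1) xg unfolding local_homeomorphism_iff by auto
    then show ?thesis using clos[of x] clos[of x'] g(3)[OF xg] g(4)[OF xg] inv[OF c] by meson
  qed
  then show ?thesis using g(1,2) wz(1) by blast
qed

end

section \<open>Flow boxes and leaves\<close>

locale foliation =
  fixes k :: enat and X :: "'x topology" and F :: "('x, 'n::finite, 'i, 'z) flow_box_cover"
  assumes fol: "foliated_space k X F"
begin

section \<open>Charts, projections to the total transversal, and holonomy maps\<close>

definition proj :: "'i \<Rightarrow> 'x \<Rightarrow> 'i \<times> 'z" where
  "proj i u = (i, snd (chart F i u))"

lemma fst_proj [simp]: "fst (proj i u) = i"
  by (simp add: proj_def)

lemma flow_box_open: "i \<in> indices F \<Longrightarrow> openin X (flow_box F i)"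
  using fol unfolding foliated_space_def by blast

lemma flow_box_subset: "i \<in> indices F \<Longrightarrow> flow_box F i \<subseteq> topspace X"
  using flow_box_open openin_subset by blast

lemma flow_box_cover: "u \<in> topspace X \<Longrightarrow> \<exists>i\<in>indices F. u \<in> flow_box F i"
  using fol unfolding foliated_space_def by blast

lemma chart_homeo:
  "i \<in> indices F \<Longrightarrow> homeomorphic_map (subtopology X (flow_box F i))
     (prod_topology (top_of_set (leaf_ball F i)) (transversal F i)) (chart F i)"
  using fol unfolding foliated_space_def by blast

lemma topspace_flow_box: "i \<in> indices F \<Longrightarrow> topspace (subtopology X (flow_box F i)) = flow_box F i"
  using flow_box_subset by (simp add: inf_absorb2)

lemma chart_image: "i \<in> indices F \<Longrightarrow> chart F i ` flow_box F i = leaf_ball F i \<times> topspace (transversal F i)"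
  using homeomorphic_imp_surjective_map[OF chart_homeo] topspace_flow_box by fastforce

lemma chart_inj: "i \<in> indices F \<Longrightarrow> inj_on (chart F i) (flow_box F i)"
  using homeomorphic_imp_injective_map[OF chart_homeo] topspace_flow_box by fastforce

lemma chart_mem:
  assumes "i \<in> indices F" "u \<in> flow_box F i"
  shows "fst (chart F i u) \<in> leaf_ball F i" "snd (chart F i u) \<in> topspace (transversal F i)"
  using chart_image[OF assms(1)] assms(2) by (metis imageI mem_Times_iff)+

lemma leaf_ball: "i \<in> indices F \<Longrightarrow> open (leaf_ball F i) \<and> connected (leaf_ball F i)"
  using fol unfolding foliated_space_def by (metis connected_ball open_ball)

lemma chart_open:
  assumes "i \<in> indices F" "openin X W"
  shows "openin (prod_topology (top_of_set (leaf_ball F i)) (transversal F i)) (chart F i ` (W \<inter> flow_box F i))"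
proof -
  have "openin (subtopology X (flow_box F i)) (W \<inter> flow_box F i)"
    using assms(2) by (rule openin_subtopology_Int)
  then show ?thesis
    using homeomorphic_imp_open_map[OF chart_homeo[OF assms(1)]] unfolding open_map_def by blast
qed

lemma chart_vimage_open:
  assumes i: "i \<in> indices F"
    and R: "openin (prod_topology (top_of_set (leaf_ball F i)) (transversal F i)) R"
  shows "openin X {u \<in> flow_box F i. chart F i u \<in> R}"
proof -
  have "openin (subtopology X (flow_box F i)) {u \<in> topspace (subtopology X (flow_box F i)). chart F i u \<in> R}"
    using homeomorphic_imp_continuous_map[OF chart_homeo[OF i]] R by (rule openin_continuous_map_preimage)
  then show ?thesis
    unfolding topspace_flow_box[OF i] using flow_box_open[OF i] by (rule openin_trans_full)
qed

lemma proj_continuous: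
  assumes i: "i \<in> indices F"
  shows "continuous_map (subtopology X (flow_box F i)) (total_transversal F) (proj i)"
proof -
  have "continuous_map (subtopology X (flow_box F i)) (transversal F i) (snd \<circ> chart F i)"
    using homeomorphic_imp_continuous_map[OF chart_homeo[OF i]] continuous_map_snd by (rule continuous_map_compose)
  then have "continuous_map (subtopology X (flow_box F i)) (total_transversal F) (Pair i \<circ> (snd \<circ> chart F i))"
    unfolding total_transversal_def using continuous_map_component_injection[OF i] by (rule continuous_map_compose)
  moreover have "Pair i \<circ> (snd \<circ> chart F i) = proj i" by (auto simp: proj_def)
  ultimately show ?thesis by simp
qed

lemma proj_vimage_open:
  assumes i: "i \<in> indices F" and V: "openin (total_transversal F) V"
  shows "openin X {u \<in> flow_box F i. proj i u \<in> V}"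
proof -
  have "openin (subtopology X (flow_box F i)) {u \<in> topspace (subtopology X (flow_box F i)). proj i u \<in> V}"
    using proj_continuous[OF i] V by (rule openin_continuous_map_preimage)
  then show ?thesis
    unfolding topspace_flow_box[OF i] using flow_box_open[OF i] by (rule openin_trans_full)
qed

lemma proj_open:
  assumes i: "i \<in> indices F" and W: "openin X W"
  shows "openin (total_transversal F) (proj i ` (W \<inter> flow_box F i))"
proof -
  have "openin (transversal F i) (snd ` chart F i ` (W \<inter> flow_box F i))"
    using open_map_snd chart_open[OF assms] unfolding open_map_def by blast
  then have "openin (total_transversal F) (Pair i ` snd ` chart F i ` (W \<inter> flow_box F i))"
    unfolding total_transversal_def using open_map_component_injection[OF i] unfolding open_map_def by blast
  moreover have "Pair i ` snd ` chart F i ` (W \<inter> flow_box F i) = proj i ` (W \<inter> flow_box F i)"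
    by (simp add: image_image proj_def)
  ultimately show ?thesis by simp
qed

lemma proj_mem:
  assumes "i \<in> indices F" "u \<in> flow_box F i"
  shows "proj i u \<in> topspace (total_transversal F)"
  using chart_mem[OF assms] assms(1) by (simp add: proj_def total_transversal_def)

lemma proj_compact:
  assumes "i \<in> indices F" "compactin X C" "C \<subseteq> flow_box F i"
  shows "compactin (total_transversal F) (proj i ` C)"
  using image_compactin[OF _ proj_continuous[OF assms(1)]] assms by (simp add: compactin_subtopology)

text \<open>A coordinate change has one transverse part \<open>\<zeta>\<close> on the whole overlap,
  so the plaque in box \<open>j\<close> is a function of the plaque in box \<open>i\<close>.
  Well-definedness of holonomy and compatibility of plaques rest on this.\<close>

lemma proj_determined:
  assumes ij: "i \<in> indices F" "j \<in> indices F" and u: "u \<in> flow_box F i \<inter> flow_box F j"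
    and v: "v \<in> flow_box F i \<inter> flow_box F j" and eq: "proj i u = proj i v"
  shows "proj j u = proj j v"
proof -
  have "\<exists>\<zeta>. continuous_map (subtopology (transversal F i) (snd ` overlap_image F j i)) (transversal F j) \<zeta> \<and>
             (\<forall>(x, z) \<in> overlap_image F j i. snd (coordinate_change F j i (x, z)) = \<zeta> z)"
    using fol ij unfolding foliated_space_def by blast
  then obtain \<zeta> where \<zeta>: "\<And>x z. (x, z) \<in> overlap_image F j i \<Longrightarrow> snd (coordinate_change F j i (x, z)) = \<zeta> z"
    by blast
  have "snd (chart F j w) = \<zeta> (snd (chart F i w))" if w: "w \<in> flow_box F i \<inter> flow_box F j" for w
  proof -
    have "chart F i w \<in> overlap_image F j i" using w unfolding overlap_image_def by blast
    then have "snd (coordinate_change F j i (chart F i w)) = \<zeta> (snd (chart F i w))"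
      using \<zeta>[of "fst (chart F i w)" "snd (chart F i w)"] by simp
    moreover have "coordinate_change F j i (chart F i w) = chart F j w"
      unfolding coordinate_change_def using w chart_inj[OF ij(1)] by (simp add: the_inv_into_f_f)
    ultimately show ?thesis by simp
  qed
  then show ?thesis using u v eq by (simp add: proj_def)
qed

lemma holonomy_map_eq:
  "holonomy_map F i j = (\<lambda>u. (proj i u, proj j u)) ` (flow_box F i \<inter> flow_box F j)"
  by (simp add: holonomy_map_def proj_def)

lemma holonomy_map_converse: "(holonomy_map F i j)\<inverse> = holonomy_map F j i"
  unfolding holonomy_map_eq by auto

lemma holonomy_map_single_valued:
  assumes "i \<in> indices F" "j \<in> indices F"
  shows "single_valued (holonomy_map F i j)"
proof (rule single_valuedI)
  fix p q r assume "(p, q) \<in> holonomy_map F i j" "(p, r) \<in> holonomy_map F i j"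
  then obtain u v where u: "u \<in> flow_box F i \<inter> flow_box F j" "p = proj i u" "q = proj j u"
    and v: "v \<in> flow_box F i \<inter> flow_box F j" "p = proj i v" "r = proj j v"
    unfolding holonomy_map_eq by blast
  then show "q = r" using proj_determined[OF assms u(1) v(1)] by simp
qed

text \<open>\<open>V\<close> is pulled back along the continuous \<open>proj i\<close> and pushed
  down along the open \<open>proj j\<close>.\<close>

lemma holonomy_map_image_open:
  assumes ij: "i \<in> indices F" "j \<in> indices F" and V: "openin (total_transversal F) V"
  shows "openin (total_transversal F) (holonomy_map F i j `` V)"
proof -
  have "holonomy_map F i j `` V = proj j ` ({u \<in> flow_box F i. proj i u \<in> V} \<inter> flow_box F j)"
    unfolding holonomy_map_eq by auto
  then show ?thesis using proj_open[OF ij(2) proj_vimage_open[OF ij(1) V]] by simp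
qed

lemma holonomy_map_local_homeomorphism:
  assumes ij: "i \<in> indices F" "j \<in> indices F"
  shows "local_homeomorphism (total_transversal F) (holonomy_map F i j)"
proof -
  have "holonomy_map F i j \<subseteq> topspace (total_transversal F) \<times> topspace (total_transversal F)"
    unfolding holonomy_map_eq using proj_mem ij by auto
  then show ?thesis
    unfolding local_homeomorphism_iff holonomy_map_converse
    using holonomy_map_single_valued ij holonomy_map_image_open by simp
qed

section \<open>Plaques, the leaf topology and leaves\<close>

definition plaque :: "'i \<Rightarrow> 'x \<Rightarrow> 'x set" where
  "plaque i u = {v \<in> flow_box F i. proj i v = proj i u}"

lemma plaque_in_plaques:
  assumes "i \<in> indices F" "u \<in> flow_box F i"
  shows "plaque i u \<in> plaques F"
proof -
  have "plaque i u = {v \<in> flow_box F i. snd (chart F i v) = snd (chart F i u)}"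
    by (simp add: plaque_def proj_def)
  then show ?thesis unfolding plaques_def using assms chart_mem by blast
qed

lemma plaques_cases:
  assumes "P \<in> plaques F" "u \<in> P"
  obtains i where "i \<in> indices F" "u \<in> flow_box F i" "P = plaque i u"
proof -
  obtain i z where i: "i \<in> indices F" "P = {v \<in> flow_box F i. snd (chart F i v) = z}"
    using assms(1) unfolding plaques_def by blast
  then have "u \<in> flow_box F i" "snd (chart F i u) = z" using assms(2) by auto
  moreover have "P = plaque i u" unfolding i(2) plaque_def proj_def using calculation by auto
  ultimately show ?thesis using that i(1) by blast
qed

abbreviation plaque_open :: "'x set \<Rightarrow> bool" where
  "plaque_open W \<equiv> \<exists>P\<in>plaques F. openin (subtopology X P) W"

lemma plaque_Int_open:
  assumes i: "i \<in> indices F" "u \<in> flow_box F i" and W: "openin X W"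
  shows "plaque_open (W \<inter> plaque i u)"
  using plaque_in_plaques[OF i] openin_subtopology_Int[OF W] by blast

text \<open>The condition for a base. The part of a plaque of box \<open>i\<close> inside box
  \<open>j\<close> lies in one plaque of box \<open>j\<close> as soon as it meets it, so the
  intersection of two plaques is open in either.\<close>

lemma plaque_open_Int:
  assumes "plaque_open V" "plaque_open W"
  shows "plaque_open (V \<inter> W)"
proof (cases "V \<inter> W = {}")
  case True
  then show ?thesis using assms(1) by (metis openin_empty)
next
  case False
  then obtain u where u: "u \<in> V" "u \<in> W" by blast
  obtain P A where P: "P \<in> plaques F" "openin X A" "V = A \<inter> P"
    using assms(1) unfolding openin_subtopology by blast
  obtain Q B where Q: "Q \<in> plaques F" "openin X B" "W = B \<inter> Q"
    using assms(2) unfolding openin_subtopology by blast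
  obtain i where i: "i \<in> indices F" "u \<in> flow_box F i" "P = plaque i u"
    using plaques_cases[OF P(1)] u P(3) by blast
  obtain j where j: "j \<in> indices F" "u \<in> flow_box F j" "Q = plaque j u"
    using plaques_cases[OF Q(1)] u Q(3) by blast
  have "V \<inter> W = (A \<inter> B \<inter> flow_box F j) \<inter> plaque i u"
  proof -
    have "v \<in> plaque j u" if "v \<in> flow_box F j" "v \<in> plaque i u" for v
      using proj_determined[OF i(1) j(1), of v u] that i(2) j(2) by (simp add: plaque_def)
    moreover have "plaque j u \<subseteq> flow_box F j" by (auto simp: plaque_def)
    ultimately show ?thesis unfolding P(3) Q(3) i(3) j(3) by blast
  qed
  moreover have "openin X (A \<inter> B \<inter> flow_box F j)"
    using P(2) Q(2) flow_box_open[OF j(1)] by blast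
  ultimately show ?thesis using plaque_Int_open[OF i(1,2)] by simp
qed

text \<open>\<open>topology\<close> is faithful only on predicates satisfying
  \<open>istopology\<close>; closure of the base under intersection supplies this.\<close>

lemma openin_leaf_topology: "openin (leaf_topology X F) = arbitrary union_of plaque_open"
proof -
  have "istopology (arbitrary union_of plaque_open)"
    using plaque_open_Int by (rule istopology_base)
  then show ?thesis unfolding leaf_topology_def by (rule topology_inverse')
qed

lemma openin_leaf_topologyI:
  assumes "\<And>u. u \<in> A \<Longrightarrow> \<exists>W. plaque_open W \<and> u \<in> W \<and> W \<subseteq> A"
  shows "openin (leaf_topology X F) A"
proof -
  have "openin (leaf_topology X F) W" if "plaque_open W" for W
    unfolding openin_leaf_topology using that by (rule arbitrary_union_of_inc)
  then have "\<forall>u\<in>A. \<exists>W. openin (leaf_topology X F) W \<and> u \<in> W \<and> W \<subseteq> A"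
    using assms by meson
  then show ?thesis by (rule openin_subopen[THEN iffD2])
qed

text \<open>On a single plaque the leaf topology is no finer than that of \<open>X\<close>, which
  lets connectedness of plaques be transferred from \<open>X\<close>.\<close>

lemma openin_leaf_topology_plaque:
  assumes V: "openin (leaf_topology X F) V" and P: "P \<in> plaques F"
  shows "openin (subtopology X P) (V \<inter> P)"
proof -
  obtain \<U> where \<U>: "\<And>W. W \<in> \<U> \<Longrightarrow> plaque_open W" "V = \<Union>\<U>"
    using V unfolding openin_leaf_topology union_of_def arbitrary_def by (auto simp: subset_eq)
  have "openin (subtopology X P) (W \<inter> P)" if W: "W \<in> \<U>" for W
  proof (cases "W \<inter> P = {}")
    case False
    then obtain u where u: "u \<in> W" "u \<in> P" by blast
    obtain Q B where Q: "Q \<in> plaques F" "openin X B" "W = B \<inter> Q"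
      using \<U>(1)[OF W] unfolding openin_subtopology by blast
    obtain i where i: "i \<in> indices F" "u \<in> flow_box F i" "P = plaque i u"
      using plaques_cases[OF P] u by blast
    obtain j where j: "j \<in> indices F" "u \<in> flow_box F j" "Q = plaque j u"
      using plaques_cases[OF Q(1)] u Q(3) by blast
    have "W \<inter> P = (B \<inter> flow_box F j) \<inter> P"
    proof -
      have "v \<in> plaque j u" if "v \<in> flow_box F j" "v \<in> plaque i u" for v
        using proj_determined[OF i(1) j(1), of v u] that i(2) j(2) by (simp add: plaque_def)
      moreover have "plaque j u \<subseteq> flow_box F j" by (auto simp: plaque_def)
      ultimately show ?thesis unfolding Q(3) i(3) j(3) by blast
    qed
    then show ?thesis using openin_subtopology_Int Q(2) flow_box_open[OF j(1)] openin_Int by metis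
  qed simp
  moreover have "V \<inter> P = (\<Union>W\<in>\<U>. W \<inter> P)" using \<U>(2) by blast
  ultimately show ?thesis by (metis (no_types, lifting) imageE openin_Union)
qed

lemma plaque_connected:
  assumes i: "i \<in> indices F" "u \<in> flow_box F i"
  shows "connectedin X (plaque i u)"
proof -
  let ?Y = "prod_topology (top_of_set (leaf_ball F i)) (transversal F i)"
  obtain \<psi> where \<psi>: "homeomorphic_maps (subtopology X (flow_box F i)) ?Y (chart F i) \<psi>"
    using chart_homeo[OF i(1)] homeomorphic_map_maps by blast
  let ?z = "snd (chart F i u)"
  have "connectedin ?Y (leaf_ball F i \<times> {?z})"
    unfolding connectedin_Times using leaf_ball[OF i(1)] chart_mem[OF i]
    by (simp add: connectedin_subtopology connectedin_sing)
  moreover have "continuous_map ?Y (subtopology X (flow_box F i)) \<psi>"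
    using \<psi> unfolding homeomorphic_maps_def by blast
  ultimately have "connectedin (subtopology X (flow_box F i)) (\<psi> ` (leaf_ball F i \<times> {?z}))"
    using connectedin_continuous_map_image by blast
  moreover have "\<psi> ` (leaf_ball F i \<times> {?z}) = plaque i u"
  proof
    show "\<psi> ` (leaf_ball F i \<times> {?z}) \<subseteq> plaque i u"
    proof
      fix v assume "v \<in> \<psi> ` (leaf_ball F i \<times> {?z})"
      then obtain b where b: "b \<in> leaf_ball F i" "v = \<psi> (b, ?z)" by blast
      have "(b, ?z) \<in> leaf_ball F i \<times> topspace (transversal F i)" using b chart_mem[OF i] by simp
      then obtain w where w: "w \<in> flow_box F i" "chart F i w = (b, ?z)"
        using chart_image[OF i(1)] by (metis imageE)
      have "\<psi> (chart F i w) = w"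
        using \<psi> w(1) topspace_flow_box[OF i(1)] unfolding homeomorphic_maps_def by blast
      then show "v \<in> plaque i u" using b w by (simp add: plaque_def proj_def)
    qed
    show "plaque i u \<subseteq> \<psi> ` (leaf_ball F i \<times> {?z})"
    proof
      fix v assume v: "v \<in> plaque i u"
      then have v': "v \<in> flow_box F i" "snd (chart F i v) = ?z" by (auto simp: plaque_def proj_def)
      have "\<psi> (chart F i v) = v"
        using \<psi> v'(1) topspace_flow_box[OF i(1)] unfolding homeomorphic_maps_def by blast
      moreover have "chart F i v \<in> leaf_ball F i \<times> {?z}"
        using chart_mem[OF i(1) v'(1)] v'(2) by (simp add: mem_Times_iff)
      ultimately show "v \<in> \<psi> ` (leaf_ball F i \<times> {?z})" by (metis imageI)
    qed
  qed
  ultimately show ?thesis by (simp add: connectedin_subtopology)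
qed

lemma plaque_leaf_connected:
  assumes i: "i \<in> indices F" "u \<in> flow_box F i"
  shows "connectedin (leaf_topology X F) (plaque i u)"
proof -
  let ?P = "plaque i u"
  have P: "?P \<in> plaques F" by (rule plaque_in_plaques[OF i])
  have PX: "?P \<subseteq> topspace X" using flow_box_subset[OF i(1)] by (auto simp: plaque_def)
  have "openin (leaf_topology X F) ?P"
  proof (rule openin_leaf_topologyI)
    have "topspace X \<inter> ?P = ?P" using PX by blast
    then have "plaque_open ?P" using plaque_Int_open[OF i openin_topspace] by simp
    then show "\<exists>W. plaque_open W \<and> v \<in> W \<and> W \<subseteq> ?P" if "v \<in> ?P" for v
      using that by blast
  qed
  then have "?P \<subseteq> topspace (leaf_topology X F)" by (rule openin_subset)
  moreover have False if E: "openin (leaf_topology X F) E1" "openin (leaf_topology X F) E2"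
    "?P \<subseteq> E1 \<union> E2" "E1 \<inter> E2 \<inter> ?P = {}" "E1 \<inter> ?P \<noteq> {}" "E2 \<inter> ?P \<noteq> {}" for E1 E2
  proof -
    obtain A where A: "openin X A" "E1 \<inter> ?P = A \<inter> ?P"
      using openin_leaf_topology_plaque[OF E(1) P] unfolding openin_subtopology by blast
    obtain B where B: "openin X B" "E2 \<inter> ?P = B \<inter> ?P"
      using openin_leaf_topology_plaque[OF E(2) P] unfolding openin_subtopology by blast
    have "?P \<subseteq> A \<union> B" "A \<inter> B \<inter> ?P = {}" "A \<inter> ?P \<noteq> {}" "B \<inter> ?P \<noteq> {}"
      using A(2) B(2) E(3-6) by blast+
    then show False using plaque_connected[OF i] A(1) B(1) unfolding connectedin by blast
  qed
  ultimately show ?thesis unfolding connectedin by blast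
qed

lemma plaque_subset_leaf:
  assumes L: "L \<in> leaves X F" and i: "i \<in> indices F" and u: "u \<in> flow_box F i" "u \<in> L"
    and v: "v \<in> flow_box F i" "proj i v = proj i u"
  shows "v \<in> L"
proof -
  have "u \<in> plaque i u" "v \<in> plaque i u" using u v by (auto simp: plaque_def)
  moreover have "plaque i u \<subseteq> L"
    using connected_components_of_maximal[OF _ plaque_leaf_connected[OF i u(1)]] L u(2) calculation(1)
    unfolding leaves_def disjnt_def by blast
  ultimately show ?thesis by blast
qed

lemma leaf_subset: "L \<in> leaves X F \<Longrightarrow> L \<subseteq> topspace X"
proof -
  assume L: "L \<in> leaves X F"
  have "L \<subseteq> topspace (leaf_topology X F)"
    using L unfolding leaves_def by (rule connected_components_of_subset)
  moreover have "topspace (leaf_topology X F) \<subseteq> topspace X"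
  proof
    fix u assume "u \<in> topspace (leaf_topology X F)"
    then obtain V where "openin (leaf_topology X F) V" "u \<in> V" by blast
    then obtain \<U> where "\<U> \<subseteq> Collect plaque_open" "V = \<Union>\<U>"
      unfolding openin_leaf_topology union_of_def arbitrary_def by blast
    then obtain W where "plaque_open W" "u \<in> W"
      using \<open>u \<in> V\<close> by blast
    then show "u \<in> topspace X" unfolding openin_subtopology using openin_subset by fastforce
  qed
  ultimately show ?thesis by blast
qed

text \<open>The sets where \<open>Q\<close> holds and where it fails are both open in the leaf
  topology, and a leaf is connected there. It serves both to spread homogeneity along a leaf and to
  join its points by chains.\<close>

lemma leaf_locally_constant:
  assumes L: "L \<in> leaves X F" and uv: "u \<in> L" "v \<in> L"
    and Q: "\<And>x. x \<in> topspace X \<Longrightarrow> \<exists>i\<in>indices F. \<exists>W. x \<in> flow_box F i \<and> openin X W \<and> x \<in> W \<and>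
       (\<forall>y\<in>W \<inter> plaque i x. Q y \<longleftrightarrow> Q x)"
  shows "Q u \<longleftrightarrow> Q v"
proof -
  have op: "openin (leaf_topology X F) {x \<in> topspace X. Q x = b}" for b
  proof (rule openin_leaf_topologyI)
    fix x assume x: "x \<in> {x \<in> topspace X. Q x = b}"
    then obtain i W where i: "i \<in> indices F" "x \<in> flow_box F i" "openin X W" "x \<in> W"
      "\<forall>y\<in>W \<inter> plaque i x. Q y \<longleftrightarrow> Q x" using Q[of x] by blast
    have "W \<inter> plaque i x \<subseteq> {x \<in> topspace X. Q x = b}"
      using i(5) x openin_subset[OF i(3)] by blast
    moreover have "x \<in> W \<inter> plaque i x" using i(2,4) by (simp add: plaque_def)
    ultimately show "\<exists>W. plaque_open W \<and> x \<in> W \<and> W \<subseteq> {x \<in> topspace X. Q x = b}"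
      using plaque_Int_open[OF i(1,2,3)] by blast
  qed
  have con: "connectedin (leaf_topology X F) L"
    using L unfolding leaves_def by (rule connectedin_connected_components_of)
  have LX: "L \<subseteq> topspace X" using L by (rule leaf_subset)
  have "L \<subseteq> {x \<in> topspace X. Q x = True} \<union> {x \<in> topspace X. Q x = False}" using LX by auto
  moreover have "{x \<in> topspace X. Q x = True} \<inter> {x \<in> topspace X. Q x = False} \<inter> L = {}" by auto
  ultimately have "{x \<in> topspace X. Q x = True} \<inter> L = {} \<or> {x \<in> topspace X. Q x = False} \<inter> L = {}"
    using con op[of True] op[of False] unfolding connectedin by meson
  then show ?thesis using uv LX by blast
qed

text \<open>The plaques of the box that meet a neighbourhood \<open>W\<close> of \<open>v\<close>
  form an open set around \<open>u\<close>, so \<open>L\<close> meets it. A leaf contains the whole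
  plaque of each of its points, and sliding along that plaque leads into \<open>W\<close>.\<close>

lemma closure_leaf_saturated:
  assumes L: "L \<in> leaves X F" and i: "i \<in> indices F" and u: "u \<in> flow_box F i" "u \<in> X closure_of L"
    and v: "v \<in> flow_box F i" "proj i v = proj i u"
  shows "v \<in> X closure_of L"
  unfolding in_closure_of
proof (intro conjI allI impI)
  show "v \<in> topspace X" using v flow_box_subset[OF i] by blast
  fix W assume W: "v \<in> W \<and> openin X W"
  define A where "A = {x \<in> flow_box F i. proj i x \<in> proj i ` (W \<inter> flow_box F i)}"
  have "openin X A" unfolding A_def using W by (intro proj_vimage_open proj_open i) simp
  moreover have "proj i u \<in> proj i ` (W \<inter> flow_box F i)" using v W by (intro image_eqI[of _ _ v]) auto
  then have "u \<in> A" unfolding A_def using u by simp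
  ultimately obtain x where x: "x \<in> L" "x \<in> A" using u(2) unfolding in_closure_of by blast
  then obtain y where y: "y \<in> W" "y \<in> flow_box F i" "proj i y = proj i x" "x \<in> flow_box F i"
    unfolding A_def by force
  then have "y \<in> L" using plaque_subset_leaf[OF L i y(4) x(1) y(2,3)] by simp
  then show "\<exists>y. y \<in> L \<and> y \<in> W" using y(1) by blast
qed

end

section \<open>Homogeneity of leaf closures\<close>

definition locally_homogeneous_pair :: "'a topology \<Rightarrow> 'a \<Rightarrow> 'a \<Rightarrow> bool" where
  "locally_homogeneous_pair T x y \<longleftrightarrow> (\<exists>h. local_homeomorphism T h \<and> (x, y) \<in> h)"

lemma locally_homogeneous_pair_sym:
  "locally_homogeneous_pair T x y \<Longrightarrow> locally_homogeneous_pair T y x"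
  unfolding locally_homogeneous_pair_def by (meson converseI local_homeomorphism_converse)

lemma locally_homogeneous_pair_trans:
  "locally_homogeneous_pair T x y \<Longrightarrow> locally_homogeneous_pair T y z \<Longrightarrow> locally_homogeneous_pair T x z"
  unfolding locally_homogeneous_pair_def by (meson relcompI local_homeomorphism_comp)

lemma homogeneous_spaceI:
  assumes "topspace T \<noteq> {}"
    and "\<And>x y. x \<in> topspace T \<Longrightarrow> y \<in> topspace T \<Longrightarrow> locally_homogeneous_pair T x y"
  shows "homogeneous_space T"
proof -
  have orbit: "pseudogroup_orbit {h. local_homeomorphism T h} x = topspace T" if "x \<in> topspace T" for x
  proof
    show "pseudogroup_orbit {h. local_homeomorphism T h} x \<subseteq> topspace T"
      unfolding pseudogroup_orbit_def local_homeomorphism_iff by blast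
    show "topspace T \<subseteq> pseudogroup_orbit {h. local_homeomorphism T h} x"
      using assms(2)[OF that] unfolding pseudogroup_orbit_def locally_homogeneous_pair_def by blast
  qed
  then have "pseudogroup_orbit {h. local_homeomorphism T h} ` topspace T = {topspace T}"
    using assms(1) by blast
  then show ?thesis unfolding homogeneous_space_def by simp
qed

context foliation
begin

section \<open>Saturated sets and their traces on the transversal\<close>

definition transverse_trace :: "'x set \<Rightarrow> ('i \<times> 'z) set" where
  "transverse_trace M = (\<Union>i\<in>indices F. proj i ` (M \<inter> flow_box F i))"

definition saturated :: "'x set \<Rightarrow> bool" where
  "saturated M \<longleftrightarrow> M \<subseteq> topspace X \<and> (\<forall>i\<in>indices F. \<forall>u\<in>flow_box F i. \<forall>v\<in>flow_box F i.
     proj i u = proj i v \<longrightarrow> u \<in> M \<longrightarrow> v \<in> M)"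

text \<open>The tag of a transversal point fixes its box, and saturation makes membership in
  \<open>M\<close> a property of the plaque.\<close>

lemma proj_in_transverse_trace:
  assumes M: "saturated M" and i: "i \<in> indices F" "u \<in> flow_box F i"
  shows "proj i u \<in> transverse_trace M \<longleftrightarrow> u \<in> M"
proof
  assume "proj i u \<in> transverse_trace M"
  then obtain j v where j: "j \<in> indices F" "v \<in> M" "v \<in> flow_box F j" "proj i u = proj j v"
    unfolding transverse_trace_def by blast
  then have "j = i" by (metis fst_proj)
  then show "u \<in> M" using M i j unfolding saturated_def by metis
next
  assume "u \<in> M"
  then show "proj i u \<in> transverse_trace M" using i unfolding transverse_trace_def by blast
qed

lemma total_transversal_cases:
  assumes "p \<in> topspace (total_transversal F)"
  obtains i u where "i \<in> indices F" "u \<in> flow_box F i" "p = proj i u"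
proof -
  obtain i z where i: "i \<in> indices F" "z \<in> topspace (transversal F i)" "p = (i, z)"
    using assms unfolding total_transversal_def by auto
  obtain c r where "0 < r" "leaf_ball F i = ball c r"
    using fol i(1) unfolding foliated_space_def by blast
  then have "(c, z) \<in> chart F i ` flow_box F i" using i chart_image[OF i(1)] by simp
  then obtain u where "u \<in> flow_box F i" "chart F i u = (c, z)" by (metis imageE)
  then show ?thesis using that[OF i(1), of u] i(3) by (simp add: proj_def)
qed

text \<open>By saturation the complement of the trace is the trace of the complement, which is open
  because projections are open.\<close>

lemma transverse_trace_closed:
  assumes M: "saturated M" "closedin X M"
  shows "closedin (total_transversal F) (transverse_trace M)"
proof -
  have "transverse_trace M \<subseteq> topspace (total_transversal F)"
    unfolding transverse_trace_def using proj_mem by blast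
  moreover have "topspace (total_transversal F) - transverse_trace M =
      (\<Union>i\<in>indices F. proj i ` ((topspace X - M) \<inter> flow_box F i))" (is "?A = ?B")
  proof
    show "?A \<subseteq> ?B"
    proof
      fix p assume p: "p \<in> ?A"
      then obtain i u where i: "i \<in> indices F" "u \<in> flow_box F i" "p = proj i u"
        using total_transversal_cases by blast
      then have "u \<notin> M" using p proj_in_transverse_trace[OF M(1) i(1,2)] by simp
      then show "p \<in> ?B" using i flow_box_subset[OF i(1)] by blast
    qed
    show "?B \<subseteq> ?A"
    proof
      fix p assume "p \<in> ?B"
      then obtain i u where i: "i \<in> indices F" "u \<in> flow_box F i" "u \<notin> M" "p = proj i u" by blast
      then show "p \<in> ?A" using proj_in_transverse_trace[OF M(1) i(1,2)] proj_mem by simp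
    qed
  qed
  moreover have "openin (total_transversal F) ?B"
    using proj_open M(2) by (intro openin_Union) (auto simp: closedin_def)
  ultimately show ?thesis by (simp add: closedin_def)
qed

section \<open>Local homeomorphisms of a saturated set inside a flow box\<close>

lemma transversal_slice_image_open:
  assumes i: "i \<in> indices F" and g: "local_homeomorphism (total_transversal F) g"
    and E: "openin (transversal F i) E"
  shows "openin (transversal F i) {z. (i, z) \<in> g `` (Pair i ` E)}"
proof -
  have "openin (total_transversal F) (Pair i ` E)"
    unfolding total_transversal_def using open_map_component_injection[OF i] E unfolding open_map_def by blast
  then have "openin (total_transversal F) (g `` (Pair i ` E))"
    using g unfolding local_homeomorphism_iff by simp
  then show ?thesis
    unfolding total_transversal_def openin_sum_topology using i by simp
qed

text \<open>In chart coordinates this is translation by \<open>t\<close> along the plaques times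
  \<open>g\<close> across them, restricted to \<open>M\<close> and to points whose image stays in
  the same box. As a relation it needs no explicit domain, and its converse has the same
  shape.\<close>

definition box_map :: "'x set \<Rightarrow> 'i \<Rightarrow> (real^'n) \<Rightarrow> (('i \<times> 'z) \<times> ('i \<times> 'z)) set \<Rightarrow> ('x \<times> 'x) set" where
  "box_map M i t g = {(x, y). x \<in> M \<inter> flow_box F i \<and> y \<in> M \<inter> flow_box F i \<and>
     fst (chart F i y) = fst (chart F i x) + t \<and> (proj i x, proj i y) \<in> g}"

lemma box_map_converse: "(box_map M i t g)\<inverse> = box_map M i (- t) (g\<inverse>)"
  unfolding box_map_def by auto

lemma box_map_single_valued:
  assumes "i \<in> indices F" "single_valued g"
  shows "single_valued (box_map M i t g)"
proof (rule single_valuedI)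
  fix x y y' assume "(x, y) \<in> box_map M i t g" "(x, y') \<in> box_map M i t g"
  then have y: "y \<in> flow_box F i" "y' \<in> flow_box F i" "fst (chart F i y) = fst (chart F i y')"
    and "(proj i x, proj i y) \<in> g" "(proj i x, proj i y') \<in> g"
    unfolding box_map_def by simp_all
  moreover from this(4,5) have "proj i y = proj i y'" using assms(2) by (meson single_valuedD)
  ultimately have y: "y \<in> flow_box F i" "y' \<in> flow_box F i" "fst (chart F i y) = fst (chart F i y')"
    "proj i y = proj i y'" by blast+
  then have "chart F i y = chart F i y'" by (simp add: proj_def prod_eq_iff)
  then show "y = y'" using chart_inj[OF assms(1)] y(1,2) by (meson inj_onD)
qed

text \<open>The image of an open set of \<open>X\<close> is open, as translation and
  \<open>g\<close> are open maps. Restricting to \<open>M\<close> is harmless: by invariance of the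
  trace, a point of \<open>M\<close> comes only from points of \<open>M\<close>.\<close>

lemma box_map_image_open:
  assumes M: "saturated M" and i: "i \<in> indices F"
    and g: "local_homeomorphism (total_transversal F) g"
    and inv: "\<And>p q. (p, q) \<in> g \<Longrightarrow> p \<in> transverse_trace M \<longleftrightarrow> q \<in> transverse_trace M"
    and V: "openin (subtopology X M) V"
  shows "openin (subtopology X M) (box_map M i t g `` V)"
proof -
  obtain V' where V': "openin X V'" "V = V' \<inter> M" using V unfolding openin_subtopology by blast
  \<comment> \<open>The ambient image in chart coordinates, with no restriction to
    \<open>M\<close>.\<close>
  define R where "R = {(b, z). b \<in> leaf_ball F i \<and>
     (\<exists>x\<in>V' \<inter> flow_box F i. b = fst (chart F i x) + t \<and> (proj i x, (i, z)) \<in> g)}"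
  have "openin (prod_topology (top_of_set (leaf_ball F i)) (transversal F i)) R"
    unfolding openin_prod_topology_alt
  proof (intro allI impI)
    fix b z assume "(b, z) \<in> R"
    then obtain x where x: "b \<in> leaf_ball F i" "x \<in> V' \<inter> flow_box F i"
      "b = fst (chart F i x) + t" "(proj i x, (i, z)) \<in> g" unfolding R_def by blast
    let ?O = "chart F i ` (V' \<inter> flow_box F i)"
    have memO: "(fst (chart F i x), snd (chart F i x)) \<in> ?O" using x(2) by simp
    obtain A E where AE: "openin (top_of_set (leaf_ball F i)) A" "openin (transversal F i) E"
      "fst (chart F i x) \<in> A" "snd (chart F i x) \<in> E" "A \<times> E \<subseteq> ?O"
      using chart_open[OF i V'(1), unfolded openin_prod_topology_alt, rule_format, OF memO] by blast
    have "open A" using AE(1) leaf_ball[OF i] by (metis openin_open_eq)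
    then have "open ((\<lambda>a. a + t) ` A)"
      using open_translation[of A t] by (simp add: add.commute)
    then have 1: "openin (top_of_set (leaf_ball F i)) (leaf_ball F i \<inter> (\<lambda>a. a + t) ` A)"
      by (simp add: openin_open_Int)
    \<comment> \<open>\<open>g\<close> may lead into other boxes; only the slice of its image in box
      \<open>i\<close> is kept.\<close>
    have 2: "openin (transversal F i) {z. (i, z) \<in> g `` (Pair i ` E)}"
      by (rule transversal_slice_image_open[OF i g AE(2)])
    have 3: "b \<in> leaf_ball F i \<inter> (\<lambda>a. a + t) ` A" using x AE(3) by blast
    have 4: "z \<in> {z. (i, z) \<in> g `` (Pair i ` E)}" using x(4) AE(4) unfolding proj_def by blast
    have 5: "(leaf_ball F i \<inter> (\<lambda>a. a + t) ` A) \<times> {z. (i, z) \<in> g `` (Pair i ` E)} \<subseteq> R"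
    proof
      fix q assume "q \<in> (leaf_ball F i \<inter> (\<lambda>a. a + t) ` A) \<times> {z. (i, z) \<in> g `` (Pair i ` E)}"
      then obtain a e z' where q: "q = (a + t, z')" "a + t \<in> leaf_ball F i" "a \<in> A" "e \<in> E" "((i, e), (i, z')) \<in> g"
        by auto
      have "(a, e) \<in> ?O" using AE(5) q(3,4) by (intro subsetD[OF AE(5)] SigmaI)
      then obtain y where y: "(a, e) = chart F i y" "y \<in> V' \<inter> flow_box F i" by (rule imageE)
      have "proj i y = (i, e)" "fst (chart F i y) = a" using y(1)[symmetric] by (simp_all add: proj_def)
      then show "q \<in> R" unfolding R_def using q y(2) by auto
    qed
    show "\<exists>U W. openin (top_of_set (leaf_ball F i)) U \<and> openin (transversal F i) W \<and>
        b \<in> U \<and> z \<in> W \<and> U \<times> W \<subseteq> R"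
      using 1 2 3 4 5 by blast
  qed
  then have "openin X {y \<in> flow_box F i. chart F i y \<in> R}" by (rule chart_vimage_open[OF i])
  moreover have "box_map M i t g `` V = {y \<in> flow_box F i. chart F i y \<in> R} \<inter> M"
  proof
    show "box_map M i t g `` V \<subseteq> {y \<in> flow_box F i. chart F i y \<in> R} \<inter> M"
    proof
      fix y assume "y \<in> box_map M i t g `` V"
      then obtain x where x: "x \<in> V" "x \<in> flow_box F i" "y \<in> M" "y \<in> flow_box F i"
        "fst (chart F i y) = fst (chart F i x) + t" "(proj i x, proj i y) \<in> g"
        unfolding box_map_def by blast
      have "(fst (chart F i y), snd (chart F i y)) \<in> R"
        unfolding R_def using x V'(2) chart_mem(1)[OF i x(4)] by (auto simp: proj_def)
      then have "chart F i y \<in> R" by (simp only: prod.collapse)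
      then show "y \<in> {y \<in> flow_box F i. chart F i y \<in> R} \<inter> M" using x by simp
    qed
    show "{y \<in> flow_box F i. chart F i y \<in> R} \<inter> M \<subseteq> box_map M i t g `` V"
    proof
      fix y assume y: "y \<in> {y \<in> flow_box F i. chart F i y \<in> R} \<inter> M"
      then have "(fst (chart F i y), snd (chart F i y)) \<in> R" by simp
      then obtain x where x: "x \<in> V'" "x \<in> flow_box F i"
        "fst (chart F i y) = fst (chart F i x) + t" "(proj i x, proj i y) \<in> g"
        unfolding R_def by (auto simp: proj_def)
      have "proj i y \<in> transverse_trace M" using y proj_in_transverse_trace[OF M i] by simp
      then have "x \<in> M" using inv[OF x(4)] proj_in_transverse_trace[OF M i x(2)] by simp
      then have "(x, y) \<in> box_map M i t g" "x \<in> V" using x y V'(2) unfolding box_map_def by auto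
      then show "y \<in> box_map M i t g `` V" by blast
    qed
  qed
  ultimately show ?thesis unfolding openin_subtopology by blast
qed

lemma box_map_homogeneous_pair:
  assumes M: "saturated M" and i: "i \<in> indices F"
    and g: "local_homeomorphism (total_transversal F) g"
    and inv: "\<And>p q. (p, q) \<in> g \<Longrightarrow> p \<in> transverse_trace M \<longleftrightarrow> q \<in> transverse_trace M"
    and u: "u \<in> M" "u \<in> flow_box F i" and v: "v \<in> M" "v \<in> flow_box F i" and uv: "(proj i u, proj i v) \<in> g"
  shows "locally_homogeneous_pair (subtopology X M) u v"
proof -
  define t where "t = fst (chart F i v) - fst (chart F i u)"
  let ?h = "box_map M i t g"
  have "(u, v) \<in> ?h" unfolding box_map_def using u v uv by (simp add: t_def)
  moreover have "local_homeomorphism (subtopology X M) ?h"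
    unfolding local_homeomorphism_iff
  proof (intro conjI allI impI)
    have g': "local_homeomorphism (total_transversal F) (g\<inverse>)"
      using g by (rule local_homeomorphism_converse)
    have inv': "p \<in> transverse_trace M \<longleftrightarrow> q \<in> transverse_trace M" if "(p, q) \<in> g\<inverse>" for p q
      using inv that by auto
    have "M \<subseteq> topspace X" using M unfolding saturated_def by simp
    then show "?h \<subseteq> topspace (subtopology X M) \<times> topspace (subtopology X M)"
      unfolding box_map_def by auto
    show "single_valued ?h" "single_valued (?h\<inverse>)"
      unfolding box_map_converse using box_map_single_valued[OF i] g g' unfolding local_homeomorphism_iff by simp_all
    show "openin (subtopology X M) (?h `` V)" if "openin (subtopology X M) V" for V
      using box_map_image_open[OF M i g inv that] .
    show "openin (subtopology X M) (?h\<inverse> `` V)" if "openin (subtopology X M) V" for V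
      unfolding box_map_converse using box_map_image_open[OF M i g' inv' that] .
  qed
  ultimately show ?thesis unfolding locally_homogeneous_pair_def by blast
qed

lemma plaque_homogeneous_pair:
  assumes M: "saturated M" and i: "i \<in> indices F"
    and u: "u \<in> M" "u \<in> flow_box F i" and v: "v \<in> flow_box F i" "proj i v = proj i u"
  shows "locally_homogeneous_pair (subtopology X M) u v"
proof (rule box_map_homogeneous_pair[OF M i])
  show "local_homeomorphism (total_transversal F) (Id_on (topspace (total_transversal F)))"
    by (rule local_homeomorphism_Id_on) simp
  show "v \<in> M" using M i u v unfolding saturated_def by metis
  show "(proj i u, proj i v) \<in> Id_on (topspace (total_transversal F))"
    using proj_mem[OF i u(2)] unfolding v(2) by (rule Id_onI)
qed (use u v in auto)

lemma leaf_homogeneous_pair: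
  assumes M: "saturated M" and L: "L \<in> leaves X F" "L \<subseteq> M" and uv: "u \<in> L" "v \<in> L"
  shows "locally_homogeneous_pair (subtopology X M) u v"
proof -
  \<comment> \<open>Membership in \<open>M\<close> is carried along because moving inside a plaque
    presupposes a starting point in \<open>M\<close>.\<close>
  let ?Q = "\<lambda>x. x \<in> M \<and> locally_homogeneous_pair (subtopology X M) u x"
  have "?Q u \<longleftrightarrow> ?Q v"
  proof (rule leaf_locally_constant[OF L(1) uv])
    fix x assume x: "x \<in> topspace X"
    then obtain i where i: "i \<in> indices F" "x \<in> flow_box F i" using flow_box_cover by blast
    have imp: "?Q b" if a: "?Q a" "a \<in> flow_box F i" "b \<in> flow_box F i" "proj i a = proj i b" for a b
    proof
      show "b \<in> M" using M i(1) a unfolding saturated_def by metis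
      have "locally_homogeneous_pair (subtopology X M) a b"
        using plaque_homogeneous_pair[OF M i(1), of a b] a by simp
      then show "locally_homogeneous_pair (subtopology X M) u b"
        using a(1) locally_homogeneous_pair_trans by metis
    qed
    have "?Q y \<longleftrightarrow> ?Q x" if "y \<in> topspace X \<inter> plaque i x" for y
    proof -
      have y: "y \<in> flow_box F i" "proj i y = proj i x" using that by (auto simp: plaque_def)
      show ?thesis using imp[OF _ y(1) i(2) y(2)] imp[OF _ i(2) y(1) y(2)[symmetric]] by (rule iffI)
    qed
    then show "\<exists>i\<in>indices F. \<exists>W. x \<in> flow_box F i \<and> openin X W \<and> x \<in> W \<and> (\<forall>y\<in>W \<inter> plaque i x. ?Q y \<longleftrightarrow> ?Q x)"
      using i x openin_topspace[of X] by blast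
  qed
  moreover have "?Q u"
  proof
    show uM: "u \<in> M" using L uv by blast
    have "u \<in> topspace X" using uv leaf_subset[OF L(1)] by blast
    then obtain i where i: "i \<in> indices F" "u \<in> flow_box F i" using flow_box_cover by blast
    show "locally_homogeneous_pair (subtopology X M) u u"
      using plaque_homogeneous_pair[OF M i(1) uM i(2) i(2)] by simp
  qed
  ultimately show ?thesis by simp
qed

section \<open>Finite covers by compact pieces and the chains of a leaf\<close>

lemma transversal_metric:
  obtains \<mu> where "mtopology_of \<mu> = total_transversal F"
proof -
  have "metrizable_space (transversal F i)" if "i \<in> indices F" for i
    using fol that unfolding foliated_space_def polish_topology_def
    by (simp add: completely_metrizable_imp_metrizable_space)
  then show ?thesis using sum_topology_metric that unfolding total_transversal_def by metis
qed

text \<open>A flow box and its transversal need not be compact, so estimates need not be uniform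
  over them. Boxes are therefore replaced by pieces \<open>W \<subseteq> C\<close>: the open sets
  \<open>W\<close> cover the space, the compact sets \<open>C\<close> carry the estimates. One box
  may contribute several pieces.\<close>

definition small_boxes :: "('i \<times> 'x set \<times> 'x set) set \<Rightarrow> bool" where
  "small_boxes A \<longleftrightarrow> finite A \<and>
     (\<forall>(i, W, C)\<in>A. i \<in> indices F \<and> openin X W \<and> compactin X C \<and> closedin X C \<and> W \<subseteq> C \<and> C \<subseteq> flow_box F i) \<and>
     (\<forall>u\<in>topspace X. \<exists>(i, W, C)\<in>A. u \<in> W)"

lemma small_boxesD:
  assumes "small_boxes A"
  shows "finite A"
    and "(i, W, C) \<in> A \<Longrightarrow>
      i \<in> indices F \<and> openin X W \<and> compactin X C \<and> closedin X C \<and> W \<subseteq> C \<and> C \<subseteq> flow_box F i"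
    and "u \<in> topspace X \<Longrightarrow> \<exists>i W C. (i, W, C) \<in> A \<and> u \<in> W"
  using assms unfolding small_boxes_def by fast+

lemma small_boxes_exist:
  assumes "compact_space X"
  shows "\<exists>A. small_boxes A"
proof -
  have "metrizable_space X" "locally_compact_space X"
    using fol unfolding foliated_space_def polish_topology_def
    by (simp_all add: completely_metrizable_imp_metrizable_space)
  then have nb: "neighbourhood_base_of (\<lambda>C. compactin X C \<and> closedin X C) X"
    using metrizable_imp_regular_space locally_compact_regular_space_neighbourhood_base by blast
  define \<B> where "\<B> = {(i, W, C). i \<in> indices F \<and> openin X W \<and> compactin X C \<and> closedin X C \<and> W \<subseteq> C \<and> C \<subseteq> flow_box F i}"
  have ex: "\<exists>i W C. (i, W, C) \<in> \<B> \<and> u \<in> W" if u: "u \<in> topspace X" for u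
  proof -
    obtain i where i: "i \<in> indices F" "u \<in> flow_box F i" using flow_box_cover[OF u] by blast
    then obtain W C where "openin X W" "compactin X C" "closedin X C" "u \<in> W" "W \<subseteq> C" "C \<subseteq> flow_box F i"
      using nb flow_box_open[OF i(1)] unfolding neighbourhood_base_of by metis
    then show ?thesis using i unfolding \<B>_def by blast
  qed
  have "\<exists>\<F>. finite \<F> \<and> \<F> \<subseteq> (\<lambda>(i, W, C). W) ` \<B> \<and> topspace X \<subseteq> \<Union>\<F>"
  proof (rule compactinD)
    show "compactin X (topspace X)" using assms by (simp add: compact_space_def)
    show "openin X U" if "U \<in> (\<lambda>(i, W, C). W) ` \<B>" for U using that by (auto simp: \<B>_def)
    show "topspace X \<subseteq> \<Union>((\<lambda>(i, W, C). W) ` \<B>)" using ex by fastforce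
  qed
  then obtain \<F> where \<F>: "finite \<F>" "\<F> \<subseteq> (\<lambda>(i, W, C). W) ` \<B>" "topspace X \<subseteq> \<Union>\<F>" by blast
  obtain A where A: "A \<subseteq> \<B>" "finite A" "\<F> = (\<lambda>(i, W, C). W) ` A"
    using finite_subset_image[OF \<F>(1,2)] by blast
  have "small_boxes A"
    unfolding small_boxes_def
  proof (intro conjI ballI A(2))
    show "case a of (i, W, C) \<Rightarrow> i \<in> indices F \<and> openin X W \<and> compactin X C \<and> closedin X C \<and> W \<subseteq> C \<and> C \<subseteq> flow_box F i"
      if "a \<in> A" for a
      using subsetD[OF A(1) that] unfolding \<B>_def by simp
    show "\<exists>(i, W, C)\<in>A. u \<in> W" if u: "u \<in> topspace X" for u
    proof -
      obtain U where "U \<in> \<F>" "u \<in> U" using \<F>(3) u by blast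
      then show ?thesis unfolding A(3) by auto
    qed
  qed
  then show ?thesis by (rule exI)
qed

text \<open>Around each point of \<open>C\<close> the holonomy map is defined, agrees with an
  element of \<open>S\<close>, and stays within \<epsilon>/2 of its value there. A Lebesgue number
  of the projection of \<open>C\<close> makes the size of these neighbourhoods uniform; for
  \<open>u\<close> the element of \<open>S\<close> belonging to a centre \<open>c\<close> is
  used.\<close>

lemma holonomy_uniform:
  fixes \<mu> :: "('i \<times> 'z) metric"
  assumes \<mu>: "mtopology_of \<mu> = total_transversal F" and ij: "i \<in> indices F" "j \<in> indices F"
    and C: "compactin X C" "C \<subseteq> flow_box F i \<inter> flow_box F j"
    and germ: "\<And>x x'. (x, x') \<in> holonomy_map F i j \<Longrightarrow>
       \<exists>s\<in>S. \<exists>N. openin (total_transversal F) N \<and> x \<in> N \<and> (\<forall>y\<in>N. \<forall>y'. (y, y') \<in> holonomy_map F i j \<longrightarrow> (y, y') \<in> s)"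
    and \<epsilon>: "0 < \<epsilon>"
  shows "\<exists>\<eta>>0. \<forall>u\<in>C. \<exists>s\<in>S. (proj i u, proj j u) \<in> s \<and>
     (\<forall>x\<in>mball_of \<mu> (proj i u) \<eta>. \<exists>x'. (x, x') \<in> holonomy_map F i j \<inter> s \<and> mdist \<mu> (proj j u) x' < \<epsilon>)"
proof -
  let ?T = "total_transversal F" and ?h = "holonomy_map F i j"
  have sp: "mspace \<mu> = topspace ?T" using \<mu> by (metis topspace_mtopology_of)
  have mem: "(proj i u, proj j u) \<in> ?h" if "u \<in> C" for u
    using C(2) that unfolding holonomy_map_eq by blast
  have h: "?h \<subseteq> topspace ?T \<times> topspace ?T" "single_valued ?h"
    using holonomy_map_local_homeomorphism[OF ij] unfolding local_homeomorphism_iff by simp_all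
  have "\<exists>s N. s \<in> S \<and> openin ?T N \<and> proj i u \<in> N \<and>
      (\<forall>y\<in>N. \<exists>y'. (y, y') \<in> ?h \<inter> s \<and> y' \<in> mspace \<mu> \<and> mdist \<mu> (proj j u) y' < \<epsilon>/2)" if u: "u \<in> C" for u
  proof -
    obtain s N where s: "s \<in> S" "openin ?T N" "proj i u \<in> N" "\<forall>y\<in>N. \<forall>y'. (y, y') \<in> ?h \<longrightarrow> (y, y') \<in> s"
      using germ[OF mem[OF u]] by blast
    let ?B = "mball_of \<mu> (proj j u) (\<epsilon>/2)"
    have "openin ?T (?h\<inverse> `` ?B)"
      unfolding holonomy_map_converse using holonomy_map_image_open[OF ij(2,1)] openin_mball_of[of \<mu>] \<mu> by simp
    \<comment> \<open>The preimage of the ball also puts the neighbourhood inside the domain of the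
      holonomy map, which the germ statement alone does not give.\<close>
    then have "openin ?T (N \<inter> ?h\<inverse> `` ?B)" using s(2) by blast
    moreover have "proj j u \<in> ?B" using mem[OF u] h(1) sp \<epsilon> by auto
    then have "proj i u \<in> N \<inter> ?h\<inverse> `` ?B" using s(3) mem[OF u] by blast
    moreover have "\<exists>y'. (y, y') \<in> ?h \<inter> s \<and> y' \<in> mspace \<mu> \<and> mdist \<mu> (proj j u) y' < \<epsilon>/2"
      if y: "y \<in> N \<inter> ?h\<inverse> `` ?B" for y
    proof -
      obtain y' where "(y, y') \<in> ?h" "y' \<in> ?B" using y by blast
      moreover have "(y, y') \<in> s" using s(4) y calculation(1) by blast
      ultimately show ?thesis by (intro exI[of _ y']) simp
    qed
    ultimately show ?thesis using s(1) by blast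
  qed
  then obtain s N where sN: "\<And>u. u \<in> C \<Longrightarrow> s u \<in> S \<and> openin ?T (N u) \<and> proj i u \<in> N u \<and>
      (\<forall>y\<in>N u. \<exists>y'. (y, y') \<in> ?h \<inter> s u \<and> y' \<in> mspace \<mu> \<and> mdist \<mu> (proj j u) y' < \<epsilon>/2)"
    by metis
  have cpt: "compactin (mtopology_of \<mu>) (proj i ` C)"
    unfolding \<mu> using proj_compact[OF ij(1) C(1)] C(2) by simp
  have cov: "proj i ` C \<subseteq> \<Union>(N ` C)" using sN by blast
  have opn: "openin (mtopology_of \<mu>) U" if "U \<in> N ` C" for U using that sN \<mu> by auto
  obtain \<eta> where \<eta>: "0 < \<eta>" "\<forall>x\<in>proj i ` C. \<exists>U\<in>N ` C. mball_of \<mu> x \<eta> \<subseteq> U"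
    using lebesgue_number_of[OF cpt cov opn] by blast
  have "\<exists>t\<in>S. (proj i u, proj j u) \<in> t \<and>
     (\<forall>x\<in>mball_of \<mu> (proj i u) \<eta>. \<exists>x'. (x, x') \<in> ?h \<inter> t \<and> mdist \<mu> (proj j u) x' < \<epsilon>)" if u: "u \<in> C" for u
  proof -
    obtain c where c: "c \<in> C" "mball_of \<mu> (proj i u) \<eta> \<subseteq> N c" using \<eta>(2) u by blast
    have m: "proj i u \<in> mspace \<mu>" "proj j u \<in> mspace \<mu>" "proj j c \<in> mspace \<mu>"
      using mem[OF u] mem[OF c(1)] h(1) sp by auto
    have "proj i u \<in> N c" using c(2) m(1) \<eta>(1) by auto
    then obtain y where y: "(proj i u, y) \<in> ?h \<inter> s c" "mdist \<mu> (proj j c) y < \<epsilon>/2" using sN[OF c(1)] by blast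
    have yu: "y = proj j u" using y(1) mem[OF u] h(2) unfolding single_valued_def by blast
    have "\<exists>x'. (x, x') \<in> ?h \<inter> s c \<and> mdist \<mu> (proj j u) x' < \<epsilon>" if x: "x \<in> mball_of \<mu> (proj i u) \<eta>" for x
    proof -
      obtain x' where x': "(x, x') \<in> ?h \<inter> s c" "x' \<in> mspace \<mu>" "mdist \<mu> (proj j c) x' < \<epsilon>/2"
        using sN[OF c(1)] c(2) x by blast
      have "mdist \<mu> (proj j u) x' < \<epsilon>"
        using mdist_triangle[OF m(2,3) x'(2)] x'(3) y(2) yu mdist_commute[of \<mu> "proj j u" "proj j c"] by simp
      then show ?thesis using x'(1) by blast
    qed
    then show ?thesis using sN[OF c(1)] y(1) yu by blast
  qed
  then show ?thesis using \<eta>(1) by blast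
qed

text \<open>The foliation enters the abstract limit argument as follows: transversal points are
  plaques, and a \<open>P\<close>-step joins the two plaques of a point common to two compact
  pieces. The limit \<open>g\<close> takes a plaque of \<open>L\<close> to that of \<open>y\<close>,
  and a box map over \<open>g\<close> takes a point of \<open>L\<close> to \<open>y\<close>.\<close>

lemma leaf_closure_homogeneous_pair:
  assumes cpt: "compact_space X" and se: "strongly_equicontinuous_foliation F"
    and L: "L \<in> leaves X F" and M: "saturated (X closure_of L)" and y: "y \<in> X closure_of L"
  shows "\<exists>u\<in>L. locally_homogeneous_pair (subtopology X (X closure_of L)) u y"
proof -
  let ?T = "total_transversal F" and ?M = "X closure_of L"
  obtain \<mu> where \<mu>: "mtopology_of \<mu> = ?T" by (rule transversal_metric)
  have sp: "mspace \<mu> = topspace ?T" using \<mu> by (metis topspace_mtopology_of)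
  obtain Q D S where Q: "Q \<in> quasi_local_metrics (topspace ?T)" "induces_topology Q ?T" "D \<in> Q"
    and S: "symmetric_maps S" "closed_under_composition S" "holonomy_pseudogroup F = generated_pseudogroup ?T S"
    and eq: "\<forall>\<epsilon>>0. \<exists>\<delta>>0. \<forall>h\<in>S. \<forall>m\<in>D. \<forall>m'\<in>D. \<forall>x y x' y'.
             (x, x') \<in> h \<and> (y, y') \<in> h \<and> x \<in> mspace m \<and> y \<in> mspace m \<and>
             x' \<in> mspace m' \<and> y' \<in> mspace m' \<and> mdist m x y < \<delta>
             \<longrightarrow> mdist m' x' y' < \<epsilon>"
    using se unfolding strongly_equicontinuous_foliation_def strongly_equicontinuous_def by (elim bexE exE conjE)
  note D = induced_topology_metric[OF Q]
  have loc: "local_homeomorphism ?T s" if "s \<in> S" for s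
  proof -
    have "s \<in> holonomy_pseudogroup F" unfolding S(3) using that by (rule generated_pseudogroup.base)
    moreover have "pseudogroup ?T (holonomy_pseudogroup F)"
      unfolding holonomy_pseudogroup_def
      by (rule pseudogroup_generated_pseudogroup) (use holonomy_map_local_homeomorphism in blast)
    ultimately show ?thesis unfolding pseudogroup_def by simp
  qed
  \<comment> \<open>Chains start with the identity, which \<open>S\<close> need not contain;
    adjoining it keeps the set symmetric and closed under composition.\<close>
  define S' where "S' = insert (Id_on (topspace ?T)) S"
  have loc': "\<forall>s\<in>S'. local_homeomorphism ?T s"
    unfolding S'_def using loc local_homeomorphism_Id_on[OF openin_topspace] by blast
  have sub': "s \<subseteq> topspace ?T \<times> topspace ?T" if "s \<in> S'" for s
    using bspec[OF loc' that] unfolding local_homeomorphism_iff by simp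
  have sym': "symmetric_maps S'" using S(1) unfolding symmetric_maps_def S'_def by simp
  have comp': "s O t \<in> S'" if "s \<in> S'" "t \<in> S'" for s t
  proof (cases "s \<in> S \<and> t \<in> S")
    case True
    then show ?thesis using S(2) unfolding closed_under_composition_def S'_def by simp
  next
    case False
    have "s O Id_on (topspace ?T) = s" "Id_on (topspace ?T) O t = t" using sub'[OF that(1)] sub'[OF that(2)] by blast+
    then show ?thesis using False that unfolding S'_def by auto
  qed
  have germ: "\<exists>s\<in>S'. \<exists>N. openin ?T N \<and> x \<in> N \<and> (\<forall>y\<in>N. \<forall>y'. (y, y') \<in> holonomy_map F i j \<longrightarrow> (y, y') \<in> s)"
    if ij: "i \<in> indices F" "j \<in> indices F" and x: "(x, x') \<in> holonomy_map F i j" for i j x x'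
  proof (rule generated_pseudogroup_germ[OF loc' sym' _ _ _ _ x])
    show "closed_under_composition S'" using comp' unfolding closed_under_composition_def by blast
    show "Id_on (topspace ?T) \<in> S'" "S \<subseteq> S'" unfolding S'_def by auto
    have "holonomy_map F i j \<in> holonomy_pseudogroup F"
      unfolding holonomy_pseudogroup_def by (rule generated_pseudogroup.base) (use ij in blast)
    then show "holonomy_map F i j \<in> generated_pseudogroup ?T S" unfolding S(3) .
  qed
  obtain A where "small_boxes A" using small_boxes_exist[OF cpt] by (rule exE)
  note A = small_boxesD[OF this]
  define K where "K = (\<Union>(i, W, C)\<in>A. proj i ` C)"
  define P where "P = {(proj i u, proj j u) | i W C j V B u. (i, W, C) \<in> A \<and> (j, V, B) \<in> A \<and> u \<in> C \<and> u \<in> B}"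
  have KI: "proj i u \<in> K" if "(i, W, C) \<in> A" "u \<in> C" for i W C u
    using that unfolding K_def by force
  have PI: "(proj i u, proj j u) \<in> P" if "(i, W, C) \<in> A" "(j, V, B) \<in> A" "u \<in> C" "u \<in> B" for i j W V C B u
    using that unfolding P_def by blast
  have PE: "\<exists>i W C j V B u. (i, W, C) \<in> A \<and> (j, V, B) \<in> A \<and> u \<in> C \<and> u \<in> B \<and> p = proj i u \<and> q = proj j u"
    if "(p, q) \<in> P" for p q
    using that unfolding P_def by blast
  have K: "compactin ?T K"
    unfolding K_def
  proof (rule compactin_Union)
    show "finite ((\<lambda>(i, W, C). proj i ` C) ` A)" using A(1) by simp
    show "compactin ?T E" if "E \<in> (\<lambda>(i, W, C). proj i ` C) ` A" for E
      using that A(2) proj_compact by auto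
  qed
  \<comment> \<open>The two boxes are read off from the tags of \<open>p\<close> and
    \<open>q\<close>, so the maps can be indexed by transversal points alone.\<close>
  define hol where "hol p q = holonomy_map F (fst p) (fst q)" for p q :: "'i \<times> 'z"
  have Ssub: "s \<subseteq> topspace ?T \<times> topspace ?T" if "s \<in> S" for s
    using sub' that unfolding S'_def by blast
  have "\<exists>\<rho>>0. \<forall>\<epsilon>>0. \<exists>\<delta>>0. \<forall>h\<in>S. \<forall>x y x' y'.
     (x, x') \<in> h \<and> (y, y') \<in> h \<and> x \<in> K \<and> x' \<in> K \<and> mdist \<mu> x y < \<delta> \<and> mdist \<mu> x' y' < \<rho>
       \<longrightarrow> mdist \<mu> x' y' < \<epsilon>"
    by (rule strongly_equicontinuous_on_compact[OF D \<mu> eq Ssub K])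
  then obtain \<rho> where \<rho>: "\<rho> > 0" "\<forall>\<epsilon>>0. \<exists>\<delta>>0. \<forall>h\<in>S. \<forall>x y x' y'.
     (x, x') \<in> h \<and> (y, y') \<in> h \<and> x \<in> K \<and> x' \<in> K \<and> mdist \<mu> x y < \<delta> \<and> mdist \<mu> x' y' < \<rho>
       \<longrightarrow> mdist \<mu> x' y' < \<epsilon>"
    by (elim exE conjE)
  interpret equicontinuous_chains \<mu> S' K \<rho> P hol
  proof
    show "s \<subseteq> mspace \<mu> \<times> mspace \<mu>" if "s \<in> S'" for s unfolding sp using that by (rule sub')
    show "Id_on (mspace \<mu>) \<in> S'" unfolding sp S'_def by simp
    show "s O t \<in> S'" if "s \<in> S'" "t \<in> S'" for s t using that by (rule comp')
    show "compactin (mtopology_of \<mu>) K" unfolding \<mu> by (rule K)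
    show "0 < \<rho>" by fact
    show "\<exists>\<delta>>0. \<forall>s\<in>S'. \<forall>x y x' y'. (x, x') \<in> s \<and> (y, y') \<in> s \<and> x \<in> K \<and> x' \<in> K \<and>
        mdist \<mu> x y < \<delta> \<and> mdist \<mu> x' y' < \<rho> \<longrightarrow> mdist \<mu> x' y' < \<epsilon>" if \<epsilon>: "0 < \<epsilon>" for \<epsilon>
    proof -
      obtain \<delta> where \<delta>: "\<delta> > 0" "\<forall>h\<in>S. \<forall>x y x' y'.
         (x, x') \<in> h \<and> (y, y') \<in> h \<and> x \<in> K \<and> x' \<in> K \<and> mdist \<mu> x y < \<delta> \<and> mdist \<mu> x' y' < \<rho>
       \<longrightarrow> mdist \<mu> x' y' < \<epsilon>" using \<rho>(2) \<epsilon> by blast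
      \<comment> \<open>The term \<open>\<epsilon>\<close> of the minimum handles the adjoined
        identity.\<close>
      have "mdist \<mu> x' y' < \<epsilon>" if h: "s \<in> S'" "(x, x') \<in> s" "(y, y') \<in> s" "x \<in> K" "x' \<in> K"
        "mdist \<mu> x y < min \<delta> \<epsilon>" "mdist \<mu> x' y' < \<rho>" for s x y x' y'
      proof (cases "s \<in> S")
        case True
        then show ?thesis using \<delta>(2) h by (metis min_less_iff_conj)
      next
        case False
        then have "s = Id_on (topspace ?T)" using h(1) unfolding S'_def by simp
        then show ?thesis using h by auto
      qed
      then show ?thesis using \<delta>(1) \<epsilon> by (intro exI[of _ "min \<delta> \<epsilon>"]) auto
    qed
    show "P \<subseteq> K \<times> K"
    proof (rule subrelI)
      fix p q assume "(p, q) \<in> P"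
      then obtain i W C j V B u where "(i, W, C) \<in> A" "(j, V, B) \<in> A" "u \<in> C" "u \<in> B" "p = proj i u" "q = proj j u"
        using PE by meson
      then show "(p, q) \<in> K \<times> K" using KI[of i W C u] KI[of j V B u] by simp
    qed
    show "sym P"
    proof (rule symI)
      fix p q assume "(p, q) \<in> P"
      then obtain i W C j V B u where "(i, W, C) \<in> A" "(j, V, B) \<in> A" "u \<in> C" "u \<in> B" "p = proj i u" "q = proj j u"
        using PE by meson
      then show "(q, p) \<in> P" using PI[of j V B i W C u] by simp
    qed
    show "single_valued (hol p q)" "(p, q) \<in> hol p q" if pq: "(p, q) \<in> P" for p q
    proof -
      obtain i W C j V B u where u: "(i, W, C) \<in> A" "(j, V, B) \<in> A" "u \<in> C" "u \<in> B" "p = proj i u" "q = proj j u"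
        using PE[OF pq] by blast
      have ij: "i \<in> indices F" "j \<in> indices F" "u \<in> flow_box F i \<inter> flow_box F j"
        using A(2)[OF u(1)] A(2)[OF u(2)] u(3,4) by blast+
      show "single_valued (hol p q)"
        using holonomy_map_single_valued[OF ij(1,2)] unfolding hol_def u(5,6) by simp
      show "(p, q) \<in> hol p q"
        using ij(3) unfolding hol_def u(5,6) holonomy_map_eq by simp
    qed
    show "hol q p = (hol p q)\<inverse>" for p q unfolding hol_def by (simp add: holonomy_map_converse)
    show "\<exists>\<eta>>0. \<forall>(p, q)\<in>P. \<exists>s\<in>S'. (p, q) \<in> s \<and>
        (\<forall>x\<in>mball_of \<mu> p \<eta>. \<exists>x'. (x, x') \<in> hol p q \<inter> s \<and> mdist \<mu> q x' < \<epsilon>)" if \<epsilon>: "0 < \<epsilon>" for \<epsilon>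
    proof -
      \<comment> \<open>The constant depends only on the two pieces, and there are finitely many
        pairs of pieces; this makes it uniform over all of \<open>P\<close>.\<close>
      let ?R = "\<lambda>((i, W, C), (j, V, B)) \<eta>. \<forall>u\<in>C \<inter> B. \<exists>s\<in>S'. (proj i u, proj j u) \<in> s \<and>
         (\<forall>x\<in>mball_of \<mu> (proj i u) \<eta>. \<exists>x'. (x, x') \<in> holonomy_map F i j \<inter> s \<and> mdist \<mu> (proj j u) x' < \<epsilon>)"
      have "\<exists>\<eta>>0. \<forall>a\<in>A \<times> A. ?R a \<eta>"
      proof (rule finite_uniform_bound)
        show "finite (A \<times> A)" using A(1) by simp
        show "\<exists>\<eta>>0. ?R a \<eta>" if "a \<in> A \<times> A" for a
        proof -
          obtain i W C j V B where a: "a = ((i, W, C), (j, V, B))" by (metis prod.collapse)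
          have 1: "i \<in> indices F" "compactin X C" "C \<subseteq> flow_box F i"
            and 2: "j \<in> indices F" "closedin X B" "B \<subseteq> flow_box F j"
            using A(2)[of i W C] A(2)[of j V B] \<open>a \<in> A \<times> A\<close> unfolding a by blast+
          have c: "compactin X (C \<inter> B)" using 1(2) 2(2) by (rule compact_Int_closedin)
          have s: "C \<inter> B \<subseteq> flow_box F i \<inter> flow_box F j" using 1(3) 2(3) by blast
          show ?thesis unfolding a prod.case by (rule holonomy_uniform[OF \<mu> 1(1) 2(1) c s germ[OF 1(1) 2(1)] \<epsilon>])
        qed
        show "?R a \<delta>'" if "?R a \<delta>" "0 < \<delta>'" "\<delta>' \<le> \<delta>" for a \<delta> \<delta>'
        proof -
          obtain i W C j V B where a: "a = ((i, W, C), (j, V, B))" by (metis prod.collapse)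
          have "mball_of \<mu> p \<delta>' \<subseteq> mball_of \<mu> p \<delta>" for p using that(3) by auto
          then show ?thesis using that(1) unfolding a prod.case by (meson subsetD)
        qed
      qed
      then obtain \<eta> where \<eta>: "\<eta> > 0" "\<forall>a\<in>A \<times> A. ?R a \<eta>" by blast
      have "\<exists>s\<in>S'. (p, q) \<in> s \<and> (\<forall>x\<in>mball_of \<mu> p \<eta>. \<exists>x'. (x, x') \<in> hol p q \<inter> s \<and> mdist \<mu> q x' < \<epsilon>)"
        if pq: "(p, q) \<in> P" for p q
      proof -
        obtain i W C j V B u where u: "(i, W, C) \<in> A" "(j, V, B) \<in> A" "u \<in> C" "u \<in> B" "p = proj i u" "q = proj j u"
          using PE[OF pq] by blast
        have "?R ((i, W, C), (j, V, B)) \<eta>" using \<eta>(2) u(1,2) by blast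
        then show ?thesis using u(3-6) unfolding hol_def by simp
      qed
      then show ?thesis using \<eta>(1) by blast
    qed
  qed
  obtain i W C where iWC: "(i, W, C) \<in> A" "y \<in> W"
    using A(3) y by (metis in_closure_of)
  have i: "i \<in> indices F" "openin X W" "W \<subseteq> C" "C \<subseteq> flow_box F i" using A(2)[OF iWC(1)] by blast+
  have yi: "y \<in> flow_box F i" using iWC(2) i by blast
  have "openin ?T (proj i ` W)" using proj_open[OF i(1,2)] i(3,4) by (simp add: inf_absorb1)
  then obtain r where r: "r > 0" "\<forall>x\<in>mspace \<mu>. mdist \<mu> (proj i y) x < r \<longrightarrow> x \<in> proj i ` W"
    using iWC(2) unfolding \<mu>[symmetric] openin_mtopology_of by blast
  have zM: "proj i y \<in> mspace \<mu>" unfolding sp by (rule proj_mem[OF i(1) yi])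
  have chains: "(proj i u, proj j v) \<in> P\<^sup>*"
    if u: "u \<in> L" "u \<in> C" and v: "v \<in> L" "(j, V, B) \<in> A" "v \<in> B" for u v j V B
  proof -
    \<comment> \<open>The predicate demands a chain to \<open>v\<close> as seen through every piece
      containing it. Pieces through a common point are one \<open>P\<close>-step apart, so a single
      piece decides (\<open>iff\<close>); along a plaque the projection of that piece is constant,
      which makes the predicate locally constant on the leaf.\<close>
    let ?Q = "\<lambda>v. \<forall>(j, V, B)\<in>A. v \<in> B \<longrightarrow> (proj i u, proj j v) \<in> P\<^sup>*"
    have "?Q u \<longleftrightarrow> ?Q v"
    proof (rule leaf_locally_constant[OF L u(1) v(1)])
      fix x assume "x \<in> topspace X"
      then obtain l V B where l: "(l, V, B) \<in> A" "x \<in> V" using A(3) by blast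
      have l': "l \<in> indices F" "openin X V" "V \<subseteq> B" "B \<subseteq> flow_box F l" using A(2)[OF l(1)] by blast+
      have iff: "?Q a \<longleftrightarrow> (proj i u, proj l a) \<in> P\<^sup>*" if a: "a \<in> B" for a
      proof
        show "(proj i u, proj l a) \<in> P\<^sup>*" if "?Q a" using that l(1) a by blast
        assume 1: "(proj i u, proj l a) \<in> P\<^sup>*"
        show "?Q a" using PI[OF l(1) _ a] rtrancl_into_rtrancl[OF 1] by blast
      qed
      have eq: "?Q a \<longleftrightarrow> ?Q x" if a: "a \<in> V \<inter> plaque l x" for a
      proof -
        have "proj l a = proj l x" "a \<in> B" "x \<in> B" using a l(2) l'(3) by (auto simp: plaque_def)
        then show ?thesis using iff by simp
      qed
      have xl: "x \<in> flow_box F l" using l(2) l'(3,4) by blast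
      show "\<exists>j\<in>indices F. \<exists>W. x \<in> flow_box F j \<and> openin X W \<and> x \<in> W \<and> (\<forall>y\<in>W \<inter> plaque j x. ?Q y \<longleftrightarrow> ?Q x)"
        by (intro bexI[of _ l] exI[of _ V] conjI ballI eq xl l' l(2))
    qed
    moreover have "?Q u" using PI[OF iWC(1) _ u(2)] by blast
    ultimately show ?thesis using v(2,3) by blast
  qed
  have MX: "closedin X ?M" by simp
  have "\<exists>w\<in>proj i ` (L \<inter> W). \<exists>g. local_homeomorphism (mtopology_of \<mu>) g \<and> (w, proj i y) \<in> g \<and>
      (\<forall>(x, x')\<in>g. x \<in> transverse_trace ?M \<longleftrightarrow> x' \<in> transverse_trace ?M)"
  proof (rule chain_limit[OF zM r(1)])
    show "mball_of \<mu> (proj i y) r \<subseteq> K"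
    proof
      fix x assume "x \<in> mball_of \<mu> (proj i y) r"
      then have "x \<in> proj i ` W" using r(2) by simp
      then show "x \<in> K" using KI[OF iWC(1)] i(3) by blast
    qed
    show "proj i ` (L \<inter> W) \<subseteq> K" using KI[OF iWC(1)] i(3) by blast
    show "(p, q) \<in> P\<^sup>*" if pq: "p \<in> proj i ` (L \<inter> W)" "q \<in> proj i ` (L \<inter> W)" for p q
    proof -
      obtain u v where u: "u \<in> L" "u \<in> W" "p = proj i u" and v: "v \<in> L" "v \<in> W" "q = proj i v"
        using pq by blast
      show ?thesis
        unfolding u(3) v(3) by (rule chains[OF u(1) subsetD[OF i(3) u(2)] v(1) iWC(1) subsetD[OF i(3) v(2)]])
    qed
    show "\<exists>p\<in>proj i ` (L \<inter> W). mdist \<mu> p (proj i y) < \<epsilon>" if \<epsilon>: "0 < \<epsilon>" for \<epsilon>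
    proof -
      \<comment> \<open>Points of \<open>W\<close> whose plaque is close to that of \<open>y\<close>
        form a neighbourhood of \<open>y\<close>, so the leaf meets it.\<close>
      let ?U = "{u \<in> flow_box F i. proj i u \<in> mball_of \<mu> (proj i y) \<epsilon>} \<inter> W"
      have "openin ?T (mball_of \<mu> (proj i y) \<epsilon>)" using openin_mball_of[of \<mu>] \<mu> by simp
      then have "openin X ?U" using proj_vimage_open[OF i(1)] i(2) by blast
      moreover have "y \<in> ?U" using yi zM \<epsilon> iWC(2) by simp
      ultimately obtain u where "u \<in> L" "u \<in> ?U" using y unfolding in_closure_of by meson
      then have "mdist \<mu> (proj i u) (proj i y) < \<epsilon>" "proj i u \<in> proj i ` (L \<inter> W)"
        by (simp_all add: mdist_commute)
      then show ?thesis by (rule bexI)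
    qed
    show "closedin (mtopology_of \<mu>) (transverse_trace ?M)"
      unfolding \<mu> by (rule transverse_trace_closed[OF M MX])
    show "x \<in> transverse_trace ?M \<longleftrightarrow> x' \<in> transverse_trace ?M" if pq: "(p, q) \<in> P" "(x, x') \<in> hol p q" for p q x x'
    proof -
      obtain l W C j V B u where u: "(l, W, C) \<in> A" "(j, V, B) \<in> A" "p = proj l u" "q = proj j u"
        using PE[OF pq(1)] by blast
      have lj: "l \<in> indices F" "j \<in> indices F" using A(2)[OF u(1)] A(2)[OF u(2)] by blast+
      obtain v where "v \<in> flow_box F l" "v \<in> flow_box F j" "x = proj l v" "x' = proj j v"
        using pq(2) unfolding hol_def u(3,4) holonomy_map_eq by auto
      then show ?thesis using proj_in_transverse_trace[OF M] lj by simp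
    qed
  qed
  then obtain w g where w: "w \<in> L" "w \<in> W" and g: "local_homeomorphism ?T g" "(proj i w, proj i y) \<in> g"
      "\<And>x x'. (x, x') \<in> g \<Longrightarrow> x \<in> transverse_trace ?M \<longleftrightarrow> x' \<in> transverse_trace ?M"
    unfolding \<mu> by blast
  have "w \<in> ?M" using w(1) leaf_subset[OF L] closure_of_subset by blast
  \<comment> \<open>\<open>w\<close> and \<open>y\<close> lie in the same box \<open>i\<close>, so
    one box map over \<open>g\<close>, with a suitable translation, takes \<open>w\<close> to
    \<open>y\<close>.\<close>
  then have "locally_homogeneous_pair (subtopology X ?M) w y"
    using box_map_homogeneous_pair[OF M i(1) g(1) g(3) _ _ y yi g(2)] w(2) i(3,4) by blast
  then show ?thesis using w(1) by blast
qed

end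

theorem theorem17p6:
  fixes X :: "'x topology"
    and F :: "('x, 'n::finite, 'i, 'z) flow_box_cover"
    and k :: enat
  assumes "foliated_space k X F"
    and "compact_space X"
    and "strongly_equicontinuous_foliation F"
    and "quasi_effective_foliation F"
    and "L \<in> leaves X F"
  shows "homogeneous_space (subtopology X (X closure_of L))"
proof -
  interpret foliation k X F by unfold_locales fact
  let ?M = "X closure_of L"
  have top: "topspace (subtopology X ?M) = ?M"
    using closure_of_subset_topspace[of X L] by (simp add: inf_absorb2)
  have LM: "L \<subseteq> ?M" using leaf_subset[OF assms(5)] closure_of_subset by blast
  have M: "saturated ?M"
    unfolding saturated_def using closure_of_subset_topspace[of X L] closure_leaf_saturated[OF assms(5)] by metis
  have "L \<noteq> {}"
    using assms(5) unfolding leaves_def by (rule nonempty_connected_components_of)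
  show ?thesis
  proof (rule homogeneous_spaceI)
    show "topspace (subtopology X ?M) \<noteq> {}" unfolding top using LM \<open>L \<noteq> {}\<close> by blast
    fix x y assume "x \<in> topspace (subtopology X ?M)" "y \<in> topspace (subtopology X ?M)"
    then have xy: "x \<in> ?M" "y \<in> ?M" unfolding top by auto
    obtain u where u: "u \<in> L" "locally_homogeneous_pair (subtopology X ?M) u x"
      using leaf_closure_homogeneous_pair[OF assms(2,3,5) M xy(1)] by blast
    obtain v where v: "v \<in> L" "locally_homogeneous_pair (subtopology X ?M) v y"
      using leaf_closure_homogeneous_pair[OF assms(2,3,5) M xy(2)] by blast
    have "locally_homogeneous_pair (subtopology X ?M) u v"
      by (rule leaf_homogeneous_pair[OF M assms(5) LM u(1) v(1)])
    then show "locally_homogeneous_pair (subtopology X ?M) x y"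
      using u(2) v(2) locally_homogeneous_pair_sym locally_homogeneous_pair_trans by metis
  qed
qed

end
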